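(* Let $p$ be an odd prime number with $p<2^5$. (1) There is no subset $S\subset\mathbb Z_p$ with at most $\lfloor\log_2 p\rfloor+1$ elements such that the $\mathcal R$-palette graph $G_S$ includes a connected $\mathcal R$-subgraph with at least $\lfloor\log_2 p\rfloor+2$ vertices. This implies that $\mathrm{mincol}^{\mathrm{Dehn}}_p(K)\ge\lfloor\log_2 p\rfloor+2$ for any Dehn $p$-colorable knot $K$. (2) If there exists a nontrivially Dehn $p$-colored diagram $(D,C)$ of a knot such that $\#\mathcal C(D,C)=\lfloor\log_2 p\rfloor+2$, then (i) $\mathcal C(D,C)\sim\{0,1,2\}$ when $p=3$; (ii) $\mathcal C(D,C)\sim\{0,1,2,3\}$ when $p=5$; (iii) $\mathcal C(D,C)\sim\{0,1,2,4\}$ when $p=7$; (iv) $\mathcal C(D,C)\sim\{0,1,2,3,6\}$ or $\{0,1,2,4,7\}$ when $p=11$; (v) $\mathcal C(D,C)\sim\{0,1,2,4,7\}$ when $p=13$; (vi) $\mathcal C(D,C)\sim\{0,1,2,3,5,9\}$, $\{0,1,2,3,5,10\}$, $\{0,1,2,3,5,12\}$, $\{0,1,2,3,6,9\}$, $\{0,1,2,3,6,10\}$, $\{0,1,2,3,6,11\}$, $\{0,1,2,3,6,13\}$, $\{0,1,2,3,7,11\}$, $\{0,1,2,4,5,9\}$, $\{0,1,2,4,5,10\}$, $\{0,1,2,4,5,12\}$, or $\{0,1,2,4,10,13\}$ when $p=17$; (vii) $\mathcal C(D,C)\sim\{0,1,2,3,5,10\}$, $\{0,1,2,3,6,10\}$,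 $\{0,1,2,3,6,11\}$, $\{0,1,2,3,6,12\}$, $\{0,1,2,3,6,13\}$, $\{0,1,2,3,6,14\}$, $\{0,1,2,3,7,12\}$, $\{0,1,2,4,5,10\}$, $\{0,1,2,4,5,14\}$, $\{0,1,2,4,7,12\}$, or $\{0,1,2,4,7,15\}$ when $p=19$; (viii) $\mathcal C(D,C)\sim\{0,1,2,3,6,12\}$, $\{0,1,2,4,7,12\}$, $\{0,1,2,4,7,13\}$, $\{0,1,2,4,7,14\}$, $\{0,1,2,4,9,14\}$, or $\{0,1,2,4,10,19\}$ when $p=23$; (ix) $\mathcal C(D,C)\sim\{0,1,2,4,8,15\}$ when $p=29$; and (x) $\mathcal C(D,C)\sim\{0,1,2,4,8,16\}$ when $p=31$.
   Context: $\mathbb Z_p=\mathbb Z/p\mathbb Z$. Two subsets $S,S'\subset\mathbb Z_p$ are affine equivalent, written $S\sim S'$, if $S'=sS+t$ for some $s\in\mathbb Z_p^\times$, $t\in\mathbb Z_p$. Dehn colorings: let $D$ be a diagram of a knot $K$, and let $\mathcal R(D)$ be the set of regions of $D$ (connected components of the complement of the underlying immersed curve). At each crossing the four surrounding regions are named $x_1,x_2,x_3,x_4$ (not necessarily distinct) so that $x_2$ is adjacent to $x_1$ across an under-arc, $x_3$ is adjacent to $x_1$ across the over-arc, and $x_4$ is opposite to $x_1$. A Dehn $p$-coloring of $D$ is a map $C:\mathcal R(D)\to\mathbb Z_p$ such that $C(x_1)+C(x_3)=C(x_2)+C(x_4)$ at each crossing. A crossing is trivially colored if $C(x_1)=C(x_4)$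 and $C(x_3)=C(x_2)$ there; $C$ is trivial if every crossing is trivially colored, and nontrivial otherwise. A nontrivially Dehn $p$-colored diagram is a pair $(D,C)$ with $C$ a nontrivial Dehn $p$-coloring of $D$, and $\mathcal C(D,C)=\mathrm{Im}\,C$. A knot $K$ is Dehn $p$-colorable if some diagram of $K$ has a nontrivial Dehn $p$-coloring; then $\mathrm{mincol}^{\mathrm{Dehn}}_p(K)$ is the minimum of $\#\mathcal C(D,C)$ over all nontrivially Dehn $p$-colored diagrams $(D,C)$ of $K$. Palette graphs: let $\emptyset\neq S\subset\mathbb Z_p$. Let $\mu(S)=\{\{a_1,a_2\}\mid a_1,a_2\in S\}$ be the set of two-element multisets from $S$ (the multiset $\{a_1,a_1\}$ is allowed). Put $\{a_1,a_2\}\sim\{a_3,a_4\}$ if $a_1+a_2=a_3+a_4$ in $\mathbb Z_p$, and write $\overline{a_1+a_2}$ for the equivalence class of $\{a_1,a_2\}$ (so classes are identified with the elements $b=a_1+a_2$ of $\mathbb Z_p$). The $\mathcal R$-palette graph of $S$ is the simple graph $G_S=(V_S,E_S)$ with vertex set $V_S=\mu(S)/\!\sim$, in which two distinct vertices $\overline{b_1},\overline{b_2}$ are joined by an edge if and only if there exist $\{a_1,a_2\}\in\overline{b_1}$ and $\{a_3,a_4\}\in\overline{b_2}$ with $a_1+a_3=a_2+a_4$ or $a_1+a_4=a_2+a_3$ in $\mathbb Z_p$. The edge between $\overline{b_1}$ and $\overline{b_2}$ carries the label $\overline{2^{-1}(b_1+b_2)}$, where $2^{-1}(b_1+b_2)\in\mathbb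 Z_p$. An $\mathcal R$-subgraph of $G_S$ is a subgraph $G=(V,E)$ of $G_S$ such that for every edge $e\in E$ joining $\overline{b_1}$ and $\overline{b_2}$, its label satisfies $\overline{2^{-1}(b_1+b_2)}\in V$. *)

theory Defs
  imports
    "HOL-Analysis.Analysis"
    "HOL-Library.Multiset"
    "HOL-Number_Theory.Number_Theory"
    "HOL-Number_Theory.Modular_Inverse"
begin

section \<open>Subsets of \<open>\<int>/p\<int>\<close>\<close>

text \<open>Elements of \<open>\<int>/p\<int>\<close> are represented by the integers in \<open>{0..<p}\<close>, and equations in
  \<open>\<int>/p\<int>\<close> by congruences.\<close>

definition residues_mod :: "nat \<Rightarrow> int set" where
  "residues_mod p = {0..<int p}"

definition affine_equiv :: "nat \<Rightarrow> int set \<Rightarrow> int set \<Rightarrow> bool" where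
  "affine_equiv p S S' \<longleftrightarrow>
     (\<exists>s\<in>residues_mod p. \<exists>t\<in>residues_mod p. coprime s (int p) \<and>
        S' = (\<lambda>x. (s * x + t) mod int p) ` S)"


section \<open>Palette graphs\<close>

text \<open>A simple graph is a pair of its vertex set and its edge set, the edges being two-element
  sets of vertices.\<close>

type_synonym 'v sgraph = "'v set \<times> 'v set set"

definition subgraph_of :: "'v sgraph \<Rightarrow> 'v sgraph \<Rightarrow> bool" where
  "subgraph_of G H \<longleftrightarrow> fst G \<subseteq> fst H \<and> snd G \<subseteq> snd H \<and> (\<forall>e\<in>snd G. e \<subseteq> fst G)"

definition connected_sgraph :: "'v sgraph \<Rightarrow> bool" where
  "connected_sgraph G \<longleftrightarrow> fst G \<noteq> {} \<and>
     (\<forall>u\<in>fst G. \<forall>v\<in>fst G. (u, v) \<in> {(x, y). {x, y} \<in> snd G}\<^sup>*)"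

definition two_multisets :: "int set \<Rightarrow> int multiset set" where
  "two_multisets S = {{#a1, a2#} | a1 a2. a1 \<in> S \<and> a2 \<in> S}"

definition sum_rel :: "nat \<Rightarrow> int set \<Rightarrow> int multiset rel" where
  "sum_rel p S = {(m, m'). m \<in> two_multisets S \<and> m' \<in> two_multisets S \<and>
     [\<Sum>\<^sub># m = \<Sum>\<^sub># m'] (mod int p)}"

definition palette_vertices :: "nat \<Rightarrow> int set \<Rightarrow> int multiset set set" where
  "palette_vertices p S = two_multisets S // sum_rel p S"

text \<open>The class written \<open>b\<close> with an overline.  It is empty, and hence not a vertex, if \<open>b\<close> is
  not the sum of two elements of \<open>S\<close>.\<close>

definition sum_class :: "nat \<Rightarrow> int set \<Rightarrow> int \<Rightarrow> int multiset set" where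
  "sum_class p S b = {m \<in> two_multisets S. [\<Sum>\<^sub># m = b] (mod int p)}"

definition palette_edges :: "nat \<Rightarrow> int set \<Rightarrow> int multiset set set set" where
  "palette_edges p S = {{A, B} | A B.
     A \<in> palette_vertices p S \<and> B \<in> palette_vertices p S \<and> A \<noteq> B \<and>
     (\<exists>a1 a2 a3 a4. {#a1, a2#} \<in> A \<and> {#a3, a4#} \<in> B \<and>
        ([a1 + a3 = a2 + a4] (mod int p) \<or> [a1 + a4 = a2 + a3] (mod int p)))}"

definition palette_graph :: "nat \<Rightarrow> int set \<Rightarrow> int multiset set sgraph" where
  "palette_graph p S = (palette_vertices p S, palette_edges p S)"

text \<open>A nonempty class determines \<open>b\<close> modulo \<open>p\<close>, so the label of an edge does not depend on
  the choice of \<open>b1\<close> and \<open>b2\<close>.\<close>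

definition R_subgraph :: "nat \<Rightarrow> int set \<Rightarrow> int multiset set sgraph \<Rightarrow> bool" where
  "R_subgraph p S G \<longleftrightarrow> subgraph_of G (palette_graph p S) \<and>
     (\<forall>b1 b2. {sum_class p S b1, sum_class p S b2} \<in> snd G \<longrightarrow>
        sum_class p S (modular_inverse (int p) 2 * (b1 + b2)) \<in> fst G)"


section \<open>Knots and their diagrams\<close>

definition smooth_curve :: "(real \<Rightarrow> 'a::real_normed_vector) \<Rightarrow> bool" where
  "smooth_curve g \<longleftrightarrow> (\<exists>d :: nat \<Rightarrow> real \<Rightarrow> 'a. d 0 = g \<and>
     (\<forall>n t. (d n has_vector_derivative d (Suc n) t) (at t)))"

abbreviation velocity :: "(real \<Rightarrow> 'a::real_normed_vector) \<Rightarrow> real \<Rightarrow> 'a" where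
  "velocity g t \<equiv> vector_derivative g (at t)"

text \<open>An immersion of the circle \<open>\<real>/\<int>\<close>, written as a 1-periodic function on the line.\<close>

definition immersed_circle :: "(real \<Rightarrow> 'a::real_normed_vector) \<Rightarrow> bool" where
  "immersed_circle g \<longleftrightarrow> smooth_curve g \<and> (\<forall>t. g (t + 1) = g t) \<and> (\<forall>t. velocity g t \<noteq> 0)"

text \<open>Three-space is written as plane times height, and knots are projected to the plane by
  \<^const>\<open>fst\<close>.\<close>

type_synonym space = "complex \<times> real"

definition knot_parametrization :: "(real \<Rightarrow> space) \<Rightarrow> bool" where
  "knot_parametrization g \<longleftrightarrow> immersed_circle g \<and> inj_on g {0..<1}"

definition knot :: "space set \<Rightarrow> bool" where
  "knot K \<longleftrightarrow> (\<exists>g. knot_parametrization g \<and> K = range g)"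

definition ambient_isotopic :: "space set \<Rightarrow> space set \<Rightarrow> bool" where
  "ambient_isotopic K K' \<longleftrightarrow> (\<exists>f.
     homotopic_with_canon (\<lambda>h. \<exists>h'. homeomorphism UNIV UNIV h h') UNIV UNIV id f \<and> f ` K = K')"

definition double_points :: "(real \<Rightarrow> complex) \<Rightarrow> (real \<times> real) set" where
  "double_points c = {(s, t). s \<in> {0..<1} \<and> t \<in> {0..<1} \<and> s \<noteq> t \<and> c s = c t}"

text \<open>A diagram consists of its underlying immersed curve and of the pairs \<open>(s, t)\<close> of parameters
  of its crossings, where \<open>s\<close> belongs to the over-arc and \<open>t\<close> to the under-arc.\<close>

record diagram =
  strand :: "real \<Rightarrow> complex"
  crossings :: "(real \<times> real) set"

text \<open>The only multiple points are finitely many transverse double points.  The imaginary part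
  below is the determinant of the two velocity vectors.\<close>

definition knot_diagram :: "diagram \<Rightarrow> bool" where
  "knot_diagram D \<longleftrightarrow>
     immersed_circle (strand D) \<and>
     finite (double_points (strand D)) \<and>
     (\<forall>z. card {t \<in> {0..<1}. strand D t = z} \<le> 2) \<and>
     (\<forall>(s, t) \<in> double_points (strand D).
        Im (cnj (velocity (strand D) s) * velocity (strand D) t) \<noteq> 0) \<and>
     crossings D \<subseteq> double_points (strand D) \<and>
     (\<forall>(s, t) \<in> double_points (strand D). (s, t) \<in> crossings D \<longleftrightarrow> (t, s) \<notin> crossings D)"

definition diagram_of :: "space set \<Rightarrow> diagram \<Rightarrow> bool" where
  "diagram_of K D \<longleftrightarrow> knot_diagram D \<and>
     (\<exists>g. knot_parametrization g \<and> ambient_isotopic K (range g) \<and>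
        (\<forall>t. fst (g t) = strand D t) \<and>
        (\<forall>(s, t) \<in> crossings D. snd (g t) < snd (g s)))"

definition regions :: "diagram \<Rightarrow> complex set set" where
  "regions D = components (- range (strand D))"


section \<open>Dehn colorings\<close>

text \<open>The two strands at a crossing bound four sectors, indexed by the signs \<open>\<sigma>\<close> and \<open>\<tau>\<close> of the
  coordinates along the over-arc and the under-arc: changing \<open>\<tau>\<close> crosses the over-arc and
  changing \<open>\<sigma>\<close> crosses the under-arc.  A region contains a sector near the crossing if it contains
  the initial part of a ray into the interior of the sector.\<close>

definition sector_region :: "diagram \<Rightarrow> real \<times> real \<Rightarrow> real \<Rightarrow> real \<Rightarrow> complex set \<Rightarrow> bool" where
  "sector_region D x \<sigma> \<tau> R \<longleftrightarrow> R \<in> regions D \<and>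
     (\<forall>\<^sub>F \<epsilon> in at_right 0. strand D (fst x) +
        \<epsilon> *\<^sub>R (\<sigma> *\<^sub>R velocity (strand D) (fst x) + \<tau> *\<^sub>R velocity (strand D) (snd x)) \<in> R)"

text \<open>\<open>x2\<close> is adjacent to \<open>x1\<close> across an under-arc, \<open>x3\<close> is adjacent to \<open>x1\<close> across the over-arc,
  and \<open>x4\<close> is opposite to \<open>x1\<close>.\<close>

definition crossing_regions ::
  "diagram \<Rightarrow> real \<times> real \<Rightarrow> complex set \<Rightarrow> complex set \<Rightarrow> complex set \<Rightarrow> complex set \<Rightarrow> bool" where
  "crossing_regions D x x1 x2 x3 x4 \<longleftrightarrow> (\<exists>\<sigma>\<in>{1, -1}. \<exists>\<tau>\<in>{1, -1}.
     sector_region D x \<sigma> \<tau> x1 \<and> sector_region D x (- \<sigma>) \<tau> x2 \<and>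
     sector_region D x \<sigma> (- \<tau>) x3 \<and> sector_region D x (- \<sigma>) (- \<tau>) x4)"

definition dehn_coloring :: "nat \<Rightarrow> diagram \<Rightarrow> (complex set \<Rightarrow> int) \<Rightarrow> bool" where
  "dehn_coloring p D C \<longleftrightarrow> C ` regions D \<subseteq> residues_mod p \<and>
     (\<forall>x\<in>crossings D. \<forall>x1 x2 x3 x4. crossing_regions D x x1 x2 x3 x4 \<longrightarrow>
        [C x1 + C x3 = C x2 + C x4] (mod int p))"

definition trivially_colored :: "diagram \<Rightarrow> (complex set \<Rightarrow> int) \<Rightarrow> real \<times> real \<Rightarrow> bool" where
  "trivially_colored D C x \<longleftrightarrow> (\<forall>x1 x2 x3 x4. crossing_regions D x x1 x2 x3 x4 \<longrightarrow>
     C x1 = C x4 \<and> C x3 = C x2)"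

definition nontrivial_dehn_coloring :: "nat \<Rightarrow> diagram \<Rightarrow> (complex set \<Rightarrow> int) \<Rightarrow> bool" where
  "nontrivial_dehn_coloring p D C \<longleftrightarrow>
     dehn_coloring p D C \<and> \<not> (\<forall>x\<in>crossings D. trivially_colored D C x)"

definition colors :: "diagram \<Rightarrow> (complex set \<Rightarrow> int) \<Rightarrow> int set" where
  "colors D C = C ` regions D"

definition dehn_colorable :: "nat \<Rightarrow> space set \<Rightarrow> bool" where
  "dehn_colorable p K \<longleftrightarrow> (\<exists>D C. diagram_of K D \<and> nontrivial_dehn_coloring p D C)"

definition mincol_dehn :: "nat \<Rightarrow> space set \<Rightarrow> nat" where
  "mincol_dehn p K =
     (LEAST n. \<exists>D C. diagram_of K D \<and> nontrivial_dehn_coloring p D C \<and> n = card (colors D C))"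

end

theory Submission
  imports Defs
begin

text \<open>
  Call a set \<open>S\<close> of residues rigid if no nonconstant map from \<open>S\<close> to \<open>\<int>/2\<int>\<close> respects all
  relations \<open>a + b = c + d\<close> in \<open>S\<close>.  Suppose that \<open>S\<close> is not rigid, and let \<open>S = A \<union> B\<close> be the
  corresponding partition.  In a connected \<open>\<R>\<close>-subgraph either every vertex is a sum of an element
  of \<open>A\<close> and an element of \<open>B\<close>, and then translating \<open>B\<close> until it meets \<open>A\<close> produces a smaller
  set with the same graph, or every edge comes from \<open>A\<close> alone or from \<open>B\<close> alone.  For a coloring
  of a knot the latter means that all colors in use lie in \<open>A\<close> or all lie in \<open>B\<close>; for an abstract
  subgraph with at most five colors a short case analysis applies.  By induction only rigid sets
  matter.  An exhaustive search, after normalizing a three-term progression to \<open>{0, 1, 2}\<close> or a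
  relation \<open>0 + (e + 1) = 1 + e\<close> in its absence, shows that the rigid sets of the critical size are
  the listed ones and, for \<open>p = 17, 19, 23\<close>, one further class whose palette graph has no connected
  \<open>\<R>\<close>-subgraph.

  A knot diagram gives such a subgraph: by transversality each arc has two well-defined sides and
  each crossing four sectors, so the sum of the colors on the two sides is constant along over-arcs
  and changes along an edge of the palette graph at each undercrossing.
\<close>

section \<open>Search for rigid sets\<close>

text \<open>An edge of the palette graph is a relation a1 + a3 = a2 + a4 in S: its ends are a1 + a2
  and a3 + a4, and its label is the common value a1 + a3, because twice that value is the sum of the
  ends. A map to Z/2Z that respects the relation therefore takes equal values on the two ends, which
  makes partitions the natural obstruction to connectedness.

  The lower bound is a consequence of the classification. A rigid set with at least two and fewer
  than p elements stays rigid when a suitable new element a + b - c is adjoined. A rigid set below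
  the critical size would thus grow to a classified set, and at the last step it would be such a set
  with one point removed; all of these are checked to be parted.

  The obstacle is a palette whose vertices are all sums within the parts. Vertices are only sums,
  and a sum from one part may also arise from the same or another pair of the other part only as a
  residue, so an abstract subgraph may combine edges of both parts. A coloring remembers the pair of
  colors at each arc and cannot change parts.\<close>

definition sumset :: "int \<Rightarrow> int set \<Rightarrow> int set \<Rightarrow> int set" where
  "sumset p A B = (\<lambda>(a, b). (a + b) mod p) ` (A \<times> B)"

text \<open>The map to \<open>\<int>/2\<int>\<close> is encoded by its fibres.  They are disjoint: a common element \<open>x\<close> would
  make \<open>x + x\<close> a forbidden sum.\<close>

definition parted :: "int \<Rightarrow> int set \<Rightarrow> bool" where
  "parted p S \<longleftrightarrow> (\<exists>A B. A \<union> B = S \<and> A \<noteq> {} \<and> B \<noteq> {} \<and>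
     sumset p A B \<inter> (sumset p A A \<union> sumset p B B) = {})"

definition ap_free :: "int \<Rightarrow> int set \<Rightarrow> bool" where
  "ap_free p S \<longleftrightarrow> (\<forall>x\<in>S. \<forall>y\<in>S. \<forall>z\<in>S. (x + y) mod p = (z + z) mod p \<longrightarrow> x = y)"

text \<open>The functions of the search are evaluated by the simplifier, which rewrites the condition of
  an \<open>if\<close> before its branches, but both arguments of a conjunction.\<close>

fun add_mod :: "int \<Rightarrow> int \<Rightarrow> int \<Rightarrow> int" where
  "add_mod p x y = (if x + y < p then x + y else x + y - p)"

fun elem :: "int \<Rightarrow> int list \<Rightarrow> bool" where
  "elem x [] = False"
| "elem x (y # ys) = (if x = y then True else elem x ys)"

fun disj :: "int list \<Rightarrow> int list \<Rightarrow> bool" where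
  "disj [] ys = True"
| "disj (x # xs) ys = (if elem x ys then False else disj xs ys)"

fun shift :: "int \<Rightarrow> int \<Rightarrow> int list \<Rightarrow> int list" where
  "shift p c [] = []"
| "shift p c (x # xs) = add_mod p c x # shift p c xs"

text \<open>A state \<open>(A, B, E, Q)\<close> is a partition into \<open>A\<close> and \<open>B\<close> together with the sums \<open>E\<close> within a
  part and the sums \<open>Q\<close> across the parts.  The trivial partition, with \<open>B\<close> empty, is kept among the
  states.\<close>

type_synonym state = "int list \<times> int list \<times> int list \<times> int list"

text \<open>Here \<open>cA\<close> and \<open>cB\<close> hold the sums of the new element with the
  two parts, and c + c is already contained in the one for the part that receives c. The new sums
  are compared with the old ones only; \<open>translate_disjoint\<close> settles the comparison
  among the new ones.\<close>

fun place_left :: "int \<Rightarrow> int list \<Rightarrow> int list \<Rightarrow> int list \<Rightarrow> int list \<Rightarrow> int list \<Rightarrow> int list \<Rightarrow>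
    state list \<Rightarrow> state list" where
  "place_left c A B E Q cA cB r =
     (if disj cB E then (if disj cA Q then (c # A, B, cA @ E, cB @ Q) # r else r) else r)"

fun place_right :: "int \<Rightarrow> int list \<Rightarrow> int list \<Rightarrow> int list \<Rightarrow> int list \<Rightarrow> int list \<Rightarrow> int list \<Rightarrow>
    state list \<Rightarrow> state list" where
  "place_right c A B E Q cA cB r =
     (if disj cA E then (if disj cB Q then (A, c # B, cB @ E, cA @ Q) # r else r) else r)"

fun place :: "int \<Rightarrow> int \<Rightarrow> int list \<Rightarrow> int list \<Rightarrow> int list \<Rightarrow> int list \<Rightarrow> int list \<Rightarrow> int list \<Rightarrow>
    state list \<Rightarrow> state list" where
  "place c cc A B E Q cA cB r =
     place_left c A B E Q (cc # cA) cB (place_right c A B E Q cA (cc # cB) r)"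

fun extend :: "int \<Rightarrow> int \<Rightarrow> state list \<Rightarrow> state list" where
  "extend p c [] = []"
| "extend p c ((A, B, E, Q) # ss) =
     place c (add_mod p c c) A B E Q (shift p c A) (shift p c B) (extend p c ss)"

text \<open>For the last element only the existence of a nontrivial extension matters, so no new
  states are built. Putting c into B always gives a nontrivial partition, putting it into A only if
  B is already nonempty. In both cases c + c is a sum within a part.\<close>

fun extendable1 :: "int \<Rightarrow> int list \<Rightarrow> int list \<Rightarrow> int list \<Rightarrow> int list \<Rightarrow> int list \<Rightarrow> bool" where
  "extendable1 cc cA cB B E Q =
     (if elem cc Q then False
      else if (if disj cA E then disj cB Q else False) then True
      else if B = [] then False
      else if disj cB E then disj cA Q else False)"

fun extendable :: "int \<Rightarrow> int \<Rightarrow> state list \<Rightarrow> bool" where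
  "extendable p c [] = False"
| "extendable p c ((A, B, E, Q) # ss) =
     (if extendable1 (add_mod p c c) (shift p c A) (shift p c B) B E Q then True
      else extendable p c ss)"

fun split_found :: "state list \<Rightarrow> bool" where
  "split_found [] = False"
| "split_found ((A, B, E, Q) # ss) = (if B = [] then split_found ss else True)"

fun two_sum :: "int \<Rightarrow> int \<Rightarrow> int list \<Rightarrow> bool" where
  "two_sum p d [] = False"
| "two_sum p d (x # xs) = (if elem d (shift p x xs) then True else two_sum p d xs)"

fun doubles :: "int \<Rightarrow> int list \<Rightarrow> int list" where
  "doubles p [] = []"
| "doubles p (x # xs) = add_mod p x x # doubles p xs"

text \<open>The first test finds c as an end of a progression, the second finds it as the
  midpoint.\<close>

fun has_ap :: "int \<Rightarrow> int \<Rightarrow> int list \<Rightarrow> bool" where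
  "has_ap p c xs = (if disj (doubles p xs) (shift p c xs) then two_sum p (add_mod p c c) xs else True)"

fun sublist_of :: "int list \<Rightarrow> int list \<Rightarrow> bool" where
  "sublist_of [] ys = True"
| "sublist_of (x # xs) ys = (if elem x ys then sublist_of xs ys else False)"

fun known :: "int list \<Rightarrow> int list list \<Rightarrow> bool" where
  "known xs [] = False"
| "known xs (F # Fs) =
     (if (if sublist_of F xs then sublist_of xs F else False) then True
      else known xs Fs)"

text \<open>The number counts the elements still to be chosen, and candidates are taken in the order
  of the list, so each subset is visited once. Before the last choice is carried out,
  \<open>extendable\<close> is consulted, which usually avoids building its states.\<close>

fun search :: "int \<Rightarrow> bool \<Rightarrow> int list list \<Rightarrow> nat \<Rightarrow> int list \<Rightarrow> state list \<Rightarrow> int list \<Rightarrow> bool" where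
  "search p ap Fs 0 xs sts cs = (if split_found sts then True else known xs Fs)"
| "search p ap Fs (Suc k) xs sts [] = True"
| "search p ap Fs (Suc k) xs sts (c # cs) =
     (if (if (if ap then has_ap p c xs else False) then True
          else if (if k = 0 then extendable p c sts else False) then True
          else search p ap Fs k (c # xs) (extend p c sts) cs)
      then search p ap Fs (Suc k) xs sts cs else False)"

declare add_mod.simps [simp del] elem.simps [simp del] disj.simps [simp del]

section \<open>Soundness of the search\<close>

lemma elem_iff [simp]: "elem x ys \<longleftrightarrow> x \<in> set ys"
  by (induction ys) (auto simp: elem.simps)

lemma disj_iff [simp]: "disj xs ys \<longleftrightarrow> set xs \<inter> set ys = {}"
  by (induction xs) (auto simp: disj.simps)

lemma add_mod_eq:
  assumes "x \<in> {0..<p}" "y \<in> {0..<p}"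
  shows "add_mod p x y = (x + y) mod p"
proof (cases "x + y < p")
  case False
  then have "(x + y) mod p = (x + y - p) mod p" by simp
  also have "\<dots> = x + y - p" using False assms by (intro mod_pos_pos_trivial) auto
  finally show ?thesis using False by (simp add: add_mod.simps)
qed (use assms in \<open>auto simp: add_mod.simps\<close>)

lemma set_shift:
  assumes "c \<in> {0..<p}" "set xs \<subseteq> {0..<p}"
  shows "set (shift p c xs) = sumset p {c} (set xs)"
  using assms by (induction xs) (auto simp: sumset_def add_mod_eq)

lemma sumsetI: "a \<in> A \<Longrightarrow> b \<in> B \<Longrightarrow> (a + b) mod p \<in> sumset p A B"
  by (auto simp: sumset_def)

lemma sumset_commute: "sumset p A B = sumset p B A"
  unfolding sumset_def by (auto simp: image_iff) (metis add.commute)+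

lemma sumset_insert_left: "sumset p (insert c A) B = sumset p {c} B \<union> sumset p A B"
  by (auto simp: sumset_def)

lemma sumset_insert_right: "sumset p A (insert c B) = sumset p {c} A \<union> sumset p A B"
  by (metis sumset_commute sumset_insert_left)

lemma sumset_empty [simp]: "sumset p {} B = {}" "sumset p A {} = {}"
  by (auto simp: sumset_def)

lemma sumset_mono: "A \<subseteq> A' \<Longrightarrow> B \<subseteq> B' \<Longrightarrow> sumset p A B \<subseteq> sumset p A' B'"
  unfolding sumset_def by (intro image_mono Sigma_mono) auto

lemma mod_eq_imp_eq:
  fixes x y p :: int
  assumes "x mod p = y mod p" "x \<in> {0..<p}" "y \<in> {0..<p}"
  shows "x = y"
  using assms by simp

text \<open>Translation by c is injective on residues, so sums of c with A and with B could agree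
  only at a common point of A and B.\<close>

lemma translate_disjoint:
  assumes "A \<subseteq> {0..<p}" "B \<subseteq> {0..<p}" "A \<inter> B = {}"
  shows "sumset p {c} A \<inter> sumset p {c} B = {}"
proof -
  have "a = b" if "(c + a) mod p = (c + b) mod p" "a \<in> A" "b \<in> B" for a b
    using that assms mod_eq_imp_eq[of a p b] by (metis add_diff_cancel_left' mod_diff_left_eq subsetD)
  then show ?thesis using assms(3) by (auto simp: sumset_def)
qed

fun valid_state :: "int \<Rightarrow> int set \<Rightarrow> state \<Rightarrow> bool" where
  "valid_state p S (A, B, E, Q) \<longleftrightarrow> set A \<union> set B = S \<and> A \<noteq> [] \<and> S \<subseteq> {0..<p} \<and>
     set E = sumset p (set A) (set A) \<union> sumset p (set B) (set B) \<and>
     set Q = sumset p (set A) (set B) \<and> set E \<inter> set Q = {}"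

lemma valid_stateD: "valid_state p S (A, B, E, Q) \<Longrightarrow> B \<noteq> [] \<Longrightarrow> parted p S"
  unfolding parted_def by (intro exI[of _ "set A"] exI[of _ "set B"]) auto

lemma valid_state_disjoint:
  assumes "valid_state p S (A, B, E, Q)"
  shows "set A \<inter> set B = {}"
proof -
  have "(x + x) mod p \<in> set E \<inter> set Q" if "x \<in> set A" "x \<in> set B" for x
    using assms that sumsetI[of x "set A" x "set A" p] sumsetI[of x "set A" x "set B" p] by simp
  then show ?thesis using assms by fastforce
qed

lemma valid_left:
  assumes st: "valid_state p S (A, B, E, Q)" and c: "c \<in> {0..<p}" "c \<notin> S"
    and d: "sumset p {c} (set B) \<inter> set E = {}"
           "sumset p {c} (insert c (set A)) \<inter> set Q = {}"
    and E': "set E' = sumset p {c} (insert c (set A)) \<union> set E"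
    and Q': "set Q' = sumset p {c} (set B) \<union> set Q"
  shows "valid_state p (insert c S) (c # A, B, E', Q')"
proof -
  have sub: "insert c (set A) \<subseteq> {0..<p}" "set B \<subseteq> {0..<p}" using st c by auto
  have "insert c (set A) \<inter> set B = {}" using valid_state_disjoint[OF st] st c by auto
  from translate_disjoint[OF sub this, of c] have "sumset p {c} (insert c (set A)) \<inter> sumset p {c} (set B) = {}" .
  moreover have "sumset p (insert c (set A)) (insert c (set A)) =
      sumset p {c} (insert c (set A)) \<union> sumset p (set A) (set A)"
    using sumset_insert_left[of p c "set A" "insert c (set A)"] sumset_insert_right[of p "set A" c "set A"]
      sumset_insert_right[of p "{c}" c "set A"] by auto
  ultimately show ?thesis
    using st d E' Q' c by (auto simp: sumset_insert_left[of p c "set A" "set B"])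
qed

lemma valid_right:
  assumes st: "valid_state p S (A, B, E, Q)" and c: "c \<in> {0..<p}" "c \<notin> S"
    and d: "sumset p {c} (set A) \<inter> set E = {}"
           "sumset p {c} (insert c (set B)) \<inter> set Q = {}"
    and E': "set E' = sumset p {c} (insert c (set B)) \<union> set E"
    and Q': "set Q' = sumset p {c} (set A) \<union> set Q"
  shows "valid_state p (insert c S) (A, c # B, E', Q')"
proof -
  have sub: "insert c (set B) \<subseteq> {0..<p}" "set A \<subseteq> {0..<p}" using st c by auto
  have "insert c (set B) \<inter> set A = {}" using valid_state_disjoint[OF st] st c by auto
  from translate_disjoint[OF sub this, of c] have "sumset p {c} (insert c (set B)) \<inter> sumset p {c} (set A) = {}" .
  moreover have "sumset p (insert c (set B)) (insert c (set B)) =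
      sumset p {c} (insert c (set B)) \<union> sumset p (set B) (set B)"
    using sumset_insert_left[of p c "set B" "insert c (set B)"] sumset_insert_right[of p "set B" c "set B"]
      sumset_insert_right[of p "{c}" c "set B"] by auto
  ultimately show ?thesis
    using st d E' Q' c by (auto simp: sumset_insert_right[of p "set A" c "set B"])
qed

lemma sumset_singleton_insert:
  "c \<in> {0..<p} \<Longrightarrow> sumset p {c} (insert c X) = insert (add_mod p c c) (sumset p {c} X)"
  by (auto simp: sumset_insert_right[of p "{c}" c] sumset_def add_mod_eq)

text \<open>One direction suffices: every state in the list is a genuine partition. A partition
  missing from the list could only make the search fail.\<close>

lemma valid_extend:
  assumes "\<forall>s\<in>set sts. valid_state p S s" "c \<in> {0..<p}" "c \<notin> S" "s \<in> set (extend p c sts)"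
  shows "valid_state p (insert c S) s"
  using assms
proof (induction p c sts rule: extend.induct)
  case (2 p c A B E Q ss)
  have st: "valid_state p S (A, B, E, Q)" using "2.prems"(1) by (simp del: valid_state.simps)
  then have sub: "set A \<subseteq> {0..<p}" "set B \<subseteq> {0..<p}" by auto
  note sh = set_shift[OF \<open>c \<in> {0..<p}\<close> sub(1)] set_shift[OF \<open>c \<in> {0..<p}\<close> sub(2)]
    sumset_singleton_insert[OF \<open>c \<in> {0..<p}\<close>]
  let ?q = "add_mod p c c" and ?A = "shift p c A" and ?B = "shift p c B"
  have "s \<in> set (extend p c ss) \<or>
      s = (c # A, B, (?q # ?A) @ E, ?B @ Q) \<and> disj ?B E \<and> disj (?q # ?A) Q \<or>
      s = (A, c # B, (?q # ?B) @ E, ?A @ Q) \<and> disj ?A E \<and> disj (?q # ?B) Q"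
    using "2.prems"(4) by (simp del: disj_iff split: if_splits) blast+
  moreover have "s \<in> set (extend p c ss) \<Longrightarrow> ?case" using 2 by simp
  ultimately show ?case
    using valid_left[OF st \<open>c \<in> {0..<p}\<close> \<open>c \<notin> S\<close>] valid_right[OF st \<open>c \<in> {0..<p}\<close> \<open>c \<notin> S\<close>]
    by (elim disjE conjE) (simp_all add: sh del: valid_state.simps)
qed simp

lemma extendable_imp_parted:
  assumes "\<forall>s\<in>set sts. valid_state p S s" "c \<in> {0..<p}" "c \<notin> S" "extendable p c sts"
  shows "parted p (insert c S)"
  using assms
proof (induction p c sts rule: extendable.induct)
  case (2 p c A B E Q ss)
  have st: "valid_state p S (A, B, E, Q)" using "2.prems"(1) by (simp del: valid_state.simps)
  then have sub: "set A \<subseteq> {0..<p}" "set B \<subseteq> {0..<p}" by auto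
  note sh = set_shift[OF \<open>c \<in> {0..<p}\<close> sub(1)] set_shift[OF \<open>c \<in> {0..<p}\<close> sub(2)]
  note self = sumset_singleton_insert[OF \<open>c \<in> {0..<p}\<close>]
  let ?q = "add_mod p c c"
  have 1: "parted p (insert c S)" if "?q \<notin> set Q" "sumset p {c} (set A) \<inter> set E = {}" "sumset p {c} (set B) \<inter> set Q = {}"
    using valid_stateD[OF valid_right[OF st \<open>c \<in> {0..<p}\<close> \<open>c \<notin> S\<close>,
          of "shift p c (c # B) @ E" "shift p c A @ Q"]] that sub \<open>c \<in> {0..<p}\<close>
    by (simp add: self sh del: valid_state.simps)
  have 2: "parted p (insert c S)" if "?q \<notin> set Q" "B \<noteq> []" "sumset p {c} (set B) \<inter> set E = {}" "sumset p {c} (set A) \<inter> set Q = {}"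
    using valid_stateD[OF valid_left[OF st \<open>c \<in> {0..<p}\<close> \<open>c \<notin> S\<close>,
          of "shift p c (c # A) @ E" "shift p c B @ Q"]] that sub \<open>c \<in> {0..<p}\<close>
    by (simp add: self sh del: valid_state.simps)
  show ?case
  proof (cases "extendable1 ?q (shift p c A) (shift p c B) B E Q")
    case True
    then have "?q \<notin> set Q \<and> (disj (shift p c A) E \<and> disj (shift p c B) Q \<or>
        B \<noteq> [] \<and> disj (shift p c B) E \<and> disj (shift p c A) Q)"
      by (simp del: disj_iff split: if_splits)
    then show ?thesis using 1 2 by (auto simp: sh)
  next
    case False
    then show ?thesis using "2.IH" "2.prems" by (simp del: valid_state.simps extendable1.simps)
  qed
qed simp

lemma split_found_imp_parted:
  "split_found sts \<Longrightarrow> \<forall>s\<in>set sts. valid_state p S s \<Longrightarrow> parted p S"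
proof (induction sts rule: split_found.induct)
  case (2 A B E Q ss)
  then show ?case using valid_stateD[of p S A B E Q] by (cases "B = []") auto
qed simp

lemma set_doubles: "set xs \<subseteq> {0..<p} \<Longrightarrow> set (doubles p xs) = (\<lambda>x. (x + x) mod p) ` set xs"
  by (induction xs) (auto simp: add_mod_eq)

lemma two_sumD:
  assumes "two_sum p d xs" "distinct xs" "set xs \<subseteq> {0..<p}"
  shows "\<exists>x\<in>set xs. \<exists>y\<in>set xs. x \<noteq> y \<and> d = (x + y) mod p"
  using assms
proof (induction p d xs rule: two_sum.induct)
  case (2 p d x xs)
  then show ?case
    by (auto simp: set_shift[of x p xs] sumset_def split: if_splits; blast)
qed simp

lemma has_ap_imp_not_ap_free:
  assumes "has_ap p c xs" "distinct (c # xs)" "set (c # xs) \<subseteq> {0..<p}"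
  shows "\<not> ap_free p (set (c # xs))"
proof -
  have c: "c \<in> {0..<p}" "set xs \<subseteq> {0..<p}" using assms by auto
  consider "set (doubles p xs) \<inter> set (shift p c xs) \<noteq> {}" | "two_sum p (add_mod p c c) xs"
    using assms(1) by (auto split: if_splits)
  then show ?thesis
  proof cases
    case 1
    then obtain z y where "z \<in> set xs" "y \<in> set xs" "(z + z) mod p = (c + y) mod p"
      by (auto simp: set_doubles[OF c(2)] set_shift[OF c] sumset_def)
    then show ?thesis unfolding ap_free_def using assms(2) by (metis distinct.simps(2) list.set_intros)
  next
    case 2
    from two_sumD[OF this] assms(2) c obtain x y where "x \<in> set xs" "y \<in> set xs" "x \<noteq> y" "(c + c) mod p = (x + y) mod p"
      by (auto simp: add_mod_eq)
    then show ?thesis unfolding ap_free_def by (metis list.set_intros)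
  qed
qed

lemma sublist_of_iff [simp]: "sublist_of xs ys \<longleftrightarrow> set xs \<subseteq> set ys"
  by (induction xs) auto

lemma knownD: "known xs Fs \<Longrightarrow> \<exists>F\<in>set Fs. set F = set xs"
proof (induction Fs)
  case (Cons F Fs)
  then show ?case by (auto split: if_splits)
qed simp

text \<open>The set T of elements still to be chosen either contains the first candidate c, and the
  claim passes to \<open>c # xs\<close> and \<open>T - {c}\<close>, or it avoids c, and c is
  dropped. A pruned branch is harmless: it contradicts \<open>ap_free\<close>, or c completes the
  set and a partition has been found.\<close>

lemma search_sound:
  assumes "search p ap Fs k xs sts cs" "\<forall>s\<in>set sts. valid_state p (set xs) s"
    "distinct (xs @ cs)" "set (xs @ cs) \<subseteq> {0..<p}"
    "T \<subseteq> set cs" "card T = k" "ap \<longrightarrow> ap_free p (set xs \<union> T)"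
  shows "parted p (set xs \<union> T) \<or> (\<exists>F\<in>set Fs. set F = set xs \<union> T)"
  using assms
proof (induction p ap Fs k xs sts cs arbitrary: T rule: search.induct)
  case (1 p ap Fs xs sts cs)
  then have "T = {}" using finite_subset[OF "1.prems"(5)] by auto
  then show ?case using 1 split_found_imp_parted[of sts p "set xs"] knownD[of xs Fs]
    by (auto split: if_splits)
next
  case (2 p ap Fs k xs sts)
  then show ?case by auto
next
  case (3 p ap Fs k xs sts c cs)
  have c: "c \<in> {0..<p}" "c \<notin> set xs" "set xs \<subseteq> {0..<p}" using 3 by auto
  have finT: "finite T" using finite_subset[OF "3.prems"(5)] by auto
  show ?case
  proof (cases "c \<in> T")
    case False
    have se: "search p ap Fs (Suc k) xs sts cs"
      using "3.prems"(1) by (simp del: extend.simps extendable.simps has_ap.simps split: if_splits)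
    have br: "if (if ap then has_ap p c xs else False) then True
          else if (if k = 0 then extendable p c sts else False) then True
          else search p ap Fs k (c # xs) (extend p c sts) cs"
      using "3.prems"(1) by (simp del: extend.simps extendable.simps has_ap.simps split: if_splits)
    show ?thesis
      by (rule "3.IH"(2)[OF br se]) (use 3 False in auto)
  next
    case True
    define T' where "T' = T - {c}"
    have T': "T' \<subseteq> set cs" "card T' = k" "set xs \<union> T = set (c # xs) \<union> T'"
      using True 3 finT by (auto simp: T'_def)
    show ?thesis
    proof (cases "ap \<and> has_ap p c xs")
      case True
      have "\<not> ap_free p (set (c # xs))" using True 3 by (intro has_ap_imp_not_ap_free) auto
      moreover have "set (c # xs) \<subseteq> set xs \<union> T" using T' by auto
      ultimately show ?thesis using "3.prems"(7) True unfolding ap_free_def by blast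
    next
      case nap: False
      show ?thesis
      proof (cases "k = 0 \<and> extendable p c sts")
        case True
        have "T' = {}" using True T' finT by (auto simp: T'_def)
        then show ?thesis using extendable_imp_parted[of sts p "set xs" c] c 3 True T' by auto
      next
        case nex: False
        have val: "\<forall>s\<in>set (extend p c sts). valid_state p (set (c # xs)) s"
          using valid_extend[of sts p "set xs" c] 3 c by auto
        have se: "search p ap Fs k (c # xs) (extend p c sts) cs"
          using "3.prems"(1) nap nex by (auto simp del: extend.simps extendable.simps has_ap.simps split: if_splits)
        have "parted p (set (c # xs) \<union> T') \<or> (\<exists>F\<in>set Fs. set F = set (c # xs) \<union> T')"
          using nap nex by (intro "3.IH"(1)[OF _ _ se val]) (use 3 T' in auto)
        then show ?thesis using T' by auto
      qed
    qed
  qed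
qed

fun extends :: "int \<Rightarrow> int list \<Rightarrow> state list \<Rightarrow> state list" where
  "extends p [] sts = sts"
| "extends p (c # cs) sts = extends p cs (extend p c sts)"

text \<open>Exchanging the parts is a symmetry, so the first element may be put into A.\<close>

fun initial :: "int \<Rightarrow> int list \<Rightarrow> state list" where
  "initial p [] = []"
| "initial p (x # xs) = extends p xs [([x], [], [add_mod p x x], [])]"

text \<open>The images of L under the affine maps that carry a progression x, y, 2y - x of L to 0,
  1, 2. These are the shapes in which a search starting from {0, 1, 2} meets the class of L.\<close>

definition normal_forms :: "int \<Rightarrow> int list \<Rightarrow> int list list" where
  "normal_forms p L = [map (\<lambda>l. (s * (l - x)) mod p) L.
     x \<leftarrow> L, y \<leftarrow> L, x \<noteq> y, elem ((2 * y - x) mod p) L, s \<leftarrow> [1..p - 1], (s * (y - x)) mod p = 1]"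

definition check_ap :: "int \<Rightarrow> nat \<Rightarrow> int list list \<Rightarrow> bool" where
  "check_ap p k Ls \<longleftrightarrow>
     search p False (concat (map (normal_forms p) Ls)) k [2, 1, 0] (initial p [0, 1, 2]) [3..p - 1]"

text \<open>An element that completes a progression with the fixed quadruple cannot occur in an
  \<open>ap_free\<close> set; removing it once spares the test in every later branch.\<close>

fun candidates :: "int \<Rightarrow> int list \<Rightarrow> int list \<Rightarrow> int list" where
  "candidates p xs [] = []"
| "candidates p xs (c # cs) =
     (if (if elem c xs then True else has_ap p c xs) then candidates p xs cs else c # candidates p xs cs)"

fun check_quadruple :: "int \<Rightarrow> nat \<Rightarrow> int \<Rightarrow> bool" where
  "check_quadruple p k e =
     (if has_ap p e [1, 0] then True else if has_ap p (e + 1) [e, 1, 0] then True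
      else search p True [] k [e + 1, e, 1, 0] (initial p [0, 1, e, e + 1])
        (candidates p [e + 1, e, 1, 0] [2..p - 1]))"

text \<open>The range of e keeps 0, 1, e and e + 1 four distinct residues.\<close>

definition check_ap_free :: "int \<Rightarrow> nat \<Rightarrow> bool" where
  "check_ap_free p k \<longleftrightarrow> list_all (check_quadruple p k) [2..p - 2]"

lemma set_candidates: "set (candidates p xs cs) = {c \<in> set cs. c \<notin> set xs \<and> \<not> has_ap p c xs}"
  by (induction cs) (auto simp del: has_ap.simps)

lemma distinct_candidates: "distinct cs \<Longrightarrow> distinct (candidates p xs cs)"
  by (induction cs) (auto simp: set_candidates simp del: has_ap.simps)

lemma valid_extends:
  assumes "\<forall>s\<in>set sts. valid_state p S s" "distinct cs" "set cs \<subseteq> {0..<p}" "set cs \<inter> S = {}"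
    "s \<in> set (extends p cs sts)"
  shows "valid_state p (S \<union> set cs) s"
  using assms
proof (induction cs arbitrary: S sts)
  case (Cons c cs)
  have "\<forall>s\<in>set (extend p c sts). valid_state p (insert c S) s"
    using valid_extend[of sts p S c] Cons.prems by auto
  from Cons.IH[OF this] Cons.prems show ?case by auto
qed simp

lemma valid_initial:
  assumes "distinct xs" "set xs \<subseteq> {0..<p}"
  shows "\<forall>s\<in>set (initial p xs). valid_state p (set xs) s"
proof (cases xs)
  case (Cons x ys)
  have "valid_state p {x} ([x], [], [add_mod p x x], [])"
    using assms Cons by (auto simp: sumset_def add_mod_eq)
  then show ?thesis using valid_extends[of "[([x], [], [add_mod p x x], [])]" p "{x}" ys] assms Cons by auto
qed simp

lemma mod_add_left_cancel: "(a + x) mod p = (a + y) mod p \<longleftrightarrow> x mod p = y mod (p::int)"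
  using cong_add_lcancel[of a x y p] by (simp add: cong_def)

lemma sumsetE:
  assumes "c \<in> sumset p A B"
  obtains a b where "a \<in> A" "b \<in> B" "c = (a + b) mod p"
  using assms by (auto simp: sumset_def)

section \<open>Affine equivalence\<close>

lemma residues_mod_iff [simp]: "x \<in> residues_mod p \<longleftrightarrow> 0 \<le> x \<and> x < int p"
  by (auto simp: residues_mod_def)

lemma affine_equivI:
  assumes "p > 0" "coprime s (int p)"
  shows "affine_equiv p S ((\<lambda>x. (s * x + t) mod int p) ` S)"
  unfolding affine_equiv_def
proof (intro bexI conjI)
  show "coprime (s mod int p) (int p)" using assms by simp
  have "[s mod int p * x + t mod int p = s * x + t] (mod int p)" for x
    by (intro cong_add cong_mult cong_refl) (simp_all add: cong_def)
  then have "(s * x + t) mod int p = (s mod int p * x + t mod int p) mod int p" for x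
    unfolding cong_def by (rule sym)
  then show "(\<lambda>x. (s * x + t) mod int p) ` S = (\<lambda>x. (s mod int p * x + t mod int p) mod int p) ` S"
    by simp
qed (use assms in auto)

lemma affine_equiv_trans:
  assumes "p > 0" "affine_equiv p S S'" "affine_equiv p S' S''"
  shows "affine_equiv p S S''"
proof -
  obtain s t where s: "coprime s (int p)" "S' = (\<lambda>x. (s * x + t) mod int p) ` S"
    using assms(2) by (auto simp: affine_equiv_def)
  obtain s' t' where s': "coprime s' (int p)" "S'' = (\<lambda>x. (s' * x + t') mod int p) ` S'"
    using assms(3) by (auto simp: affine_equiv_def)
  have "(s' * ((s * x + t) mod int p) + t') mod int p = ((s' * s) * x + (s' * t + t')) mod int p" for x
  proof -
    have "[s' * ((s * x + t) mod int p) + t' = s' * (s * x + t) + t'] (mod int p)"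
      by (intro cong_add cong_mult cong_refl) (simp_all add: cong_def)
    moreover have "s' * (s * x + t) + t' = (s' * s) * x + (s' * t + t')" by (simp add: algebra_simps)
    ultimately show ?thesis by (simp only: cong_def)
  qed
  then have "S'' = (\<lambda>x. ((s' * s) * x + (s' * t + t')) mod int p) ` S"
    unfolding s' s image_image by simp
  then show ?thesis using affine_equivI[OF assms(1), of "s' * s" S "s' * t + t'"] s s' by simp
qed

lemma affine_equiv_sym:
  assumes "p > 0" "S \<subseteq> residues_mod p" "affine_equiv p S S'"
  shows "affine_equiv p S' S"
proof -
  obtain s t where s: "coprime s (int p)" "S' = (\<lambda>x. (s * x + t) mod int p) ` S"
    using assms(3) by (auto simp: affine_equiv_def)
  obtain r where r: "[s * r = 1] (mod int p)" using s(1) cong_solve_coprime_int by blast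
  have "[r * s = 1] (mod int p)" using r by (simp add: mult.commute)
  then have "coprime r (int p)" using coprime_iff_invertible_int by blast
  have "(r * ((s * x + t) mod int p) + (- r * t)) mod int p = x" if "x \<in> S" for x
  proof -
    have "[r * ((s * x + t) mod int p) + (- r * t) = r * (s * x + t) + (- r * t)] (mod int p)"
      by (intro cong_add cong_mult cong_refl) (simp_all add: cong_def)
    also have "r * (s * x + t) + (- r * t) = (s * r) * x" by (simp add: algebra_simps)
    also have "[(s * r) * x = 1 * x] (mod int p)" by (intro cong_mult cong_refl r)
    finally show ?thesis using that assms(2) by (auto simp: cong_def subset_iff)
  qed
  then have "(\<lambda>x. (r * x + (- r * t)) mod int p) ` S' = S" unfolding s image_image by simp
  then show ?thesis using affine_equivI[OF assms(1) \<open>coprime r (int p)\<close>, of S' "- r * t"] by simp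
qed

lemma affine_equiv_residues: "affine_equiv p S S' \<Longrightarrow> p > 0 \<Longrightarrow> S' \<subseteq> residues_mod p"
  by (auto simp: affine_equiv_def)

lemma affine_mod_eq_iff:
  fixes x y z w :: int
  assumes "coprime s (int p)"
  shows "((s * x + t) mod int p + (s * y + t) mod int p) mod int p =
         ((s * z + t) mod int p + (s * w + t) mod int p) mod int p \<longleftrightarrow>
         (x + y) mod int p = (z + w) mod int p"
proof -
  have "((s * x + t) mod int p + (s * y + t) mod int p) mod int p = (s * (x + y) + 2 * t) mod int p" for x y
    unfolding mod_add_eq by (simp add: algebra_simps)
  then have "((s * x + t) mod int p + (s * y + t) mod int p) mod int p =
         ((s * z + t) mod int p + (s * w + t) mod int p) mod int p \<longleftrightarrow>
         [s * (x + y) + 2 * t = s * (z + w) + 2 * t] (mod int p)"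
    by (simp only: cong_def)
  also have "\<dots> \<longleftrightarrow> [s * (x + y) = s * (z + w)] (mod int p)" by (rule cong_add_rcancel)
  also have "\<dots> \<longleftrightarrow> [x + y = z + w] (mod int p)" by (rule cong_mult_lcancel[OF assms])
  finally show ?thesis unfolding cong_def .
qed

lemma affine_inj_on:
  assumes "coprime s (int p)" "S \<subseteq> residues_mod p"
  shows "inj_on (\<lambda>x. (s * x + t) mod int p) S"
proof (rule inj_onI)
  fix x y assume xy: "x \<in> S" "y \<in> S" "(s * x + t) mod int p = (s * y + t) mod int p"
  then have "[s * x + t = s * y + t] (mod int p)" unfolding cong_def by simp
  then have "[s * x = s * y] (mod int p)" by (simp only: cong_add_rcancel)
  then have "[x = y] (mod int p)" using cong_mult_lcancel[OF assms(1)] by blast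
  then show "x = y" using xy assms(2) by (auto simp: cong_def subset_iff)
qed

lemma affine_equiv_card:
  assumes "affine_equiv p S S'" "S \<subseteq> residues_mod p"
  shows "card S' = card S"
proof -
  obtain s t where "coprime s (int p)" "S' = (\<lambda>x. (s * x + t) mod int p) ` S"
    using assms(1) unfolding affine_equiv_def by blast
  then show ?thesis using card_image[OF affine_inj_on[OF _ assms(2)]] by simp
qed

lemma affine_equiv_parted:
  assumes "affine_equiv p S S'" "parted (int p) S'"
  shows "parted (int p) S"
proof -
  obtain s t where s: "coprime s (int p)" "S' = (\<lambda>x. (s * x + t) mod int p) ` S"
    using assms by (auto simp: affine_equiv_def)
  obtain A B where AB: "A \<union> B = S'" "A \<noteq> {}" "B \<noteq> {}"
    "sumset (int p) A B \<inter> (sumset (int p) A A \<union> sumset (int p) B B) = {}"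
    using assms(2) unfolding parted_def by blast
  define f where "f x = (s * x + t) mod int p" for x
  have S': "S' = f ` S" by (simp add: s f_def)
  have sums: "(a + b) mod int p \<in> sumset (int p) {x\<in>S. f x \<in> X} {x\<in>S. f x \<in> Y} \<Longrightarrow>
      (f a + f b) mod int p \<in> sumset (int p) X Y" for a b X Y
  proof (elim sumsetE)
    fix c d assume cd: "c \<in> {x\<in>S. f x \<in> X}" "d \<in> {x\<in>S. f x \<in> Y}" "(a + b) mod int p = (c + d) mod int p"
    then have "(f a + f b) mod int p = (f c + f d) mod int p"
      unfolding f_def using affine_mod_eq_iff[OF s(1)] by blast
    then show ?thesis using sumsetI[of "f c" X "f d" Y "int p"] cd by simp
  qed
  show ?thesis unfolding parted_def
  proof (intro exI conjI)
    show "{x\<in>S. f x \<in> A} \<union> {x\<in>S. f x \<in> B} = S" using AB S' by auto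
    have "A \<subseteq> f ` S" "B \<subseteq> f ` S" using AB S' by auto
    then show "{x\<in>S. f x \<in> A} \<noteq> {}" "{x\<in>S. f x \<in> B} \<noteq> {}" using AB(2,3) by blast+
    show "sumset (int p) {x \<in> S. f x \<in> A} {x \<in> S. f x \<in> B} \<inter>
      (sumset (int p) {x \<in> S. f x \<in> A} {x \<in> S. f x \<in> A} \<union>
       sumset (int p) {x \<in> S. f x \<in> B} {x \<in> S. f x \<in> B}) = {}"
    proof (rule ccontr)
      assume "\<not> ?thesis"
      then obtain v where v: "v \<in> sumset (int p) {x \<in> S. f x \<in> A} {x \<in> S. f x \<in> B}"
        "v \<in> sumset (int p) {x \<in> S. f x \<in> A} {x \<in> S. f x \<in> A} \<union>
         sumset (int p) {x \<in> S. f x \<in> B} {x \<in> S. f x \<in> B}" by blast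
      from v(1) obtain a b where ab: "a \<in> S" "b \<in> S" "f a \<in> A" "f b \<in> B"
        "(a + b) mod int p \<in> sumset (int p) {x \<in> S. f x \<in> A} {x \<in> S. f x \<in> A} \<union>
         sumset (int p) {x \<in> S. f x \<in> B} {x \<in> S. f x \<in> B}"
        using v(2) by (elim sumsetE) auto
      then have "(f a + f b) mod int p \<in> sumset (int p) A A \<union> sumset (int p) B B"
        using sums by auto
      then show False using ab AB(4) sumsetI[of "f a" A "f b" B "int p"] by auto
    qed
  qed
qed

lemma coprime_residue_diff:
  assumes "prime p" "x \<in> residues_mod p" "y \<in> residues_mod p" "x \<noteq> y"
  shows "coprime (y - x) (int p)"
proof -
  have "\<bar>y - x\<bar> < int p" "\<bar>y - x\<bar> > 0" using assms(2-4) by auto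
  then have "\<not> int p dvd (y - x)" using zdvd_imp_le[of "int p" "\<bar>y - x\<bar>"] by auto
  then show ?thesis using assms(1) prime_imp_coprime[of "int p" "y - x"] by (simp add: coprime_commute)
qed

lemma normal_forms_affine:
  assumes "F \<in> set (normal_forms (int p) L)" "prime p"
  shows "affine_equiv p (set L) (set F)"
proof -
  obtain s x y where s: "F = map (\<lambda>l. (s * (l - x)) mod int p) L" "(s * (y - x)) mod int p = 1"
    using assms by (auto simp: normal_forms_def split: if_splits)
  have p1: "int p > 1" using assms(2) prime_gt_1_nat by simp
  then have "[s * (y - x) = 1] (mod int p)" using s(2) by (simp add: cong_def)
  then have c: "coprime s (int p)" using coprime_iff_invertible_int by blast
  have "set F = (\<lambda>l. (s * l + (- s * x)) mod int p) ` set L" by (simp add: s algebra_simps)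
  then show ?thesis using affine_equivI[OF _ c, of "set L" "- s * x"] p1 by simp
qed

section \<open>Normal positions of rigid sets\<close>

lemma normalize_pair:
  assumes "prime p" "x \<in> S" "y \<in> S" "x \<noteq> y" "S \<subseteq> residues_mod p"
  shows "\<exists>f. affine_equiv p S (f ` S) \<and> f x = 0 \<and> f y = 1 \<and> inj_on f S \<and>
    (\<forall>a b c d. (f a + f b) mod int p = (f c + f d) mod int p \<longleftrightarrow> (a + b) mod int p = (c + d) mod int p)"
proof -
  have p1: "int p > 1" using assms(1) prime_gt_1_nat by simp
  have "coprime (y - x) (int p)" using coprime_residue_diff[OF assms(1) subsetD[OF assms(5,2)] subsetD[OF assms(5,3)] assms(4)] .
  then obtain s where s: "[(y - x) * s = 1] (mod int p)" using cong_solve_coprime_int[of "y - x" "int p"] by blast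
  then have "[s * (y - x) = 1] (mod int p)" by (simp only: mult.commute)
  then have c: "coprime s (int p)" using coprime_iff_invertible_int by blast
  define f where "f l = (s * l + (- s * x)) mod int p" for l
  have "f y = ((y - x) * s) mod int p" by (simp add: f_def algebra_simps)
  then have f1: "f y = 1" using s p1 by (simp add: cong_def)
  have f0: "f x = 0" by (simp add: f_def)
  have aff: "affine_equiv p S (f ` S)"
    using affine_equivI[OF _ c, of S "- s * x"] p1 by (simp add: f_def[abs_def])
  have iff: "(f a + f b) mod int p = (f c + f d) mod int p \<longleftrightarrow> (a + b) mod int p = (c + d) mod int p"
    for a b c d
    unfolding f_def by (rule affine_mod_eq_iff) (rule c)
  have inj: "inj_on f S" using affine_inj_on[OF c assms(5), of "- s * x"] by (simp add: f_def[abs_def])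
  show ?thesis using aff f0 f1 iff inj by (intro exI[of _ f] conjI allI)
qed

lemma not_ap_free_affine:
  assumes "prime p" "S \<subseteq> residues_mod p" "\<not> ap_free (int p) S" "p > 2"
  obtains S' where "affine_equiv p S S'" "{0, 1, 2} \<subseteq> S'"
proof -
  obtain x y z where xyz: "x \<in> S" "y \<in> S" "z \<in> S" "(x + y) mod int p = (z + z) mod int p" "x \<noteq> y"
    using assms(3) by (auto simp: ap_free_def)
  have "z \<noteq> x"
  proof
    assume "z = x"
    then have "y mod int p = x mod int p" using xyz(4) mod_add_left_cancel by blast
    then show False using xyz assms(2) by (auto simp: subset_iff)
  qed
  have "x \<noteq> z" using \<open>z \<noteq> x\<close> by simp
  obtain f where f: "affine_equiv p S (f ` S)" "f x = 0" "f z = 1" "inj_on f S"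
    "\<forall>a b c d. (f a + f b) mod int p = (f c + f d) mod int p \<longleftrightarrow> (a + b) mod int p = (c + d) mod int p"
    using normalize_pair[OF assms(1) xyz(1,3) \<open>x \<noteq> z\<close> assms(2)] by (elim exE conjE) (rule that)
  \<comment> \<open>The relation x + y = z + z turns into 0 + f y = 1 + 1.\<close>
  have fy: "f y mod int p = 2 mod int p" using f(5)[rule_format, of x y z z] f(2,3) xyz(4) by simp
  have "f y \<in> residues_mod p" using affine_equiv_residues[OF f(1)] assms(4) xyz by auto
  then have "f y = 2" using fy assms(4) by simp
  then have "{0, 1, 2} = {f x, f z, f y}" using f by simp
  then have "{0, 1, 2} \<subseteq> f ` S" using xyz by simp
  then show ?thesis using that[of "f ` S"] f(1) by blast
qed

text \<open>Splitting a rigid set into one point x and the rest must fail, which gives x + y = z + w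
  with z and w different from x. In the absence of progressions z and w differ. Moving x to 0 and z
  to 1 produces the required quadruple, with e the image of w.\<close>

lemma ap_free_affine:
  assumes "prime p" "S \<subseteq> residues_mod p" "ap_free (int p) S" "\<not> parted (int p) S" "card S \<ge> 2"
  obtains S' e where "affine_equiv p S S'" "ap_free (int p) S'" "{0, 1, e, e + 1} \<subseteq> S'" "2 \<le> e" "e \<le> int p - 2"
proof -
  have eqI: "x = y" if "x \<in> S" "y \<in> S" "(a + x) mod int p = (a + y) mod int p" for a x y
  proof -
    have "x mod int p = y mod int p" using that(3) mod_add_left_cancel by blast
    then show ?thesis using that assms(2) by (auto simp: subset_iff)
  qed
  have "S \<noteq> {}" using assms(5) by auto
  then obtain x where x: "x \<in> S" by blast
  have "S - {x} \<noteq> {}"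
  proof
    assume "S - {x} = {}"
    then have "S = {x}" using x by auto
    then show False using assms(5) by simp
  qed
  have "parted (int p) S" if "sumset (int p) {x} (S - {x}) \<inter>
      (sumset (int p) {x} {x} \<union> sumset (int p) (S - {x}) (S - {x})) = {}"
    unfolding parted_def using that \<open>S - {x} \<noteq> {}\<close> x
    by (intro exI[of _ "{x}"] exI[of _ "S - {x}"]) auto
  then obtain v where v: "v \<in> sumset (int p) {x} (S - {x})"
      "v \<in> sumset (int p) {x} {x} \<union> sumset (int p) (S - {x}) (S - {x})"
    using assms(4) by blast
  from v(1) obtain y where y: "y \<in> S" "y \<noteq> x" "v = (x + y) mod int p" by (auto elim: sumsetE)
  have "v \<notin> sumset (int p) {x} {x}" using eqI[of y x x] x y by (auto elim: sumsetE)
  then have "v \<in> sumset (int p) (S - {x}) (S - {x})" using v(2) by blast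
  then obtain z w where "z \<in> S" "w \<in> S" "z \<noteq> x" "w \<noteq> x" "v = (z + w) mod int p"
    by (rule sumsetE) auto
  with y have yzw: "y \<in> S" "z \<in> S" "w \<in> S" "y \<noteq> x" "z \<noteq> x" "w \<noteq> x"
    "(x + y) mod int p = (z + w) mod int p" by auto
  have "z \<noteq> w" using assms(3) x yzw unfolding ap_free_def by blast
  have "y \<noteq> z" using eqI[of x w z] x yzw by (auto simp: add.commute)
  have "x \<noteq> z" using yzw by simp
  obtain f where f: "affine_equiv p S (f ` S)" "f x = 0" "f z = 1" "inj_on f S"
    "\<forall>a b c d. (f a + f b) mod int p = (f c + f d) mod int p \<longleftrightarrow> (a + b) mod int p = (c + d) mod int p"
    using normalize_pair[OF assms(1) x yzw(2) \<open>x \<noteq> z\<close> assms(2)] by (elim exE conjE) (rule that)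
  have p0: "p > 0" using assms(1) prime_gt_0_nat by simp
  have res: "f a \<in> residues_mod p" if "a \<in> S" for a using affine_equiv_residues[OF f(1) p0] that by blast
  have "f y mod int p = (1 + f w) mod int p" using f(5)[rule_format, of x y z w] yzw(7) f(2,3) by simp
  moreover have "f y \<noteq> 0" using inj_onD[OF f(4), of y x] f(2) x yzw by auto
  moreover have "f w \<noteq> 0" "f w \<noteq> 1" using inj_onD[OF f(4), of w x] inj_onD[OF f(4), of w z] f(2,3) x yzw \<open>z \<noteq> w\<close> by auto
  ultimately have e: "f y mod int p = (1 + f w) mod int p" "f y \<noteq> 0" "f w \<noteq> 0" "f w \<noteq> 1" by blast+
  have ranges: "0 \<le> f y" "f y < int p" "0 \<le> f w" "f w < int p" using res[OF yzw(1)] res[OF yzw(3)] by auto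
  \<comment> \<open>A wrap-around would give f y = 0, the value taken at x.\<close>
  have "1 + f w \<noteq> int p" using e ranges by (metis mod_pos_pos_trivial mod_self)
  then have "(1 + f w) mod int p = 1 + f w" using ranges by (intro mod_pos_pos_trivial) auto
  then have "f y = f w + 1" using e(1) ranges by simp
  moreover from this have "f w \<ge> 2" "f w \<le> int p - 2" using ranges e by linarith+
  moreover have "ap_free (int p) (f ` S)"
    unfolding ap_free_def
  proof (intro ballI impI)
    fix u v w assume "u \<in> f ` S" "v \<in> f ` S" "w \<in> f ` S" and eq: "(u + v) mod int p = (w + w) mod int p"
    then obtain a b c where abc: "a \<in> S" "b \<in> S" "c \<in> S" "u = f a" "v = f b" "w = f c" by blast
    then have "(a + b) mod int p = (c + c) mod int p" using eq f(5) by blast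
    then show "u = v" using assms(3) abc unfolding ap_free_def by blast
  qed
  moreover have "{0, 1, f w, f w + 1} \<subseteq> f ` S"
  proof -
    have "{0, 1, f w, f w + 1} = {f x, f z, f w, f y}" using \<open>f y = f w + 1\<close> f by simp
    then show ?thesis using x yzw by simp
  qed
  ultimately show ?thesis using that[OF f(1), of "f w"] by blast
qed

lemma ap_free_mono: "ap_free p S \<Longrightarrow> T \<subseteq> S \<Longrightarrow> ap_free p T"
  unfolding ap_free_def by blast

text \<open>The number \<open>k\<close> counts the elements besides a normalized progression.
  Without progressions four elements are fixed and k - 1 remain; k = 0 is then impossible, since S
  has only three elements.\<close>

lemma classification:
  assumes "prime p" "p > 2" and ap: "check_ap (int p) k Ls"
    and ap_free: "k > 0 \<Longrightarrow> check_ap_free (int p) (k - 1)"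
    and S: "card S = k + 3" "S \<subseteq> residues_mod p" "\<not> parted (int p) S"
    and Ls: "\<And>L. L \<in> set Ls \<Longrightarrow> set L \<subseteq> residues_mod p"
  shows "\<exists>L\<in>set Ls. affine_equiv p S (set L)"
proof -
  have p0: "p > 0" using assms(2) by simp
  have transfer: "S' \<subseteq> residues_mod p" "card S' = k + 3" "\<not> parted (int p) S'" if "affine_equiv p S S'" for S'
    using affine_equiv_residues[OF that p0] affine_equiv_card[OF that S(2)] S(1,3) affine_equiv_parted[OF that]
    by auto
  show ?thesis
  proof (cases "ap_free (int p) S")
    case False
    obtain S' where S': "affine_equiv p S S'" "{0, 1, 2} \<subseteq> S'"
      using not_ap_free_affine[OF assms(1) S(2) False assms(2)] by blast
    note res = transfer(1)[OF S'(1)] and card = transfer(2)[OF S'(1)] and np = transfer(3)[OF S'(1)]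
    define T where "T = S' - {0, 1, 2}"
    have fin: "finite S'" using card card.infinite by fastforce
    have cT: "card T = k" using card_Diff_subset[of "{0, 1, 2}" S'] S'(2) card by (simp add: T_def)
    have un: "set [2, 1, 0] \<union> T = S'" using S'(2) by (auto simp: T_def)
    have "parted (int p) (set [2, 1, 0] \<union> T) \<or>
        (\<exists>F\<in>set (concat (map (normal_forms (int p)) Ls)). set F = set [2, 1, 0] \<union> T)"
    proof (rule search_sound[OF ap[unfolded check_ap_def]])
      have "set [2, 1, 0] = set [0, 1, 2 :: int]" by auto
      then show "\<forall>s\<in>set (initial (int p) [0, 1, 2]). valid_state (int p) (set [2, 1, 0]) s"
        using valid_initial[of "[0, 1, 2]" "int p"] assms(2) by simp
      show "T \<subseteq> set [3..int p - 1]"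
      proof
        fix x assume x: "x \<in> T"
        then have "0 \<le> x" "x < int p" "x \<noteq> 0" "x \<noteq> 1" "x \<noteq> 2" using res by (auto simp: T_def)
        then show "x \<in> set [3..int p - 1]" by auto
      qed
    qed (use cT assms(2) in auto)
    then obtain L F where "L \<in> set Ls" "F \<in> set (normal_forms (int p) L)" "set F = S'"
      using np unfolding un by auto
    then have "affine_equiv p (set L) S'" using normal_forms_affine assms(1) by blast
    then have "affine_equiv p S' (set L)" using affine_equiv_sym[OF p0 Ls[OF \<open>L \<in> set Ls\<close>]] by blast
    then show ?thesis using affine_equiv_trans[OF p0 S'(1)] \<open>L \<in> set Ls\<close> by blast
  next
    case True
    obtain S' e where S': "affine_equiv p S S'" "ap_free (int p) S'" "{0, 1, e, e + 1} \<subseteq> S'"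
      and e: "2 \<le> e" "e \<le> int p - 2"
      using ap_free_affine[OF assms(1) S(2) True S(3)] S(1) by auto
    note res = transfer(1)[OF S'(1)] and card = transfer(2)[OF S'(1)] and np = transfer(3)[OF S'(1)]
    have fin: "finite S'" using card card.infinite by fastforce
    have c4: "card {0, 1, e, e + 1} = 4" using e by auto
    then have k: "k > 0" using card_mono[OF fin S'(3)] card by simp
    define T where "T = S' - {0, 1, e, e + 1}"
    have cT: "card T = k - 1" using card_Diff_subset[of "{0, 1, e, e + 1}" S'] S'(3) card c4 by (simp add: T_def)
    have un: "set [e + 1, e, 1, 0] \<union> T = S'" using S'(3) by (auto simp: T_def)
    have "check_quadruple (int p) (k - 1) e"
      using ap_free[OF k] e by (auto simp: check_ap_free_def list_all_iff simp del: check_quadruple.simps)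
    moreover have "\<not> has_ap (int p) e [1, 0]"
      using has_ap_imp_not_ap_free[of "int p" e "[1, 0]"] ap_free_mono[OF S'(2), of "{e, 1, 0}"] S'(3) e assms(2)
      by (auto simp del: has_ap.simps)
    moreover have "\<not> has_ap (int p) (e + 1) [e, 1, 0]"
      using has_ap_imp_not_ap_free[of "int p" "e + 1" "[e, 1, 0]"] ap_free_mono[OF S'(2), of "{e + 1, e, 1, 0}"]
        S'(3) e assms(2)
      by (auto simp del: has_ap.simps)
    ultimately have s: "search (int p) True [] (k - 1) [e + 1, e, 1, 0] (initial (int p) [0, 1, e, e + 1])
        (candidates (int p) [e + 1, e, 1, 0] [2..int p - 1])"
      by (simp del: has_ap.simps initial.simps candidates.simps)
    have "parted (int p) (set [e + 1, e, 1, 0] \<union> T) \<or> (\<exists>F\<in>set []. set F = set [e + 1, e, 1, 0] \<union> T)"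
    proof (rule search_sound[OF s])
      have "set [e + 1, e, 1, 0] = set [0, 1, e, e + 1]" by auto
      then show "\<forall>s\<in>set (initial (int p) [0, 1, e, e + 1]). valid_state (int p) (set [e + 1, e, 1, 0]) s"
        using valid_initial[of "[0, 1, e, e + 1]" "int p"] assms(2) e by (simp del: initial.simps)
      show "T \<subseteq> set (candidates (int p) [e + 1, e, 1, 0] [2..int p - 1])"
      proof
        fix x assume x: "x \<in> T"
        then have r: "0 \<le> x" "x < int p" "x \<noteq> 0" "x \<noteq> 1" "x \<noteq> e" "x \<noteq> e + 1" using res by (auto simp: T_def)
        have "set [x, e + 1, e, 1, 0] \<subseteq> S'" using x S'(3) by (auto simp: T_def)
        then have "\<not> has_ap (int p) x [e + 1, e, 1, 0]"
          using has_ap_imp_not_ap_free[of "int p" x "[e + 1, e, 1, 0]"] ap_free_mono[OF S'(2)] r e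
          by (auto simp del: has_ap.simps)
        then show "x \<in> set (candidates (int p) [e + 1, e, 1, 0] [2..int p - 1])"
          using r by (simp add: set_candidates del: has_ap.simps candidates.simps)
      qed
      show "distinct ([e + 1, e, 1, 0] @ candidates (int p) [e + 1, e, 1, 0] [2..int p - 1])"
        using e by (auto simp: set_candidates distinct_candidates simp del: has_ap.simps candidates.simps)
      show "set ([e + 1, e, 1, 0] @ candidates (int p) [e + 1, e, 1, 0] [2..int p - 1]) \<subseteq> {0..<int p}"
        using e assms(2) by (auto simp: set_candidates simp del: has_ap.simps candidates.simps)
      show "True \<longrightarrow> ap_free (int p) (set [e + 1, e, 1, 0] \<union> T)" unfolding un using S'(2) by simp
    qed (use cT e assms(2) in auto)
    then show ?thesis using np unfolding un by simp
  qed
qed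

section \<open>Rigid sets below the critical size\<close>

lemma no_partition_of_insert:
  assumes "A \<union> B = insert x S" "x \<in> A" "sumset p A B \<inter> (sumset p A A \<union> sumset p B B) = {}" "B \<noteq> {}"
    and "x \<notin> S" "a \<in> S" "b \<in> S" "c \<in> S" "x = (a + b - c) mod p" "\<not> parted p S"
  shows False
proof (cases "A \<inter> S = {}")
  case True
  then have "S \<subseteq> B" using assms(1) by blast
  have "(x + c) mod p = (a + b) mod p" unfolding assms(9) by (simp add: mod_simps)
  moreover have "(x + c) mod p \<in> sumset p A B" using sumsetI[of x A c B p] assms \<open>S \<subseteq> B\<close> by blast
  moreover have "(a + b) mod p \<in> sumset p B B" using sumsetI[of a B b B p] assms \<open>S \<subseteq> B\<close> by blast
  ultimately show False using assms(3) by auto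
next
  case False
  have "A \<inter> B = {}"
  proof (rule ccontr)
    assume "A \<inter> B \<noteq> {}"
    then obtain y where "y \<in> A" "y \<in> B" by blast
    then show False using sumsetI[of y A y B p] sumsetI[of y A y A p] assms(3) by blast
  qed
  then have BS: "B \<inter> S \<noteq> {}" using assms(1,2,4) by blast
  have "sumset p (A \<inter> S) (B \<inter> S) \<inter> (sumset p (A \<inter> S) (A \<inter> S) \<union> sumset p (B \<inter> S) (B \<inter> S)) = {}"
    using assms(3) sumset_mono[of "A \<inter> S" A "B \<inter> S" B p] sumset_mono[of "A \<inter> S" A "A \<inter> S" A p]
      sumset_mono[of "B \<inter> S" B "B \<inter> S" B p] by blast
  moreover have "(A \<inter> S) \<union> (B \<inter> S) = S" using assms(1) by blast
  ultimately have "parted p S" unfolding parted_def using False BS by blast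
  then show False using assms(10) by blast
qed

text \<open>The relation x + c = a + b ties x to S. A partition of the larger set either restricts
  to a partition of S or separates x from all of S, and the relation forbids the latter.\<close>

lemma not_parted_insert:
  assumes "x \<notin> S" "a \<in> S" "b \<in> S" "c \<in> S" "x = (a + b - c) mod p" "\<not> parted p S"
  shows "\<not> parted p (insert x S)"
proof
  assume "parted p (insert x S)"
  then obtain A B where AB: "A \<union> B = insert x S" "A \<noteq> {}" "B \<noteq> {}"
    "sumset p A B \<inter> (sumset p A A \<union> sumset p B B) = {}"
    unfolding parted_def by blast
  have BA: "B \<union> A = insert x S" "sumset p B A \<inter> (sumset p B B \<union> sumset p A A) = {}"
    using AB by (auto simp: sumset_commute[of p B A])
  consider "x \<in> A" | "x \<in> B" using AB(1) by blast
  then show False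
    using no_partition_of_insert[OF AB(1) _ AB(4,3) assms] no_partition_of_insert[OF BA(1) _ BA(2) AB(2) assms] by cases
qed

text \<open>A set closed under a + b - c contains, with distinct b and c, all terms b + k(b - c).
  These run through all residues because b - c is invertible.\<close>

lemma exists_new_sum:
  assumes "prime p" "S \<subseteq> residues_mod p" "card S \<ge> 2" "card S < p"
  shows "\<exists>a\<in>S. \<exists>b\<in>S. \<exists>c\<in>S. (a + b - c) mod int p \<notin> S"
proof (rule ccontr)
  assume "\<not> ?thesis"
  then have cl: "(a + b - c) mod int p \<in> S" if "a \<in> S" "b \<in> S" "c \<in> S" for a b c using that by blast
  have "\<exists>b\<in>S. \<exists>c\<in>S. b \<noteq> c"
  proof (rule ccontr)
    assume *: "\<not> ?thesis"
    have "S \<noteq> {}" using assms(3) by auto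
    then obtain b where "b \<in> S" by blast
    then have "S = {b}" using * by blast
    then show False using assms(3) by simp
  qed
  then obtain b c where bc: "b \<in> S" "c \<in> S" "b \<noteq> c" by blast
  have p0: "int p > 0" using assms(1) prime_gt_0_nat by simp
  have cb: "c \<in> residues_mod p" "b \<in> residues_mod p" using bc assms(2) by blast+
  have "coprime (b - c) (int p)" using coprime_residue_diff[OF assms(1) cb] bc(3) by blast
  then obtain r where r: "[(b - c) * r = 1] (mod int p)" using cong_solve_coprime_int[of "b - c" "int p"] by blast
  have step: "(b + int k * (b - c)) mod int p \<in> S" for k
  proof (induction k)
    case 0
    then show ?case using bc assms(2) by (auto simp: subset_iff)
  next
    case (Suc k)
    have "((b + int k * (b - c)) mod int p + b - c) mod int p = (b + int (Suc k) * (b - c)) mod int p"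
    proof -
      have "[(b + int k * (b - c)) mod int p + (b - c) = (b + int k * (b - c)) + (b - c)] (mod int p)"
        by (intro cong_add cong_refl) (simp add: cong_def)
      then show ?thesis by (simp add: cong_def algebra_simps)
    qed
    then show ?case using cl[OF Suc bc(1,2)] by simp
  qed
  have "residues_mod p \<subseteq> S"
  proof
    fix y assume y: "y \<in> residues_mod p"
    \<comment> \<open>Since r inverts b - c, this k solves b + k(b - c) = y.\<close>
    define k where "k = nat ((r * (y - b)) mod int p)"
    have k: "int k = (r * (y - b)) mod int p" using p0 by (simp add: k_def)
    have "[b + int k * (b - c) = b + (r * (y - b)) * (b - c)] (mod int p)"
      unfolding k by (intro cong_add cong_mult cong_refl) (simp add: cong_def)
    also have "b + (r * (y - b)) * (b - c) = b + ((b - c) * r) * (y - b)" by (simp only: mult.commute mult.left_commute mult.assoc)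
    also have "[b + ((b - c) * r) * (y - b) = b + 1 * (y - b)] (mod int p)"
      by (intro cong_add cong_mult cong_refl r)
    finally have "(b + int k * (b - c)) mod int p = y mod int p" by (simp add: cong_def)
    then show "y \<in> S" using step[of k] y by simp
  qed
  then have "S = residues_mod p" using assms(2) by blast
  then have "card S = p" by (simp add: residues_mod_def)
  then show False using assms(4) by simp
qed

text \<open>A rigid S would grow by elements a + b - c, staying rigid, until it has n elements; n
  \<le> p leaves room for this. Just before the end it is a classified set minus one point, up to an
  affine map, and \<open>minors\<close> provides a partition of that.\<close>

lemma small_parted:
  assumes "prime p" "n \<le> p"
    and cl: "\<And>S. card S = n \<Longrightarrow> S \<subseteq> residues_mod p \<Longrightarrow> \<not> parted (int p) S \<Longrightarrow> \<exists>L\<in>set Ls. affine_equiv p S (set L)"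
    and minors: "\<And>L x. L \<in> set Ls \<Longrightarrow> x \<in> set L \<Longrightarrow> parted (int p) (set L - {x})"
    and S: "S \<subseteq> residues_mod p" "2 \<le> card S" "card S < n"
  shows "parted (int p) S"
  using S
proof (induction "n - card S" arbitrary: S rule: less_induct)
  case less
  show ?case
  proof (rule ccontr)
    assume np: "\<not> parted (int p) S"
    have "card S < p" using less.prems assms(2) by simp
    then obtain a b c where abc: "a \<in> S" "b \<in> S" "c \<in> S" "(a + b - c) mod int p \<notin> S"
      using exists_new_sum[OF assms(1) less.prems(1,2)] by blast
    define x where "x = (a + b - c) mod int p"
    have np': "\<not> parted (int p) (insert x S)"
      using not_parted_insert[of x S a b c "int p"] abc np x_def by blast
    have fin: "finite S" using less.prems(2) card.infinite by fastforce
    have p0: "int p > 0" using assms(1) prime_gt_0_nat by simp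
    have xS: "x \<notin> S" using abc x_def by simp
    have card: "card (insert x S) = Suc (card S)" using xS fin by simp
    have res: "insert x S \<subseteq> residues_mod p" using less.prems(1) p0 by (simp add: x_def)
    show False
    proof (cases "Suc (card S) < n")
      case True
      have "n - card (insert x S) < n - card S" using True card by linarith
      then show False using less.hyps[of "insert x S"] np' True res card less.prems(2) by linarith
    next
      case False
      then have "card (insert x S) = n" using card less.prems(3) by simp
      then obtain L where L: "L \<in> set Ls" "affine_equiv p (insert x S) (set L)" using cl res np' by blast
      obtain s t where s: "coprime s (int p)" "set L = (\<lambda>x. (s * x + t) mod int p) ` insert x S"
        using L(2) unfolding affine_equiv_def by blast
      define f where "f y = (s * y + t) mod int p" for y
      have "inj_on f (insert x S)" using affine_inj_on[OF s(1) res, of t] by (simp add: f_def[abs_def])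
      then have "f ` S = set L - {f x}"
        using s(2) xS unfolding f_def[symmetric, abs_def] by (auto dest: inj_onD)
      moreover have "f x \<in> set L" using s(2) by (simp add: f_def)
      ultimately have "parted (int p) (f ` S)" using minors[OF L(1)] by simp
      moreover have "affine_equiv p S (f ` S)"
        using affine_equivI[OF _ s(1), of S t] p0 by (simp add: f_def[abs_def])
      ultimately show False using affine_equiv_parted np by blast
    qed
  qed
qed

definition check_minors :: "int \<Rightarrow> int list \<Rightarrow> bool" where
  "check_minors p L \<longleftrightarrow> distinct L \<and> list_all (\<lambda>x. 0 \<le> x \<and> x < p) L \<and>
     list_all (\<lambda>x. split_found (initial p (remove1 x L))) L"

lemma check_minorsD:
  assumes "check_minors p L" "x \<in> set L"
  shows "parted p (set L - {x})"
proof -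
  have "distinct (remove1 x L)" "set (remove1 x L) \<subseteq> {0..<p}"
    using assms set_remove1_subset[of x L] unfolding check_minors_def list_all_iff by auto
  from valid_initial[OF this] have "\<forall>s\<in>set (initial p (remove1 x L)). valid_state p (set L - {x}) s"
    using assms by (simp add: check_minors_def)
  moreover have "split_found (initial p (remove1 x L))"
    using assms by (simp add: check_minors_def list_all_iff)
  ultimately show ?thesis using split_found_imp_parted by blast
qed

section \<open>Connected palettes\<close>

definition edge :: "int \<Rightarrow> int set \<Rightarrow> int set \<Rightarrow> int \<Rightarrow> int \<Rightarrow> bool" where
  "edge p S V u v \<longleftrightarrow> (\<exists>a1\<in>S. \<exists>a2\<in>S. \<exists>a3\<in>S. \<exists>a4\<in>S.
     (a1 + a3) mod p = (a2 + a4) mod p \<and> (a1 + a3) mod p \<in> V \<and>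
     u = (a1 + a2) mod p \<and> v = (a3 + a4) mod p \<and> u \<in> V \<and> v \<in> V)"

text \<open>The vertex set \<open>V\<close> spans a connected \<open>\<R>\<close>-subgraph: no cut of \<open>V\<close> is respected by all
  edges of the palette graph whose ends and label lie in \<open>V\<close>.\<close>

definition connected_palette :: "int \<Rightarrow> int set \<Rightarrow> int set \<Rightarrow> bool" where
  "connected_palette p S V \<longleftrightarrow> (\<exists>u\<in>V. \<exists>v\<in>V. u \<noteq> v) \<and>
     (\<forall>X. (\<forall>u v. edge p S V u v \<longrightarrow> (u \<in> X \<longleftrightarrow> v \<in> X)) \<longrightarrow> V \<subseteq> X \<or> V \<inter> X = {})"

lemma connected_paletteD:
  assumes "connected_palette p S V" "\<And>u v. edge p S V u v \<Longrightarrow> u \<noteq> v \<Longrightarrow> u \<in> X \<longleftrightarrow> v \<in> X"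
  shows "V \<subseteq> X \<or> V \<inter> X = {}"
proof -
  have "edge p S V u v \<longrightarrow> (u \<in> X \<longleftrightarrow> v \<in> X)" for u v using assms(2)[of u v] by blast
  then show ?thesis using assms(1) unfolding connected_palette_def by blast
qed

lemma connected_paletteE:
  assumes "connected_palette p S V"
  obtains u v where "u \<in> V" "v \<in> V" "u \<noteq> v"
  using assms unfolding connected_palette_def by blast

text \<open>A vertex that is not a sum of two colors meets no edge, so it alone would form a
  cut.\<close>

lemma connected_palette_subset:
  assumes "connected_palette p S V"
  shows "V \<subseteq> sumset p S S"
proof
  fix v assume v: "v \<in> V"
  show "v \<in> sumset p S S"
  proof (rule ccontr)
    assume "v \<notin> sumset p S S"
    have "V \<subseteq> {v} \<or> V \<inter> {v} = {}"
    proof (rule connected_paletteD[OF assms])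
      fix u w assume "edge p S V u w"
      then have "u \<in> sumset p S S" "w \<in> sumset p S S" unfolding edge_def by (auto intro: sumsetI)
      then show "u \<in> {v} \<longleftrightarrow> w \<in> {v}" using \<open>v \<notin> sumset p S S\<close> by blast
    qed
    moreover obtain u w where "u \<in> V" "w \<in> V" "u \<noteq> w" using connected_paletteE[OF assms] .
    ultimately show False using v by blast
  qed
qed

section \<open>Certificates that a set carries no connected palette\<close>

type_synonym triple = "int \<times> int \<times> int"

text \<open>Entries are one end, the label and the other end. The inequalities discard the relations
  that merely exchange their terms and give loops.\<close>

definition triples :: "int \<Rightarrow> int list \<Rightarrow> triple list" where
  "triples p L = [(add_mod p a b, add_mod p a c, add_mod p c d).
     a \<leftarrow> L, b \<leftarrow> L, c \<leftarrow> L, d \<leftarrow> L, b \<noteq> c, a \<noteq> d, add_mod p a c = add_mod p b d]"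

fun grow :: "triple list \<Rightarrow> int list \<Rightarrow> int list \<Rightarrow> int list" where
  "grow [] W X = X"
| "grow ((u, c, v) # E) W X =
     (if elem u X then if elem v X then grow E W X
        else if elem c W then if elem v W then grow E W (v # X) else grow E W X else grow E W X
      else grow E W X)"

text \<open>Any number of passes is sound, because \<open>closed_under\<close> verifies afterwards
  that the set found is a cut.\<close>

fun iterate :: "nat \<Rightarrow> triple list \<Rightarrow> int list \<Rightarrow> int list \<Rightarrow> int list" where
  "iterate 0 E W X = X"
| "iterate (Suc n) E W X = iterate n E W (grow E W X)"

fun closed_under :: "triple list \<Rightarrow> int list \<Rightarrow> int list \<Rightarrow> bool" where
  "closed_under [] W X = True"
| "closed_under ((u, c, v) # E) W X =
     (if (if elem u W then if elem v W then elem c W else False else False)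
      then if elem u X = elem v X then closed_under E W X else False
      else closed_under E W X)"

text \<open>The list \<open>W\<close> bounds the possible vertex set V from above. If X is respected
  by all edges with ends and label in \<open>W\<close>, then V lies inside X or avoids X, and both
  possibilities are refuted with a smaller \<open>W\<close>. At most one vertex is too few for a
  palette. The number bounds the depth of the recursion, and exhausting it counts as
  failure.\<close>

fun dead :: "nat \<Rightarrow> triple list \<Rightarrow> int list \<Rightarrow> bool"
  and dead_split :: "nat \<Rightarrow> triple list \<Rightarrow> int list \<Rightarrow> int list \<Rightarrow> bool" where
  "dead 0 E W = False"
| "dead (Suc n) E [] = True"
| "dead (Suc n) E (w # W) = (if W = [] then True else dead_split n E (w # W) (iterate 5 E (w # W) [w]))"
| "dead_split 0 E W X = False"
| "dead_split (Suc n) E W X =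
     (if closed_under E W X then
        if dead n E (filter (\<lambda>x. elem x X) W) then dead n E (filter (\<lambda>x. \<not> elem x X) W) else False
      else False)"

definition check_dead :: "int \<Rightarrow> int list \<Rightarrow> bool" where
  "check_dead p L \<longleftrightarrow> dead 40 (triples p L) (remdups (concat (map (\<lambda>a. shift p a L) L)))"

lemma closed_underD:
  "closed_under E W X \<Longrightarrow> (u, c, v) \<in> set E \<Longrightarrow> u \<in> set W \<Longrightarrow> c \<in> set W \<Longrightarrow> v \<in> set W \<Longrightarrow>
     u \<in> set X \<longleftrightarrow> v \<in> set X"
  by (induction E W X rule: closed_under.induct) (auto split: if_splits)

lemma dead_sound:
  assumes "connected_palette p S V"
  shows "dead n E W \<Longrightarrow> V \<subseteq> set W \<Longrightarrow>
      \<forall>u v. edge p S V u v \<longrightarrow> u \<noteq> v \<longrightarrow> (\<exists>c\<in>V. (u, c, v) \<in> set E) \<Longrightarrow> False"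
    and "dead_split n E W X \<Longrightarrow> V \<subseteq> set W \<Longrightarrow>
      \<forall>u v. edge p S V u v \<longrightarrow> u \<noteq> v \<longrightarrow> (\<exists>c\<in>V. (u, c, v) \<in> set E) \<Longrightarrow> False"
proof (induction n E W and n E W X rule: dead_dead_split.induct)
  case (2 n E)
  obtain u v where "u \<in> V" "v \<in> V" "u \<noteq> v" using connected_paletteE[OF assms] .
  then show ?case using "2.prems"(2) by auto
next
  case (3 n E w W)
  obtain u v where "u \<in> V" "v \<in> V" "u \<noteq> v" using connected_paletteE[OF assms] .
  moreover from this have "u \<in> set (w # W)" "v \<in> set (w # W)" using "3.prems"(2) by blast+
  ultimately have W: "W \<noteq> []" by auto
  then have "dead_split n E (w # W) (iterate 5 E (w # W) [w])" using "3.prems"(1) by simp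
  then show ?case using "3.IH" W "3.prems"(2,3) by blast
next
  case (5 n E W X)
  have cl: "closed_under E W X" "dead n E (filter (\<lambda>x. elem x X) W)" "dead n E (filter (\<lambda>x. \<not> elem x X) W)"
    using "5.prems"(1) by (simp_all split: if_splits)
  have "V \<subseteq> set X \<or> V \<inter> set X = {}"
  proof (rule connected_paletteD[OF assms(1)])
    fix u v assume e: "edge p S V u v" "u \<noteq> v"
    then obtain c where "c \<in> V" "(u, c, v) \<in> set E" using "5.prems"(3) by blast
    moreover have "u \<in> V" "v \<in> V" using e unfolding edge_def by blast+
    ultimately show "u \<in> set X \<longleftrightarrow> v \<in> set X"
      using closed_underD[OF cl(1), of u c v] subsetD[OF "5.prems"(2)] by simp
  qed
  then show ?case
  proof
    assume "V \<subseteq> set X"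
    then have "V \<subseteq> set (filter (\<lambda>x. elem x X) W)" using "5.prems"(2) by auto
    then show False using "5.IH"(1)[OF cl(1,2)] "5.prems"(3) by blast
  next
    assume "V \<inter> set X = {}"
    then have "V \<subseteq> set (filter (\<lambda>x. \<not> elem x X) W)" using "5.prems"(2) by auto
    then show False using "5.IH"(2)[OF cl] "5.prems"(3) by blast
  qed
qed simp_all

lemma check_dead_sound:
  assumes "check_dead p L" "set L \<subseteq> {0..<p}"
  shows "\<not> connected_palette p (set L) V"
proof
  assume c: "connected_palette p (set L) V"
  have E: "\<exists>c\<in>V. (u, c, v) \<in> set (triples p L)" if uv: "edge p (set L) V u v" "u \<noteq> v" for u v
  proof -
    obtain a1 a2 a3 a4 where a: "a1 \<in> set L" "a2 \<in> set L" "a3 \<in> set L" "a4 \<in> set L"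
      "(a1 + a3) mod p = (a2 + a4) mod p" "(a1 + a3) mod p \<in> V" "u = (a1 + a2) mod p" "v = (a3 + a4) mod p"
      using uv(1) unfolding edge_def by blast
    have am: "add_mod p x y = (x + y) mod p" if "x \<in> set L" "y \<in> set L" for x y
      using add_mod_eq that assms(2) by blast
    have "a2 \<noteq> a3" "a1 \<noteq> a4" using a(5,7,8) uv(2) by (auto simp: add.commute)
    moreover have "add_mod p a1 a3 = add_mod p a2 a4" using am a by simp
    ultimately have "(add_mod p a1 a2, add_mod p a1 a3, add_mod p a3 a4) \<in> set (triples p L)"
      unfolding triples_def using a(1-4) by auto
    then show ?thesis using am a by auto
  qed
  have "set (concat (map (\<lambda>a. shift p a L) L)) = sumset p (set L) (set L)"
    using assms(2) by (auto simp: set_shift subset_iff sumset_def)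
  then have "V \<subseteq> set (remdups (concat (map (\<lambda>a. shift p a L) L)))" using connected_palette_subset[OF c] by simp
  then show False using dead_sound(1)[OF c assms(1)[unfolded check_dead_def]] E by blast
qed

section \<open>The classified sets and their verification\<close>

definition exceptional_sets :: "nat \<Rightarrow> int list list" where
  "exceptional_sets p =
    (if p = 17 then [[0, 1, 2, 4, 7, 9]] else if p = 19 then [[0, 1, 2, 4, 7, 11]]
     else if p = 23 then [[0, 1, 2, 4, 7, 17]] else [])"

definition listed_sets :: "nat \<Rightarrow> int list list" where
  "listed_sets p =
    (if p = 3 then [[0, 1, 2]]
     else if p = 5 then [[0, 1, 2, 3]]
     else if p = 7 then [[0, 1, 2, 4]]
     else if p = 11 then [[0, 1, 2, 3, 6], [0, 1, 2, 4, 7]]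
     else if p = 13 then [[0, 1, 2, 4, 7]]
     else if p = 17 then
       [[0, 1, 2, 3, 5, 9], [0, 1, 2, 3, 5, 10], [0, 1, 2, 3, 5, 12], [0, 1, 2, 3, 6, 9],
        [0, 1, 2, 3, 6, 10], [0, 1, 2, 3, 6, 11], [0, 1, 2, 3, 6, 13], [0, 1, 2, 3, 7, 11],
        [0, 1, 2, 4, 5, 9], [0, 1, 2, 4, 5, 10], [0, 1, 2, 4, 5, 12], [0, 1, 2, 4, 10, 13]]
     else if p = 19 then
       [[0, 1, 2, 3, 5, 10], [0, 1, 2, 3, 6, 10], [0, 1, 2, 3, 6, 11], [0, 1, 2, 3, 6, 12],
        [0, 1, 2, 3, 6, 13], [0, 1, 2, 3, 6, 14], [0, 1, 2, 3, 7, 12], [0, 1, 2, 4, 5, 10],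
        [0, 1, 2, 4, 5, 14], [0, 1, 2, 4, 7, 12], [0, 1, 2, 4, 7, 15]]
     else if p = 23 then
       [[0, 1, 2, 3, 6, 12], [0, 1, 2, 4, 7, 12], [0, 1, 2, 4, 7, 13], [0, 1, 2, 4, 7, 14],
        [0, 1, 2, 4, 9, 14], [0, 1, 2, 4, 10, 19]]
     else if p = 29 then [[0, 1, 2, 4, 8, 15]]
     else [[0, 1, 2, 4, 8, 16]])"

text \<open>The critical size is \<open>k + 3\<close>; thus \<open>k + 1\<close> is the integer part
  of the binary logarithm of p.\<close>

definition check_all :: "nat \<Rightarrow> nat \<Rightarrow> bool" where
  "check_all p k \<longleftrightarrow> check_ap (int p) k (listed_sets p @ exceptional_sets p) \<and>
     (k > 0 \<longrightarrow> check_ap_free (int p) (k - 1)) \<and>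
     list_all (check_minors (int p)) (listed_sets p @ exceptional_sets p) \<and>
     list_all (check_dead (int p)) (exceptional_sets p)"

lemma check_3: "check_all 3 0" by code_simp
lemma check_5: "check_all 5 1" by code_simp
lemma check_7: "check_all 7 1" by code_simp
lemma check_11: "check_all 11 2" by code_simp
lemma check_13: "check_all 13 2" by code_simp
lemma check_17: "check_all 17 3" by code_simp
lemma check_19: "check_all 19 3" by code_simp
lemma check_23: "check_all 23 3" by code_simp
lemma check_29: "check_all 29 3" by code_simp
lemma check_31: "check_all 31 3" by code_simp

text \<open>Colors are moved by \<open>\<sigma>\<close> and sums by \<open>\<tau>\<close>, and the
  two need to be compatible only on pairs whose sum lies in V. This admits maps such as the
  translation of a single part, which may destroy other relations of S.\<close>

lemma connected_palette_map:
  assumes c: "connected_palette p S V" and inj: "inj_on \<tau> V" and S': "\<sigma> ` S \<subseteq> S'"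
    and hom: "\<And>x y. x \<in> S \<Longrightarrow> y \<in> S \<Longrightarrow> (x + y) mod p \<in> V \<Longrightarrow> (\<sigma> x + \<sigma> y) mod p = \<tau> ((x + y) mod p)"
  shows "connected_palette p S' (\<tau> ` V)"
  unfolding connected_palette_def
proof (intro conjI allI impI)
  obtain u v where "u \<in> V" "v \<in> V" "u \<noteq> v" using connected_paletteE[OF c] .
  moreover from this have "\<tau> u \<noteq> \<tau> v" using inj_onD[OF inj] by blast
  ultimately show "\<exists>u\<in>\<tau> ` V. \<exists>v\<in>\<tau> ` V. u \<noteq> v" by blast
next
  fix X assume X: "\<forall>u v. edge p S' (\<tau> ` V) u v \<longrightarrow> (u \<in> X \<longleftrightarrow> v \<in> X)"
  have "V \<subseteq> \<tau> -` X \<or> V \<inter> \<tau> -` X = {}"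
  proof (rule connected_paletteD[OF c])
    fix u v assume "edge p S V u v"
    then obtain a1 a2 a3 a4 where a: "a1 \<in> S" "a2 \<in> S" "a3 \<in> S" "a4 \<in> S"
      "(a1 + a3) mod p = (a2 + a4) mod p" "(a1 + a3) mod p \<in> V" "u = (a1 + a2) mod p" "v = (a3 + a4) mod p"
      "u \<in> V" "v \<in> V" unfolding edge_def by blast
    have "edge p S' (\<tau> ` V) (\<tau> u) (\<tau> v)"
      unfolding edge_def
    proof (intro bexI conjI)
      show "(\<sigma> a1 + \<sigma> a3) mod p = (\<sigma> a2 + \<sigma> a4) mod p"
        using hom[OF a(1,3)] hom[OF a(2,4)] a(5,6) by simp
      show "(\<sigma> a1 + \<sigma> a3) mod p \<in> \<tau> ` V" using hom[OF a(1,3)] a(6) by simp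
      show "\<tau> u = (\<sigma> a1 + \<sigma> a2) mod p" using hom[OF a(1,2)] a(7,9) by simp
      show "\<tau> v = (\<sigma> a3 + \<sigma> a4) mod p" using hom[OF a(3,4)] a(8,10) by simp
    qed (use a S' in auto)
    then show "u \<in> \<tau> -` X \<longleftrightarrow> v \<in> \<tau> -` X" using X by simp
  qed
  then show "\<tau> ` V \<subseteq> X \<or> \<tau> ` V \<inter> X = {}" by blast
qed

lemma connected_palette_range: "connected_palette p S V \<Longrightarrow> p > 0 \<Longrightarrow> V \<subseteq> {0..<p}"
  using connected_palette_subset[of p S V] by (auto simp: sumset_def)

lemma translate_inj_on: "V \<subseteq> {0..<p} \<Longrightarrow> inj_on (\<lambda>v. (v + t) mod p) V" for p t :: int
  by (rule inj_onI) (metis add.commute mod_add_left_cancel mod_eq_imp_eq subsetD)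

lemma connected_palette_affine:
  assumes "connected_palette (int p) S V" "affine_equiv p S S'" "p > 0"
  shows "\<exists>V'. connected_palette (int p) S' V'"
proof -
  obtain s t where s: "coprime s (int p)" "S' = (\<lambda>x. (s * x + t) mod int p) ` S"
    using assms(2) unfolding affine_equiv_def by blast
  have "V \<subseteq> residues_mod p" using connected_palette_range[OF assms(1)] assms(3) by (auto simp: residues_mod_def)
  then have "inj_on (\<lambda>v. (s * v + 2 * t) mod int p) V" using affine_inj_on[OF s(1)] by blast
  moreover have "((s * x + t) mod int p + (s * y + t) mod int p) mod int p =
      (s * ((x + y) mod int p) + 2 * t) mod int p" for x y
  proof -
    have "[(s * x + t) mod int p + (s * y + t) mod int p = (s * x + t) + (s * y + t)] (mod int p)"
      by (intro cong_add) (simp_all add: cong_def)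
    also have "(s * x + t) + (s * y + t) = s * (x + y) + 2 * t" by (simp add: algebra_simps)
    also have "[s * (x + y) + 2 * t = s * ((x + y) mod int p) + 2 * t] (mod int p)"
      by (intro cong_add cong_mult cong_refl) (simp add: cong_def)
    finally show ?thesis by (simp only: cong_def)
  qed
  ultimately show ?thesis
    using connected_palette_map[OF assms(1), of "\<lambda>v. (s * v + 2 * t) mod int p" "\<lambda>x. (s * x + t) mod int p" S'] s(2)
    by blast
qed

section \<open>Palettes on a partitioned set\<close>

locale sum_partition =
  fixes p :: int and S A B :: "int set"
  assumes un: "A \<union> B = S" and ne: "A \<noteq> {}" "B \<noteq> {}"
    and sep: "sumset p A B \<inter> (sumset p A A \<union> sumset p B B) = {}"
begin

lemma disjoint: "A \<inter> B = {}"
proof (rule ccontr)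
  assume "A \<inter> B \<noteq> {}"
  then obtain y where "y \<in> A" "y \<in> B" by blast
  then show False using sumsetI[of y A y B p] sumsetI[of y A y A p] sep by blast
qed

lemma sum_in_iff:
  assumes "x \<in> S" "y \<in> S"
  shows "(x + y) mod p \<in> sumset p A B \<longleftrightarrow> (x \<in> A \<longleftrightarrow> y \<notin> A)"
proof -
  consider "x \<in> A" "y \<in> A" | "x \<in> A" "y \<in> B" | "x \<in> B" "y \<in> A" | "x \<in> B" "y \<in> B" using assms un by blast
  then show ?thesis
  proof cases
    case 1
    then show ?thesis using sumsetI[of x A y A p] sep by blast
  next
    case 2
    then show ?thesis using sumsetI[of x A y B p] disjoint by blast
  next
    case 3
    then have "(x + y) mod p \<in> sumset p A B" using sumsetI[of y A x B p] by (simp add: add.commute)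
    then show ?thesis using 3 disjoint by blast
  next
    case 4
    then have "(x + y) mod p \<notin> sumset p A B" using sumsetI[of x B y B p] sep by blast
    then show ?thesis using 4 disjoint by blast
  qed
qed

text \<open>With h the map to Z/2Z, the equation h a1 + h a3 = h a2 + h a4 is equivalent to h a1 + h
  a2 = h a3 + h a4. So the sums across the parts, which are those of value 1, form a set respected
  by every edge.\<close>

lemma palette_cases:
  assumes "connected_palette p S V"
  shows "V \<subseteq> sumset p A B \<or> V \<inter> sumset p A B = {}"
proof (rule connected_paletteD[OF assms])
  fix u v assume "edge p S V u v"
  then obtain a1 a2 a3 a4 where a: "a1 \<in> S" "a2 \<in> S" "a3 \<in> S" "a4 \<in> S"
    "(a1 + a3) mod p = (a2 + a4) mod p" "u = (a1 + a2) mod p" "v = (a3 + a4) mod p"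
    unfolding edge_def by blast
  show "u \<in> sumset p A B \<longleftrightarrow> v \<in> sumset p A B"
    using sum_in_iff[OF a(1,3)] sum_in_iff[OF a(2,4)] sum_in_iff[OF a(1,2)] sum_in_iff[OF a(3,4)] a(5-7)
    by auto
qed

text \<open>All relations in use have one term from \<open>B\<close> on each side, so translations of \<open>B\<close> preserve
  them; a suitable translation makes \<open>B\<close> meet \<open>A\<close>.\<close>

lemma palette_shrink:
  assumes c: "connected_palette p S V" and V: "V \<subseteq> sumset p A B" and S: "S \<subseteq> {0..<p}" and "p > 0"
  shows "\<exists>S' V'. S' \<subseteq> {0..<p} \<and> card S' < card S \<and> connected_palette p S' V'"
proof -
  obtain a b where ab: "a \<in> A" "b \<in> B" using ne by blast
  define t where "t = a - b"
  define \<tau> where "\<tau> x = (x + t) mod p" for x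
  define \<sigma> where "\<sigma> x = (if x \<in> A then x else \<tau> x)" for x
  have fin: "finite S" using S finite_subset by blast
  have "\<sigma> b = \<sigma> a"
    using ab disjoint S un by (auto simp: \<sigma>_def \<tau>_def t_def subset_iff)
  then have "\<sigma> ` S = \<sigma> ` (S - {b})" using ab un disjoint by (auto simp: image_iff)
  then have "card (\<sigma> ` S) \<le> card (S - {b})" using card_image_le[of "S - {b}" \<sigma>] fin by simp
  moreover have "card (S - {b}) < card S" using ab un fin by (intro card_Diff1_less) auto
  moreover have "\<sigma> ` S \<subseteq> {0..<p}" using S assms(4) by (auto simp: \<sigma>_def \<tau>_def)
  moreover have "connected_palette p (\<sigma> ` S) (\<tau> ` V)"
  proof (rule connected_palette_map[OF c])
    show "inj_on \<tau> V"
      using translate_inj_on[OF connected_palette_range[OF c assms(4)], of t] by (simp add: \<tau>_def[abs_def])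
    fix x y assume xy: "x \<in> S" "y \<in> S" "(x + y) mod p \<in> V"
    then have d: "x \<in> A \<longleftrightarrow> y \<notin> A" using sum_in_iff V by blast
    have *: "(x + (y + t) mod p) mod p = ((x + y) mod p + t) mod p" for x y
    proof -
      have "[x + (y + t) mod p = x + (y + t)] (mod p)" by (intro cong_add cong_refl) (simp add: cong_def)
      also have "x + (y + t) = (x + y) + t" by simp
      also have "[(x + y) + t = (x + y) mod p + t] (mod p)" by (intro cong_add cong_refl) (simp add: cong_def)
      finally show ?thesis by (simp only: cong_def)
    qed
    show "(\<sigma> x + \<sigma> y) mod p = \<tau> ((x + y) mod p)"
      using d *[of x y] *[of y x] by (cases "x \<in> A") (simp_all add: \<sigma>_def \<tau>_def add.commute)
  qed simp
  ultimately show ?thesis by (meson order.strict_trans1)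
qed

text \<open>The ends a1 + a2 and a3 + a4 and the label a1 + a3 all lie in V. When none of them is a
  sum across the parts, all four elements lie in one part.\<close>

lemma edge_same_side:
  assumes "V \<inter> sumset p A B = {}" "edge p S V u v"
  shows "edge p A V u v \<or> edge p B V u v"
proof -
  obtain a1 a2 a3 a4 where a: "a1 \<in> S" "a2 \<in> S" "a3 \<in> S" "a4 \<in> S"
    "(a1 + a3) mod p = (a2 + a4) mod p" "(a1 + a3) mod p \<in> V" "u = (a1 + a2) mod p" "v = (a3 + a4) mod p"
    "u \<in> V" "v \<in> V" using assms(2) unfolding edge_def by blast
  have eq: "a1 \<in> A \<longleftrightarrow> a2 \<in> A" "a3 \<in> A \<longleftrightarrow> a4 \<in> A" "a1 \<in> A \<longleftrightarrow> a3 \<in> A"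
    using sum_in_iff[OF a(1,2)] sum_in_iff[OF a(3,4)] sum_in_iff[OF a(1,3)] a(6-10) assms(1) by blast+
  show ?thesis
  proof (cases "a1 \<in> A")
    case True
    then have "edge p A V u v" unfolding edge_def using a eq by blast
    then show ?thesis by simp
  next
    case False
    then have "a1 \<in> B" "a2 \<in> B" "a3 \<in> B" "a4 \<in> B" using eq a(1-4) un by blast+
    then have "edge p B V u v" unfolding edge_def using a by blast
    then show ?thesis by simp
  qed
qed

end

lemma connected_palette_cong:
  assumes "connected_palette p S V" "\<And>u v. edge p S V u v \<Longrightarrow> u \<noteq> v \<Longrightarrow> edge p S' V u v"
  shows "connected_palette p S' V"
  unfolding connected_palette_def
proof (intro conjI allI impI)
  show "\<exists>u\<in>V. \<exists>v\<in>V. u \<noteq> v" using assms(1) unfolding connected_palette_def by blast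
  fix X assume X: "\<forall>u v. edge p S' V u v \<longrightarrow> (u \<in> X \<longleftrightarrow> v \<in> X)"
  show "V \<subseteq> X \<or> V \<inter> X = {}"
    by (rule connected_paletteD[OF assms(1)]) (use X assms(2) in blast)
qed

section \<open>Palettes on at most five colors\<close>

lemma residue_cancel:
  fixes a x y p :: int
  assumes "(a + x) mod p = (a + y) mod p" "x \<in> {0..<p}" "y \<in> {0..<p}"
  shows "x = y"
  using assms mod_eq_imp_eq[of x p y] by (simp only: mod_add_left_cancel)

lemma nontrivial_edge:
  assumes "edge p S V u v" "u \<noteq> v"
  obtains a1 a2 a3 a4 where "a1 \<in> S" "a2 \<in> S" "a3 \<in> S" "a4 \<in> S"
    "(a1 + a3) mod p = (a2 + a4) mod p" "(a1 + a3) mod p \<in> V" "u = (a1 + a2) mod p" "v = (a3 + a4) mod p"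
    "u \<in> V" "v \<in> V" "a1 \<noteq> a4" "a2 \<noteq> a3"
proof -
  obtain a1 a2 a3 a4 where a: "a1 \<in> S" "a2 \<in> S" "a3 \<in> S" "a4 \<in> S"
    "(a1 + a3) mod p = (a2 + a4) mod p" "(a1 + a3) mod p \<in> V" "u = (a1 + a2) mod p" "v = (a3 + a4) mod p"
    "u \<in> V" "v \<in> V" using assms(1) unfolding edge_def by blast
  moreover have "a1 \<noteq> a4" "a2 \<noteq> a3" using a(5,7,8) assms(2) by (auto simp: add.commute)
  ultimately show ?thesis by (rule that)
qed

lemma double_cancel:
  assumes "prime p" "p > 2" "(x + x) mod int p = (y + y) mod int p" "x \<in> residues_mod p" "y \<in> residues_mod p"
  shows "x = y"
proof (rule ccontr)
  assume "x \<noteq> y"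
  then have c: "coprime (y - x) (int p)" using coprime_residue_diff[OF assms(1,4,5)] by blast
  have "int p dvd (y + y) - (x + x)" using assms(3) by (metis mod_eq_dvd_iff)
  then have "int p dvd 2 * (y - x)" by (simp add: algebra_simps)
  moreover have "coprime (int p) (y - x)" using c by (simp add: coprime_commute)
  ultimately have "int p dvd 2" using coprime_dvd_mult_left_iff[of "int p" "y - x" 2] by blast
  then show False using zdvd_imp_le[of "int p" 2] assms(2) by simp
qed

lemma triple_cancel:
  assumes "prime p" "p > 3" "int p dvd 3 * (y - x)" "x \<in> residues_mod p" "y \<in> residues_mod p"
  shows "x = y"
proof (rule ccontr)
  assume "x \<noteq> y"
  then have c: "coprime (y - x) (int p)" using coprime_residue_diff[OF assms(1,4,5)] by blast
  then have "coprime (int p) (y - x)" by (simp add: coprime_commute)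
  then have "int p dvd 3" using assms(3) coprime_dvd_mult_left_iff[of "int p" "y - x" 3] by blast
  then show False using zdvd_imp_le[of "int p" 3] assms(2) by simp
qed

text \<open>The only relation that yields an edge is x + y = x + y read with a1 = a2 and a3 = a4.
  Otherwise a1 = a3 and a2 = a4, which would force 2x = 2y.\<close>

lemma edge_of_pair:
  assumes "prime p" "p > 2" "x \<in> residues_mod p" "y \<in> residues_mod p" "edge (int p) {x, y} V u v" "u \<noteq> v"
  shows "{u, v} = {(x + x) mod int p, (y + y) mod int p}" "(x + y) mod int p \<in> V"
proof -
  obtain a1 a2 a3 a4 where a: "a1 \<in> {x, y}" "a2 \<in> {x, y}" "a3 \<in> {x, y}" "a4 \<in> {x, y}"
    "(a1 + a3) mod int p = (a2 + a4) mod int p" "(a1 + a3) mod int p \<in> V"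
    "u = (a1 + a2) mod int p" "v = (a3 + a4) mod int p" "a1 \<noteq> a4" "a2 \<noteq> a3"
    using nontrivial_edge[OF assms(5,6)] by metis
  have "a1 = a2"
  proof (rule ccontr)
    assume "a1 \<noteq> a2"
    then have "a3 = a1" "a4 = a2" using a by auto
    then show False using double_cancel[OF assms(1,2), of a1 a2] a(1,2,5) assms(3,4) \<open>a1 \<noteq> a2\<close> by auto
  qed
  then have "a3 = a4" using a by auto
  then show "{u, v} = {(x + x) mod int p, (y + y) mod int p}" "(x + y) mod int p \<in> V"
    using a \<open>a1 = a2\<close> by (auto simp: add.commute)
qed

text \<open>Among three elements a relation with distinct ends has one of two types. If a1 = a2 and
  a3 = a4, both ends are doubles. Otherwise it is a progression 2c = x + y with ends c + x and c + y
  and label 2c. These ends are not doubles: c + x = 2y together with 2c = x + y would give 3(c - y)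
  = 0, contrary to p > 3.\<close>

lemma edge_of_triple:
  assumes "prime p" "p > 3" "B \<subseteq> residues_mod p" "card B \<le> 3" "edge (int p) B V u v" "u \<noteq> v"
    "D = (\<lambda>b. (b + b) mod int p) ` B"
  shows "u \<in> D \<longleftrightarrow> v \<in> D" "u \<notin> D \<Longrightarrow> V \<inter> D \<noteq> {}"
proof -
  obtain a1 a2 a3 a4 where a: "a1 \<in> B" "a2 \<in> B" "a3 \<in> B" "a4 \<in> B"
    "(a1 + a3) mod int p = (a2 + a4) mod int p" "(a1 + a3) mod int p \<in> V"
    "u = (a1 + a2) mod int p" "v = (a3 + a4) mod int p" "u \<in> V" "v \<in> V" "a1 \<noteq> a4" "a2 \<noteq> a3"
    using nontrivial_edge[OF assms(5,6)] .
  have fin: "finite B" using assms(3) finite_subset[of B "residues_mod p"] by (simp add: residues_mod_def)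
  have three: "x = y \<or> x = z \<or> x = w \<or> y = z \<or> y = w \<or> z = w" if "x \<in> B" "y \<in> B" "z \<in> B" "w \<in> B" for x y z w
  proof (rule ccontr)
    assume "\<not> ?thesis"
    then have "card {x, y, z, w} = 4" by auto
    moreover have "{x, y, z, w} \<subseteq> B" using that by blast
    ultimately show False using card_mono[OF fin, of "{x, y, z, w}"] assms(4) by linarith
  qed
  have res: "b \<in> residues_mod p" "b \<in> {0..<int p}" if "b \<in> B" for b
    using that assms(3) by (auto simp: residues_mod_def)
  have dbl: "x = y" if "(x + x) mod int p = (y + y) mod int p" "x \<in> B" "y \<in> B" for x y
    using double_cancel[OF assms(1) _ that(1) res(1)[OF that(2)] res(1)[OF that(3)]] assms(2) by simp
  have cancel: "x = y" if "(c + x) mod int p = (c + y) mod int p" "x \<in> B" "y \<in> B" for c x y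
    using residue_cancel[OF that(1) res(2)[OF that(2)] res(2)[OF that(3)]] .
  have mid: "(c + x) mod int p \<notin> D" if "c \<in> B" "x \<in> B" "y \<in> B" "c \<noteq> x" "c \<noteq> y" "x \<noteq> y"
    "(c + c) mod int p = (x + y) mod int p" for c x y
  proof
    assume "(c + x) mod int p \<in> D"
    then obtain b where b: "b \<in> B" "(c + x) mod int p = (b + b) mod int p" using assms(7) by blast
    have "b \<noteq> c" using b(2) cancel[of c x c] that by auto
    moreover have "b \<noteq> x" using b(2) cancel[of x c x] that by (auto simp: add.commute)
    ultimately have "b = y" using three[of b c x y] b that by blast
    then have "int p dvd (c + x) - (y + y)" using b(2) mod_eq_dvd_iff by blast
    moreover have "int p dvd (c + c) - (x + y)" using that(7) mod_eq_dvd_iff by blast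
    ultimately have "int p dvd ((c + x) - (y + y)) + ((c + c) - (x + y))" by (rule dvd_add)
    moreover have "((c + x) - (y + y)) + ((c + c) - (x + y)) = 3 * (c - y)" by simp
    ultimately have "int p dvd 3 * (c - y)" by simp
    then show False using triple_cancel[OF assms(1,2) _ res(1)[OF that(3)] res(1)[OF that(1)]] that(5) by blast
  qed
  have "u \<in> D \<and> v \<in> D \<or> u \<notin> D \<and> v \<notin> D \<and> V \<inter> D \<noteq> {}"
  proof (cases "a1 = a2 \<or> a3 = a4")
    case True
    then have "a1 = a2 \<and> a3 = a4"
    proof
      assume "a1 = a2"
      then show ?thesis using a(3-5) cancel[of a1 a3 a4] by blast
    next
      assume "a3 = a4"
      then have "(a3 + a1) mod int p = (a3 + a2) mod int p" using a(5) by (simp add: add.commute)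
      then show ?thesis using a(1,2) cancel[of a3 a1 a2] \<open>a3 = a4\<close> by blast
    qed
    then show ?thesis using a(1,3,7,8) assms(7) by blast
  next
    case False
    then have "a1 = a3 \<or> a2 = a4" using three[OF a(1-4)] a(11,12) by blast
    then show ?thesis
    proof
      assume eq: "a1 = a3"
      have "a2 \<noteq> a4" using a(5) dbl[OF _ a(1,2)] False eq by auto
      then have "(a1 + a2) mod int p \<notin> D" "(a1 + a4) mod int p \<notin> D"
        using mid[OF a(1,2,4)] mid[OF a(1,4,2)] a(5,11) False eq by (auto simp: add.commute)
      moreover have "(a1 + a3) mod int p \<in> D" using eq a(1) assms(7) by blast
      ultimately show ?thesis using a(6,7,8) eq by blast
    next
      assume eq: "a2 = a4"
      have "a1 \<noteq> a3" using a(5) dbl[OF _ a(1,2)] False eq by auto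
      then have "(a2 + a1) mod int p \<notin> D" "(a2 + a3) mod int p \<notin> D"
        using mid[OF a(2,1,3)] mid[OF a(2,3,1)] a(5,12) False eq by (auto simp: add.commute)
      moreover have "(a2 + a4) mod int p \<in> D" using eq a(2) assms(7) by blast
      ultimately show ?thesis using a(5-8) eq by (auto simp: add.commute)
    qed
  qed
  then show "u \<in> D \<longleftrightarrow> v \<in> D" "u \<notin> D \<Longrightarrow> V \<inter> D \<noteq> {}" by blast+
qed

text \<open>Some edge comes from A, so 2x and x + y lie in V. The doubles D of B form a cut that
  misses 2x, hence V avoids D. Now no edge comes from B, as it would need an end or a label in D.
  The remaining edges join 2x and 2y only, which cuts off x + y.\<close>

lemma (in sum_partition) no_pair_palette:
  assumes q: "prime q" "q > 3" "p = int q" and S: "S \<subseteq> residues_mod q" and "A = {x, y}" "x \<noteq> y" "card B \<le> 3"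
    and c: "connected_palette p S V" and V: "V \<inter> sumset p A B = {}" and nB: "\<not> connected_palette p B V"
  shows False
proof -
  define D where "D = (\<lambda>b. (b + b) mod p) ` B"
  have xy: "x \<in> residues_mod q" "y \<in> residues_mod q" using S un assms(5) by auto
  have B: "B \<subseteq> residues_mod q" using S un by blast
  have q2: "q > 2" using q(2) by simp
  have eA: "(u = (x + x) mod p \<and> v = (y + y) mod p \<or> u = (y + y) mod p \<and> v = (x + x) mod p) \<and> (x + y) mod p \<in> V"
    if "edge p A V u v" "u \<noteq> v" for u v
    using edge_of_pair[OF q(1) q2 xy, of V u v] that assms(3,5) by (simp add: doubleton_eq_iff)
  have eB: "(u \<in> D \<longleftrightarrow> v \<in> D) \<and> (u \<notin> D \<longrightarrow> V \<inter> D \<noteq> {})" if "edge p B V u v" "u \<noteq> v" for u v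
    using edge_of_triple[OF q(1,2) B assms(7), of V u v D] that q(3) D_def by blast
  have inV: "u \<in> V" "v \<in> V" if "edge p T V u v" for T u v using that unfolding edge_def by blast+
  \<comment> \<open>Without an edge from A all edges would come from B, and V would be a palette of
    B.\<close>
  obtain u0 v0 where uv: "edge p A V u0 v0" "u0 \<noteq> v0"
    using connected_palette_cong[OF c, of B] nB edge_same_side[OF V] by blast
  have mid: "(x + y) mod p \<in> V" "(x + x) mod p \<in> V" using eA[OF uv] inV[OF uv(1)] by blast+
  have notD: "(x + x) mod p \<notin> D" "(y + y) mod p \<notin> D"
    using double_cancel[OF q(1) q2] xy B disjoint assms(5) q(3) unfolding D_def by blast+
  have "V \<subseteq> D \<or> V \<inter> D = {}"
  proof (rule connected_paletteD[OF c])
    fix u v assume e: "edge p S V u v" "u \<noteq> v"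
    then consider "edge p A V u v" | "edge p B V u v" using edge_same_side[OF V] by blast
    then show "u \<in> D \<longleftrightarrow> v \<in> D"
    proof cases
      case 1
      then have "u \<notin> D" "v \<notin> D" using eA[OF 1 e(2)] notD by blast+
      then show ?thesis by blast
    next
      case 2
      then show ?thesis using eB e(2) by blast
    qed
  qed
  then have D: "V \<inter> D = {}" using mid notD by blast
  have "V \<subseteq> {(x + x) mod p, (y + y) mod p} \<or> V \<inter> {(x + x) mod p, (y + y) mod p} = {}"
  proof (rule connected_paletteD[OF c])
    fix u v assume e: "edge p S V u v" "u \<noteq> v"
    have "\<not> edge p B V u v" using eB[OF _ e(2)] inV D by blast
    then have "edge p A V u v" using edge_same_side[OF V e(1)] by blast
    then show "u \<in> {(x + x) mod p, (y + y) mod p} \<longleftrightarrow> v \<in> {(x + x) mod p, (y + y) mod p}"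
      using eA e(2) by blast
  qed
  then have "(x + y) mod p = (x + x) mod p \<or> (y + x) mod p = (y + y) mod p" using mid by (auto simp: add.commute)
  then show False
    using residue_cancel[of x y p x] residue_cancel[of y x p y] xy assms(3,6) by auto
qed

text \<open>Since n \<le> 6, there are at most five colors, and the smaller part has at most two.
  One point carries no edge between distinct vertices, so the palette descends to the other part and
  the induction applies; two points are excluded by \<open>no_pair_palette\<close>. In the last case
  the set has at least four elements, so n > 4 supplies p > 3.\<close>

lemma no_small_palette:
  assumes "prime p" "p > 2" "n \<le> 6" "n > 4 \<Longrightarrow> p > 3"
    and small: "\<And>S. S \<subseteq> residues_mod p \<Longrightarrow> 2 \<le> card S \<Longrightarrow> card S < n \<Longrightarrow> parted (int p) S"
    and S: "S \<subseteq> residues_mod p" "card S < n"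
  shows "\<not> connected_palette (int p) S V"
  using S
proof (induction "card S" arbitrary: S V rule: less_induct)
  case less
  show ?case
  proof
    assume c: "connected_palette (int p) S V"
    have fin: "finite S" using less.prems(1) finite_subset[of S "residues_mod p"] by (simp add: residues_mod_def)
    have p0: "int p > 0" using assms(2) by simp
    have S': "S \<subseteq> {0..<int p}" using less.prems(1) by (simp add: residues_mod_def)
    have "2 \<le> card S"
    proof (rule ccontr)
      assume "\<not> ?thesis"
      then have "card S \<le> 1" by simp
      then have eq: "x = y" if "x \<in> S" "y \<in> S" for x y using card_le_Suc0_iff_eq[OF fin] that by simp
      obtain u v where "u \<in> V" "v \<in> V" "u \<noteq> v" using connected_paletteE[OF c] .
      moreover have "u \<in> sumset (int p) S S" "v \<in> sumset (int p) S S"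
        using connected_palette_subset[OF c] calculation by blast+
      ultimately show False using eq by (auto elim!: sumsetE)
    qed
    then have "parted (int p) S" using small less.prems by blast
    then obtain A0 B0 where AB0: "A0 \<union> B0 = S" "A0 \<noteq> {}" "B0 \<noteq> {}"
      "sumset (int p) A0 B0 \<inter> (sumset (int p) A0 A0 \<union> sumset (int p) B0 B0) = {}"
      unfolding parted_def by blast
    obtain A B where AB: "A \<union> B = S" "A \<noteq> {}" "B \<noteq> {}"
      "sumset (int p) A B \<inter> (sumset (int p) A A \<union> sumset (int p) B B) = {}" "card A \<le> card B"
    proof (cases "card A0 \<le> card B0")
      case True
      then show ?thesis using that[OF AB0] by blast
    next
      case False
      have "sumset (int p) B0 A0 \<inter> (sumset (int p) B0 B0 \<union> sumset (int p) A0 A0) = {}"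
        using AB0(4) by (simp add: sumset_commute[of _ B0 A0] Un_commute)
      then show ?thesis using that[of B0 A0] AB0 False by auto
    qed
    interpret sum_partition "int p" S A B using AB by unfold_locales
    have finAB: "finite A" "finite B" using fin un by auto
    have card: "card S = card A + card B" using card_Un_disjoint[OF finAB disjoint] un by simp
    have A1: "card A \<ge> 1" using finAB ne by (simp add: Suc_leI card_gt_0_iff)
    consider "V \<subseteq> sumset (int p) A B" | "V \<inter> sumset (int p) A B = {}" using palette_cases[OF c] by blast
    then show False
    proof cases
      case 1
      obtain S1 V1 where "S1 \<subseteq> {0..<int p}" "card S1 < card S" "connected_palette (int p) S1 V1"
        using palette_shrink[OF c 1 S' p0] by blast
      then show False using less.hyps[of S1 V1] less.prems by (simp add: residues_mod_def)
    next
      case 2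
      have nB: "\<not> connected_palette (int p) B V"
        using less.hyps[of B V] less.prems un card A1 by auto
      have "card A \<noteq> 1"
      proof
        assume "card A = 1"
        then obtain x where x: "A = {x}" by (rule card_1_singletonE)
        have "connected_palette (int p) B V"
        proof (rule connected_palette_cong[OF c])
          fix u v assume e: "edge (int p) S V u v" "u \<noteq> v"
          have "\<not> edge (int p) A V u v" using e(2) unfolding edge_def x by auto
          then show "edge (int p) B V u v" using edge_same_side[OF 2 e(1)] by blast
        qed
        then show False using nB by blast
      qed
      then have cA: "card A = 2" and cB: "card B \<le> 3" using AB(5) card A1 less.prems(2) assms(3) by linarith+
      obtain x y where "A = {x, y}" "x \<noteq> y" using cA by (meson card_2_iff)
      moreover have "p > 3" using assms(4) AB(5) cA card less.prems(2) by simp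
      ultimately show False
        using no_pair_palette[OF assms(1) _ refl less.prems(1) _ _ cB c 2 nB] by blast
    qed
  qed
qed

text \<open>The relation \<open>M\<close> contains the pairs of colors on the two sides of an arc, in both orders.\<close>

definition crossing_colors :: "int \<Rightarrow> (int \<times> int) set \<Rightarrow> int \<Rightarrow> int \<Rightarrow> int \<Rightarrow> int \<Rightarrow> bool" where
  "crossing_colors p M x1 x2 x3 x4 \<longleftrightarrow> (x1, x2) \<in> M \<and> (x3, x4) \<in> M \<and> (x1, x3) \<in> M \<and> (x2, x4) \<in> M \<and>
     (x1 + x3) mod p = (x2 + x4) mod p"

text \<open>The two equations follow a strand through a crossing: x1, x2 become x3, x4 along the
  under-arc, and x1, x3 become x2, x4 along the over-arc. The predicate \<open>h\<close> sees the
  pair and not only its sum, which is what \<open>coloring_not_parted\<close> needs in order to tell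
  the parts of a partition from each other.\<close>

definition connected_coloring :: "int \<Rightarrow> (int \<times> int) set \<Rightarrow> bool" where
  "connected_coloring p M \<longleftrightarrow>
     (\<exists>x1 x2 x3 x4. crossing_colors p M x1 x2 x3 x4 \<and> \<not> (x1 = x4 \<and> x3 = x2)) \<and>
     (\<forall>h :: int \<Rightarrow> int \<Rightarrow> bool. (\<forall>x y. h x y = h y x) \<longrightarrow>
        (\<forall>x1 x2 x3 x4. crossing_colors p M x1 x2 x3 x4 \<longrightarrow> h x1 x2 = h x3 x4 \<and> h x1 x3 = h x2 x4) \<longrightarrow>
        (\<forall>(x, y)\<in>M. \<forall>(x', y')\<in>M. h x y = h x' y'))"

lemma connected_coloringD:
  fixes h :: "int \<Rightarrow> int \<Rightarrow> bool"
  assumes "connected_coloring p M" "\<And>x y. h x y = h y x"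
    "\<And>x1 x2 x3 x4. crossing_colors p M x1 x2 x3 x4 \<Longrightarrow> h x1 x2 = h x3 x4 \<and> h x1 x3 = h x2 x4"
    "(x, y) \<in> M" "(x', y') \<in> M"
  shows "h x y = h x' y'"
proof -
  have "\<forall>(x, y)\<in>M. \<forall>(x', y')\<in>M. h x y = h x' y'"
    using assms(1)[unfolded connected_coloring_def, THEN conjunct2, rule_format, of h] assms(2,3) by blast
  then show ?thesis using assms(4,5) by blast
qed

text \<open>Membership of the sum in a cut is a predicate on pairs, so it is constant along the
  knot. A nontrivially colored crossing supplies two distinct vertices: x1 + x2 = x3 + x4 and x1 +
  x3 = x2 + x4 would give 2 x2 = 2 x3, hence x2 = x3 and x1 = x4.\<close>

lemma connected_coloring_palette:
  assumes c: "connected_coloring (int p) M" and M: "M \<subseteq> S \<times> S" and S: "S \<subseteq> residues_mod p" and p: "prime p" "p > 2"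
  shows "connected_palette (int p) S ((\<lambda>(x, y). (x + y) mod int p) ` M)" (is "connected_palette _ _ ?V")
  unfolding connected_palette_def
proof (intro conjI allI impI)
  obtain x1 x2 x3 x4 where x: "crossing_colors (int p) M x1 x2 x3 x4" "\<not> (x1 = x4 \<and> x3 = x2)"
    using conjunct1[OF c[unfolded connected_coloring_def]] by blast
  have in_M: "(x1, x2) \<in> M" "(x3, x4) \<in> M" and eq: "(x1 + x3) mod int p = (x2 + x4) mod int p"
    using x(1) unfolding crossing_colors_def by blast+
  then have xS: "x1 \<in> residues_mod p" "x2 \<in> residues_mod p" "x3 \<in> residues_mod p" "x4 \<in> residues_mod p"
    using M S by blast+
  have "(x1 + x2) mod int p \<noteq> (x3 + x4) mod int p"
  proof
    assume "(x1 + x2) mod int p = (x3 + x4) mod int p"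
    then have 1: "int p dvd (x1 + x2) - (x3 + x4)" using mod_eq_dvd_iff by blast
    have 2: "int p dvd (x1 + x3) - (x2 + x4)" using eq mod_eq_dvd_iff by blast
    have "int p dvd ((x1 + x2) - (x3 + x4)) - ((x1 + x3) - (x2 + x4))" using 1 2 by (rule dvd_diff)
    moreover have "((x1 + x2) - (x3 + x4)) - ((x1 + x3) - (x2 + x4)) = (x2 + x2) - (x3 + x3)" by simp
    ultimately have "(x2 + x2) mod int p = (x3 + x3) mod int p" using mod_eq_dvd_iff[of "x2 + x2" "int p" "x3 + x3"] by simp
    then have "x2 = x3" using double_cancel[OF p _ xS(2,3)] by blast
    moreover have "x1 = x4"
      using residue_cancel[of x2 x1 "int p" x4] eq \<open>x2 = x3\<close> xS by (simp add: add.commute)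
    ultimately show False using x(2) by blast
  qed
  moreover have "(x1 + x2) mod int p \<in> ?V" "(x3 + x4) mod int p \<in> ?V" using in_M by force+
  ultimately show "\<exists>u\<in>?V. \<exists>v\<in>?V. u \<noteq> v" by blast
next
  fix X assume X: "\<forall>u v. edge (int p) S ?V u v \<longrightarrow> (u \<in> X \<longleftrightarrow> v \<in> X)"
  have "((x + y) mod int p \<in> X) = ((x' + y') mod int p \<in> X)" if xy: "(x, y) \<in> M" "(x', y') \<in> M" for x y x' y'
  proof (rule connected_coloringD[OF c _ _ xy])
    show "((x + y) mod int p \<in> X) = ((y + x) mod int p \<in> X)" for x y by (simp add: add.commute)
    fix x1 x2 x3 x4 assume q: "crossing_colors (int p) M x1 x2 x3 x4"
    then have m: "(x1, x2) \<in> M" "(x3, x4) \<in> M" "(x1, x3) \<in> M" "(x1 + x3) mod int p = (x2 + x4) mod int p"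
      unfolding crossing_colors_def by blast+
    have "(x1 + x2) mod int p \<in> ?V" "(x3 + x4) mod int p \<in> ?V" "(x1 + x3) mod int p \<in> ?V" using m by force+
    moreover have "x1 \<in> S" "x2 \<in> S" "x3 \<in> S" "x4 \<in> S" using m M by blast+
    ultimately have "edge (int p) S ?V ((x1 + x2) mod int p) ((x3 + x4) mod int p)"
      unfolding edge_def using m(4) by blast
    then show "((x1 + x2) mod int p \<in> X) = ((x3 + x4) mod int p \<in> X) \<and>
        ((x1 + x3) mod int p \<in> X) = ((x2 + x4) mod int p \<in> X)"
      using X m(4) by simp
  qed
  then have "(u \<in> X) = (v \<in> X)" if "u \<in> ?V" "v \<in> ?V" for u v
    using that by (auto simp del: mod_add_eq)
  then show "?V \<subseteq> X \<or> ?V \<inter> X = {}" by blast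
qed

text \<open>If all sums are across the parts, \<open>palette_shrink\<close> contradicts
  \<open>no\<close>. If none is, the two colors at each arc lie in the same part, this part is
  constant along the knot, and the palette uses only a proper subset of S, again contradicting
  \<open>no\<close>.\<close>

lemma (in sum_partition) coloring_not_parted:
  assumes q: "prime q" "q > 2" "p = int q" and S: "S \<subseteq> residues_mod q"
    and no: "\<And>S' V. S' \<subseteq> residues_mod q \<Longrightarrow> card S' < card S \<Longrightarrow> \<not> connected_palette p S' V"
    and c: "connected_coloring p M" and M: "M \<subseteq> S \<times> S"
  shows False
proof -
  define V where "V = (\<lambda>(x, y). (x + y) mod p) ` M"
  have pal: "connected_palette p S V" using connected_coloring_palette[of q M S] c M S q V_def by simp
  have S': "S \<subseteq> {0..<p}" using S q(3) by (simp add: residues_mod_def)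
  have fin: "finite S" using S' finite_subset by blast
  have p0: "p > 0" using q by simp
  consider "V \<subseteq> sumset p A B" | "V \<inter> sumset p A B = {}" using palette_cases[OF pal] by blast
  then show False
  proof cases
    case 1
    then show False using palette_shrink[OF pal 1 S' p0] no q(3) by (auto simp: residues_mod_def)
  next
    case 2
    have side: "x \<in> A \<longleftrightarrow> y \<in> A" if "(x, y) \<in> M" for x y
    proof -
      have "x \<in> S" "y \<in> S" using that M by blast+
      moreover have "(x + y) mod p \<in> V" using that V_def by force
      ultimately show ?thesis using sum_in_iff 2 by blast
    qed
    have "(x \<in> A \<and> y \<in> A) = (x' \<in> A \<and> y' \<in> A)" if xy: "(x, y) \<in> M" "(x', y') \<in> M" for x y x' y'
    proof (rule connected_coloringD[OF c _ _ xy])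
      fix x1 x2 x3 x4 assume "crossing_colors p M x1 x2 x3 x4"
      then show "(x1 \<in> A \<and> x2 \<in> A) = (x3 \<in> A \<and> x4 \<in> A) \<and> (x1 \<in> A \<and> x3 \<in> A) = (x2 \<in> A \<and> x4 \<in> A)"
        unfolding crossing_colors_def using side by blast
    qed blast
    then have "M \<subseteq> A \<times> A \<or> M \<subseteq> B \<times> B" using side M un by blast
    then obtain C where C: "C = A \<or> C = B" "M \<subseteq> C \<times> C" by blast
    have "C \<subset> S" using C(1) un disjoint ne by blast
    then have "card C < card S" "C \<subseteq> residues_mod q" using psubset_card_mono[OF fin] S by blast+
    moreover have "connected_palette p C V"
      using connected_coloring_palette[of q M C] c C(2) q V_def \<open>C \<subseteq> residues_mod q\<close> by simp
    ultimately show False using no by blast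
  qed
qed

section \<open>Regions along a plane curve\<close>

lemma independent_bound:
  fixes u v :: complex
  assumes "Im (cnj u * v) \<noteq> 0"
  obtains m where "m > 0" "\<And>a b. m * (\<bar>a\<bar> + \<bar>b\<bar>) \<le> norm (a *\<^sub>R u + b *\<^sub>R v)"
proof -
  define d where "d = \<bar>Im (cnj u * v)\<bar>"
  have d: "d > 0" using assms by (simp add: d_def)
  have uv: "norm u > 0" using assms by auto
  define m where "m = d / (norm u + norm v)"
  have pos: "norm u + norm v > 0" using uv by (simp add: add_pos_nonneg)
  have "m * (\<bar>a\<bar> + \<bar>b\<bar>) \<le> norm (a *\<^sub>R u + b *\<^sub>R v)" for a b
  proof -
    let ?w = "a *\<^sub>R u + b *\<^sub>R v"
    have "Im (cnj ?w * v) = a * Im (cnj u * v)" by (simp add: algebra_simps)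
    then have 1: "\<bar>a\<bar> * d \<le> norm ?w * norm v"
      using abs_Im_le_cmod[of "cnj ?w * v"] unfolding norm_mult complex_mod_cnj
      by (simp only: d_def abs_mult)
    have "Im (cnj u * ?w) = b * Im (cnj u * v)" by (simp add: algebra_simps)
    then have 2: "\<bar>b\<bar> * d \<le> norm u * norm ?w"
      using abs_Im_le_cmod[of "cnj u * ?w"] unfolding norm_mult complex_mod_cnj
      by (simp only: d_def abs_mult)
    have "(\<bar>a\<bar> + \<bar>b\<bar>) * d \<le> norm ?w * (norm u + norm v)"
      using 1 2 by (simp add: algebra_simps)
    then show ?thesis using pos by (simp add: m_def field_simps)
  qed
  moreover have "m > 0" using d pos by (simp add: m_def)
  ultimately show ?thesis using that by blast
qed

lemma at_right_happens: "eventually P (at_right (0 :: real)) \<Longrightarrow> \<exists>\<epsilon>. P \<epsilon>"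
  by (rule eventually_happens'[OF trivial_limit_at_right_real])

lemma positive_lower_bound:
  fixes a b c d :: real
  assumes "0 < a" "0 < b" "0 < c" "0 < d"
  shows "\<exists>e>0. e \<le> a \<and> e \<le> b \<and> e \<le> c \<and> e \<le> d"
  using assms by (intro exI[of _ "min (min a b) (min c d)"]) auto

text \<open>Continuity of \<open>c'\<close> makes the linear approximation uniform for all chords
  near x, not only for those that start at x.\<close>

lemma strict_derivative:
  fixes c c' :: "real \<Rightarrow> complex"
  assumes d: "\<And>t. (c has_vector_derivative c' t) (at t)" and cont: "continuous_on UNIV c'" and "\<kappa> > 0"
  shows "\<forall>\<^sub>F \<delta> in at_right 0. \<forall>t\<in>ball x \<delta>. \<forall>t'\<in>ball x \<delta>.
    norm (c t' - c t - (t' - t) *\<^sub>R c' x) \<le> \<kappa> * \<bar>t' - t\<bar>"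
proof -
  have "isCont c' x" using cont by (simp add: continuous_on_eq_continuous_at)
  then obtain d where d0: "d > 0" and dd: "\<And>t. dist t x < d \<Longrightarrow> dist (c' t) (c' x) < \<kappa>"
    using \<open>\<kappa> > 0\<close> unfolding continuous_at_eps_delta by blast
  have "norm (c t' - c t - (t' - t) *\<^sub>R c' x) \<le> \<kappa> * \<bar>t' - t\<bar>"
    if "t \<in> ball x d" "t' \<in> ball x d" for t t'
  proof -
    have "norm (c t' - c t - (t' - t) *\<^sub>R c' x) \<le> norm (t' - t) * \<kappa>"
    proof (rule vector_differentiable_bound_linearization[where S = "ball x d"])
      show "(c has_vector_derivative c' s) (at s within ball x d)" for s
        using d has_vector_derivative_at_within by blast
      show "closed_segment t t' \<subseteq> ball x d" using that by (intro closed_segment_subset convex_ball)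
      show "norm (c' s - c' x) \<le> \<kappa>" if "s \<in> ball x d" for s
        using dd[of s] that by (simp add: dist_norm dist_commute less_imp_le)
      show "x \<in> ball x d" using d0 by simp
    qed
    then show ?thesis by (simp add: mult.commute)
  qed
  then show ?thesis using d0 unfolding eventually_at_right_field
    by (intro exI[of _ d]) (auto simp: ball_def)
qed

text \<open>Chords of the two curves are close to multiples of the independent vectors
  \<open>c' x\<close> and \<open>g' y\<close>, so equal chords must vanish. This is how strips and
  quadrilaterals swept out next to the curve are seen to miss it.\<close>

lemma transversal:
  fixes c c' g g' :: "real \<Rightarrow> complex"
  assumes "\<And>t. (c has_vector_derivative c' t) (at t)" "continuous_on UNIV c'"
    and "\<And>t. (g has_vector_derivative g' t) (at t)" "continuous_on UNIV g'"
    and ind: "Im (cnj (c' x) * g' y) \<noteq> 0"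
  shows "\<forall>\<^sub>F \<delta> in at_right 0. \<forall>t\<in>ball x \<delta>. \<forall>t'\<in>ball x \<delta>. \<forall>s\<in>ball y \<delta>. \<forall>s'\<in>ball y \<delta>.
    c t' - c t = g s' - g s \<longrightarrow> t' = t \<and> s' = s"
proof -
  obtain m where m: "m > 0" "\<And>a b. m * (\<bar>a\<bar> + \<bar>b\<bar>) \<le> norm (a *\<^sub>R c' x + b *\<^sub>R g' y)"
    using independent_bound[OF ind] by blast
  \<comment> \<open>Half of the lower bound absorbs both linearization errors.\<close>
  have m2: "m / 2 > 0" using m by simp
  show ?thesis
    using strict_derivative[OF assms(1,2) m2, of x] strict_derivative[OF assms(3,4) m2, of y]
  proof eventually_elim
    case (elim \<delta>)
    show ?case
    proof (intro ballI impI)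
      fix t t' s s' assume a: "t \<in> ball x \<delta>" "t' \<in> ball x \<delta>" "s \<in> ball y \<delta>" "s' \<in> ball y \<delta>" "c t' - c t = g s' - g s"
      define e where "e = c t' - c t - (t' - t) *\<^sub>R c' x"
      define f where "f = g s' - g s - (s' - s) *\<^sub>R g' y"
      have "norm e \<le> m / 2 * \<bar>t' - t\<bar>" "norm f \<le> m / 2 * \<bar>s' - s\<bar>"
        using elim a(1-4) unfolding e_def f_def by blast+
      moreover have "(t' - t) *\<^sub>R c' x + (- (s' - s)) *\<^sub>R g' y = f - e"
        using a(5) by (simp add: e_def f_def algebra_simps)
      then have "m * (\<bar>t' - t\<bar> + \<bar>s' - s\<bar>) \<le> norm (f - e)"
        using m(2)[of "t' - t" "- (s' - s)"] by (simp only: abs_minus_cancel)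
      moreover have "norm (f - e) \<le> norm f + norm e" by (rule norm_triangle_ineq4)
      ultimately have "m * (\<bar>t' - t\<bar> + \<bar>s' - s\<bar>) \<le> m / 2 * (\<bar>t' - t\<bar> + \<bar>s' - s\<bar>)"
        by (simp add: algebra_simps)
      then have "m / 2 * (\<bar>t' - t\<bar> + \<bar>s' - s\<bar>) \<le> 0" by (simp add: algebra_simps)
      then have "\<bar>t' - t\<bar> + \<bar>s' - s\<bar> \<le> 0" using m2 by (simp add: mult_le_0_iff)
      then show "t' = t \<and> s' = s" by linarith
    qed
  qed
qed

lemma tangent_cone:
  fixes c c' :: "real \<Rightarrow> complex"
  assumes "\<And>t. (c has_vector_derivative c' t) (at t)" "continuous_on UNIV c'"
    and "\<kappa> > 0" "c' x \<noteq> 0"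
  shows "\<forall>\<^sub>F \<delta> in at_right 0. \<forall>t\<in>ball x \<delta>. \<bar>Im (cnj (c' x) * (c t - c x))\<bar> \<le> \<kappa> * norm (c t - c x)"
proof -
  define v where "v = norm (c' x)"
  have v: "v > 0" using assms(4) by (simp add: v_def)
  \<comment> \<open>The choice makes v * \<epsilon> equal to \<kappa> * (v - \<epsilon>). Per unit
    of parameter, v * \<epsilon> bounds the determinant with the tangent vector from above, and v -
    \<epsilon> bounds the length of the chord from below.\<close>
  define \<epsilon> where "\<epsilon> = \<kappa> * v / (v + \<kappa>)"
  have \<epsilon>: "\<epsilon> > 0" using v assms(3) by (simp add: \<epsilon>_def)
  have eps: "v * \<epsilon> = \<kappa> * (v - \<epsilon>)" using v assms(3) by (simp add: \<epsilon>_def field_simps)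
  show ?thesis using strict_derivative[OF assms(1,2) \<epsilon>, of x] eventually_at_right_less[of 0]
  proof eventually_elim
    case (elim \<delta>)
    show ?case
    proof
      fix t assume t: "t \<in> ball x \<delta>"
      define e where "e = c t - c x - (t - x) *\<^sub>R c' x"
      have "x \<in> ball x \<delta>" using elim(2) by simp
      then have e: "norm e \<le> \<epsilon> * \<bar>t - x\<bar>" using elim(1) t unfolding e_def by blast
      have eq: "c t - c x = (t - x) *\<^sub>R c' x + e" by (simp add: e_def)
      have "Im (cnj (c' x) * (c t - c x)) = Im (cnj (c' x) * e)" unfolding eq by (simp add: algebra_simps)
      also have "\<bar>\<dots>\<bar> \<le> v * norm e" using abs_Im_le_cmod[of "cnj (c' x) * e"] by (simp add: norm_mult v_def)
      also have "\<dots> \<le> v * (\<epsilon> * \<bar>t - x\<bar>)" using e v by simp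
      also have "\<dots> = (v * \<epsilon>) * \<bar>t - x\<bar>" by simp
      also have "\<dots> = \<kappa> * (v * \<bar>t - x\<bar> - \<epsilon> * \<bar>t - x\<bar>)" unfolding eps by (simp add: algebra_simps)
      also have "\<dots> \<le> \<kappa> * (norm ((t - x) *\<^sub>R c' x) - norm e)" using e assms(3) by (simp add: v_def mult.commute)
      also have "\<dots> \<le> \<kappa> * norm (c t - c x)" unfolding eq
        by (rule mult_left_mono[OF norm_diff_ineq less_imp_le[OF assms(3)]])
      finally show "\<bar>Im (cnj (c' x) * (c t - c x))\<bar> \<le> \<kappa> * norm (c t - c x)" .
    qed
  qed
qed

section \<open>Regions entered along a path\<close>

definition leads :: "complex set \<Rightarrow> (real \<Rightarrow> complex) \<Rightarrow> complex set \<Rightarrow> bool" where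
  "leads K \<gamma> R \<longleftrightarrow> R \<in> components (- K) \<and> (\<forall>\<^sub>F \<epsilon> in at_right 0. \<gamma> \<epsilon> \<in> R)"

lemma leads_unique:
  assumes "leads K \<gamma> R" "leads K \<gamma> R'"
  shows "R = R'"
proof -
  have "\<forall>\<^sub>F \<epsilon> in at_right (0 :: real). \<gamma> \<epsilon> \<in> R \<inter> R'"
    using assms unfolding leads_def by (auto elim: eventually_elim2)
  from at_right_happens[OF this] have "R \<inter> R' \<noteq> {}" by blast
  then show ?thesis using assms components_eq unfolding leads_def by blast
qed

locale plane_curve =
  fixes c c' :: "real \<Rightarrow> complex"
  assumes deriv: "(c has_vector_derivative c' t) (at t)" and cont: "continuous_on UNIV c'"
    and per: "c (t + 1) = c t" and nz: "c' t \<noteq> 0"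
begin

lemma per_int: "c (t + of_int k) = c t"
proof -
  have nat: "c (t + of_nat n) = c t" for n t
  proof (induction n)
    case (Suc n)
    then show ?case using per[of "t + of_nat n"] by (simp add: algebra_simps)
  qed simp
  show ?thesis
  proof (cases "k \<ge> 0")
    case True
    then show ?thesis using nat[of t "nat k"] by simp
  next
    case False
    then show ?thesis using nat[of "t + of_int k" "nat (- k)"] by simp
  qed
qed

lemma deriv_per: "c' (t + of_int k) = c' t"
proof -
  have "((\<lambda>s. c (s + of_int k)) has_vector_derivative c' (t + of_int k)) (at t)"
  proof -
    have "((\<lambda>s. s + of_int k) has_vector_derivative 1) (at t)"
      by (auto intro!: derivative_eq_intros simp: has_vector_derivative_def)
    from vector_diff_chain_at[OF this deriv] show ?thesis by (simp add: o_def)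
  qed
  then have "(c has_vector_derivative c' (t + of_int k)) (at t)" by (simp add: per_int)
  then show ?thesis using vector_derivative_unique_at deriv by blast
qed

lemma cont_curve: "continuous_on S c"
  using deriv has_vector_derivative_continuous by (intro continuous_at_imp_continuous_on) blast

text \<open>The case x = y describes simple points, so the local lemmas treat arcs and crossings
  together.\<close>

definition branches :: "real \<Rightarrow> real \<Rightarrow> bool" where
  "branches x y \<longleftrightarrow> c x = c y \<and> (\<forall>t. c t = c x \<longrightarrow> (\<exists>k :: int. t = x + of_int k \<or> t = y + of_int k))"

abbreviation simple :: "real \<Rightarrow> bool" where
  "simple t \<equiv> branches t t"

lemma branches_sym: "branches x y \<Longrightarrow> branches y x"
  unfolding branches_def by metis

text \<open>In one period, the parameters away from all preimages of \<open>c x\<close> form a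
  compact set whose image keeps a positive distance from \<open>c x\<close>. The other parameters
  are brought close to x or y by an integer shift.\<close>

lemma near_branch:
  assumes br: "branches x y" and "\<delta> > 0"
  shows "\<exists>\<rho>>0. \<forall>t. dist (c t) (c x) < \<rho> \<longrightarrow> (\<exists>t'. c t' = c t \<and> (t' \<in> ball x \<delta> \<or> t' \<in> ball y \<delta>))"
proof -
  define U where "U = (\<Union>w\<in>{w. c w = c x}. ball w \<delta>)"
  have "compact (c ` ({0..1} - U))"
    by (intro compact_continuous_image cont_curve compact_diff compact_Icc) (auto simp: U_def)
  moreover have "c x \<notin> c ` ({0..1} - U)" using \<open>\<delta> > 0\<close> by (auto simp: U_def)
  ultimately obtain \<rho> where \<rho>: "\<rho> > 0" "\<And>w. w \<in> c ` ({0..1} - U) \<Longrightarrow> \<rho> \<le> dist (c x) w"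
    using separate_point_closed[of "c ` ({0..1} - U)" "c x"] compact_imp_closed by blast
  have "\<exists>t'. c t' = c t \<and> (t' \<in> ball x \<delta> \<or> t' \<in> ball y \<delta>)" if t: "dist (c t) (c x) < \<rho>" for t
  proof -
    have ct: "c (frac t) = c t" using per_int[of "frac t" "\<lfloor>t\<rfloor>"] by (simp add: frac_def)
    have "frac t \<in> {0..1}" using frac_lt_1[of t] by (simp add: less_imp_le)
    moreover have "frac t \<notin> {0..1} - U"
    proof
      assume "frac t \<in> {0..1} - U"
      then have "c (frac t) \<in> c ` ({0..1} - U)" by (rule imageI)
      from \<rho>(2)[OF this] show False using t ct by (simp add: dist_commute)
    qed
    ultimately obtain w where w: "c w = c x" "frac t \<in> ball w \<delta>" by (auto simp: U_def)
    then obtain k :: int where "w = x + of_int k \<or> w = y + of_int k" using br unfolding branches_def by blast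
    then have "frac t - of_int k \<in> ball x \<delta> \<or> frac t - of_int k \<in> ball y \<delta>"
      using w(2) by (auto simp: dist_real_def algebra_simps)
    moreover have "c (frac t - of_int k) = c t" using per_int[of "frac t - of_int k" k] ct by simp
    ultimately show ?thesis by blast
  qed
  then show ?thesis using \<rho>(1) by blast
qed

text \<open>A one-sided tangent direction, meaningful for straight rays and for differentiable paths
  alike. It allows a region found by following a path to be identified with one found by a
  ray.\<close>

definition ahead :: "complex \<Rightarrow> (real \<Rightarrow> complex) \<Rightarrow> complex \<Rightarrow> bool" where
  "ahead z \<gamma> w \<longleftrightarrow> ((\<lambda>\<epsilon>. (\<gamma> \<epsilon> - z) /\<^sub>R \<epsilon>) \<longlongrightarrow> w) (at_right 0)"

text \<open>The inequality is homogeneous, so it may be tested on the difference quotient, which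
  tends to w.\<close>

lemma ahead_in_cone:
  assumes "ahead z \<gamma> w" "\<kappa> * norm w < q * Im (cnj v * w)"
  shows "\<forall>\<^sub>F \<epsilon> in at_right 0. \<kappa> * norm (\<gamma> \<epsilon> - z) < q * Im (cnj v * (\<gamma> \<epsilon> - z))"
proof -
  have "((\<lambda>\<epsilon>. q * Im (cnj v * ((\<gamma> \<epsilon> - z) /\<^sub>R \<epsilon>)) - \<kappa> * norm ((\<gamma> \<epsilon> - z) /\<^sub>R \<epsilon>)) \<longlongrightarrow>
      q * Im (cnj v * w) - \<kappa> * norm w) (at_right 0)"
    using assms(1) unfolding ahead_def by (intro tendsto_intros)
  then have "\<forall>\<^sub>F \<epsilon> in at_right 0. 0 < q * Im (cnj v * ((\<gamma> \<epsilon> - z) /\<^sub>R \<epsilon>)) - \<kappa> * norm ((\<gamma> \<epsilon> - z) /\<^sub>R \<epsilon>)"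
    using assms(2) by (intro order_tendstoD(1)) auto
  then show ?thesis using eventually_at_right_less[of 0]
  proof eventually_elim
    case (elim \<epsilon>)
    have "q * Im (cnj v * ((\<gamma> \<epsilon> - z) /\<^sub>R \<epsilon>)) - \<kappa> * norm ((\<gamma> \<epsilon> - z) /\<^sub>R \<epsilon>) =
        (q * Im (cnj v * (\<gamma> \<epsilon> - z)) - \<kappa> * norm (\<gamma> \<epsilon> - z)) / \<epsilon>"
    proof -
      have "norm ((\<gamma> \<epsilon> - z) /\<^sub>R \<epsilon>) = norm (\<gamma> \<epsilon> - z) / \<epsilon>"
        using elim(2) unfolding norm_scaleR by (simp add: divide_inverse mult.commute)
      moreover have "Im (cnj v * ((\<gamma> \<epsilon> - z) /\<^sub>R \<epsilon>)) = Im (cnj v * (\<gamma> \<epsilon> - z)) / \<epsilon>"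
        unfolding mult_scaleR_right scaleR_complex.sel by (simp only: divide_inverse mult.commute)
      ultimately show ?thesis by (simp only: diff_divide_distrib times_divide_eq_right)
    qed
    then have "0 < (q * Im (cnj v * (\<gamma> \<epsilon> - z)) - \<kappa> * norm (\<gamma> \<epsilon> - z)) / \<epsilon>" using elim(1) by simp
    then show ?case using elim(2) by (simp add: zero_less_divide_iff)
  qed
qed

lemma ahead_in_ball:
  assumes "ahead z \<gamma> w" "\<rho> > 0"
  shows "\<forall>\<^sub>F \<epsilon> in at_right 0. norm (\<gamma> \<epsilon> - z) < \<rho>"
proof -
  have "((\<lambda>\<epsilon>. \<epsilon> *\<^sub>R ((\<gamma> \<epsilon> - z) /\<^sub>R \<epsilon>)) \<longlongrightarrow> 0 *\<^sub>R w) (at_right 0)"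
    using assms(1) unfolding ahead_def by (intro tendsto_intros)
  then have "((\<lambda>\<epsilon>. norm (\<epsilon> *\<^sub>R ((\<gamma> \<epsilon> - z) /\<^sub>R \<epsilon>))) \<longlongrightarrow> 0) (at_right 0)"
    by (intro tendsto_norm_zero) (simp only: scaleR_zero_left)
  then have "\<forall>\<^sub>F \<epsilon> in at_right 0. norm (\<epsilon> *\<^sub>R ((\<gamma> \<epsilon> - z) /\<^sub>R \<epsilon>)) < \<rho>"
    using assms(2) by (rule order_tendstoD(2))
  then show ?thesis using eventually_at_right_less[of 0]
    by eventually_elim simp
qed

lemma convex_cone: "\<kappa> \<ge> 0 \<Longrightarrow> convex {\<zeta>. \<kappa> * norm \<zeta> < q * Im (cnj v * \<zeta>)}"
proof (rule convexI)
  fix x y :: complex and a b :: real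
  assume k: "\<kappa> \<ge> 0" and ab: "0 \<le> a" "0 \<le> b" "a + b = 1"
    and xy: "x \<in> {\<zeta>. \<kappa> * norm \<zeta> < q * Im (cnj v * \<zeta>)}" "y \<in> {\<zeta>. \<kappa> * norm \<zeta> < q * Im (cnj v * \<zeta>)}"
  have "\<kappa> * norm (a *\<^sub>R x + b *\<^sub>R y) \<le> \<kappa> * (a * norm x + b * norm y)"
    using k ab norm_triangle_ineq[of "a *\<^sub>R x" "b *\<^sub>R y"] by (intro mult_left_mono) auto
  also have "\<dots> = a * (\<kappa> * norm x) + b * (\<kappa> * norm y)" by (simp add: algebra_simps)
  also have "\<dots> < a * (q * Im (cnj v * x)) + b * (q * Im (cnj v * y))"
  proof (cases "a = 0")
    case True
    then show ?thesis using xy ab by simp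
  next
    case False
    then have "a > 0" using ab by simp
    then show ?thesis using xy ab by (intro add_less_le_mono mult_strict_left_mono mult_left_mono) auto
  qed
  also have "\<dots> = q * Im (cnj v * (a *\<^sub>R x + b *\<^sub>R y))" by (simp add: algebra_simps)
  finally show "a *\<^sub>R x + b *\<^sub>R y \<in> {\<zeta>. \<kappa> * norm \<zeta> < q * Im (cnj v * \<zeta>)}" by simp
qed

text \<open>The directions \<open>w1\<close> and \<open>w2\<close> lie in the same sector between the tangent lines at \<open>c x\<close>.\<close>

lemma wedge:
  assumes br: "branches x y" and q: "\<bar>q1\<bar> = 1" "\<bar>q2\<bar> = 1"
    and w1: "q1 * Im (cnj (c' x) * w1) > 0" "q2 * Im (cnj (c' y) * w1) > 0"
    and w2: "q1 * Im (cnj (c' x) * w2) > 0" "q2 * Im (cnj (c' y) * w2) > 0"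
    and \<gamma>1: "ahead (c x) \<gamma>1 w1"
  shows "\<exists>R. leads (range c) \<gamma>1 R \<and> (\<forall>\<gamma>2. ahead (c x) \<gamma>2 w2 \<longrightarrow> leads (range c) \<gamma>2 R)"
proof -
  obtain b where b: "b > 0" "b \<le> q1 * Im (cnj (c' x) * w1)" "b \<le> q2 * Im (cnj (c' y) * w1)"
    "b \<le> q1 * Im (cnj (c' x) * w2)" "b \<le> q2 * Im (cnj (c' y) * w2)"
    using positive_lower_bound[OF w1 w2] by blast
  \<comment> \<open>So small that both directions satisfy the two strict cone inequalities, whereas
    by \<open>tangent_cone\<close> each nearby point of the curve violates one of them. The cone cut
    off at radius \<rho> is then a convex piece of the complement.\<close>
  define \<kappa> where "\<kappa> = b / (1 + norm w1 + norm w2)"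
  have n: "1 + norm w1 + norm w2 > 0" by (simp add: add_pos_nonneg)
  have \<kappa>: "\<kappa> > 0" using b n by (simp add: \<kappa>_def)
  have "\<kappa> * norm w1 < \<kappa> * (1 + norm w1 + norm w2)" "\<kappa> * norm w2 < \<kappa> * (1 + norm w1 + norm w2)"
    using \<kappa> by (intro mult_strict_left_mono; simp add: add_pos_nonneg add_nonneg_pos)+
  moreover have "\<kappa> * (1 + norm w1 + norm w2) = b" using n by (simp add: \<kappa>_def)
  ultimately have kw: "\<kappa> * norm w1 < b" "\<kappa> * norm w2 < b" by simp_all
  have "\<forall>\<^sub>F \<delta> in at_right (0 :: real). \<delta> > 0 \<and>
      (\<forall>t\<in>ball x \<delta>. \<bar>Im (cnj (c' x) * (c t - c x))\<bar> \<le> \<kappa> * norm (c t - c x)) \<and>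
      (\<forall>t\<in>ball y \<delta>. \<bar>Im (cnj (c' y) * (c t - c y))\<bar> \<le> \<kappa> * norm (c t - c y))"
    using eventually_at_right_less[of 0] tangent_cone[OF deriv cont \<kappa> nz, of x] tangent_cone[OF deriv cont \<kappa> nz, of y]
    by eventually_elim blast
  from at_right_happens[OF this] obtain \<delta> where \<delta>: "\<delta> > 0"
    "\<And>t. t \<in> ball x \<delta> \<Longrightarrow> \<bar>Im (cnj (c' x) * (c t - c x))\<bar> \<le> \<kappa> * norm (c t - c x)"
    "\<And>t. t \<in> ball y \<delta> \<Longrightarrow> \<bar>Im (cnj (c' y) * (c t - c y))\<bar> \<le> \<kappa> * norm (c t - c y)"
    by blast
  obtain \<rho> where \<rho>: "\<rho> > 0"
    "\<And>t. dist (c t) (c x) < \<rho> \<Longrightarrow> \<exists>t'. c t' = c t \<and> (t' \<in> ball x \<delta> \<or> t' \<in> ball y \<delta>)"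
    using near_branch[OF br \<delta>(1)] by blast
  define K where "K = {\<zeta>. \<kappa> * norm \<zeta> < q1 * Im (cnj (c' x) * \<zeta>)} \<inter>
    {\<zeta>. \<kappa> * norm \<zeta> < q2 * Im (cnj (c' y) * \<zeta>)} \<inter> ball 0 \<rho>"
  define T where "T = (+) (c x) ` K"
  have "convex T" unfolding T_def K_def using \<kappa>
    by (intro convex_translation convex_Int convex_cone convex_ball) auto
  then have conn: "connected T" by (rule convex_connected)
  have "c t \<notin> T" for t
  proof
    assume "c t \<in> T"
    then have ct: "c t - c x \<in> K" by (auto simp: T_def)
    then have "dist (c t) (c x) < \<rho>" by (simp add: K_def dist_norm norm_minus_commute)
    then obtain t' where t': "c t' = c t" "t' \<in> ball x \<delta> \<or> t' \<in> ball y \<delta>" using \<rho>(2) by blast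
    have cxy: "c x = c y" using br by (simp add: branches_def)
    from t'(2) show False
    proof
      assume "t' \<in> ball x \<delta>"
      from \<delta>(2)[OF this] have "\<bar>q1 * Im (cnj (c' x) * (c t - c x))\<bar> \<le> \<kappa> * norm (c t - c x)"
        using t'(1) q by (simp add: abs_mult)
      from abs_le_D1[OF this] show False using ct by (simp add: K_def)
    next
      assume "t' \<in> ball y \<delta>"
      from \<delta>(3)[OF this] have "\<bar>q2 * Im (cnj (c' y) * (c t - c x))\<bar> \<le> \<kappa> * norm (c t - c x)"
        using t'(1) q cxy by (simp add: abs_mult)
      from abs_le_D1[OF this] show False using ct by (simp add: K_def)
    qed
  qed
  then have sub: "T \<subseteq> - range c" by blast
  have ev: "\<forall>\<^sub>F \<epsilon> in at_right 0. \<gamma> \<epsilon> \<in> T" if "ahead (c x) \<gamma> w" "w = w1 \<or> w = w2" for \<gamma> w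
  proof -
    have "\<kappa> * norm w < q1 * Im (cnj (c' x) * w)" "\<kappa> * norm w < q2 * Im (cnj (c' y) * w)"
      using that(2) kw b by auto
    from ahead_in_cone[OF that(1) this(1)] ahead_in_cone[OF that(1) this(2)] ahead_in_ball[OF that(1) \<rho>(1)]
    show ?thesis
    proof eventually_elim
      case (elim \<epsilon>)
      then have "\<gamma> \<epsilon> - c x \<in> K" by (simp add: K_def)
      then have "c x + (\<gamma> \<epsilon> - c x) \<in> T" unfolding T_def by blast
      then show ?case by simp
    qed
  qed
  have "T \<noteq> {}" using at_right_happens[OF ev[OF \<gamma>1]] by blast
  then obtain R where R: "R \<in> components (- range c)" "T \<subseteq> R"
    using exists_component_superset[OF sub _ conn] sub by blast
  have "leads (range c) \<gamma> R" if "ahead (c x) \<gamma> w" "w = w1 \<or> w = w2" for \<gamma> w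
    using ev[OF that] R unfolding leads_def by (auto elim: eventually_mono)
  then show ?thesis using \<gamma>1 by blast
qed

lemma ahead_ray: "ahead z (\<lambda>\<epsilon>. z + \<epsilon> *\<^sub>R w) w"
proof -
  have "\<forall>\<^sub>F \<epsilon> in at_right 0. (z + \<epsilon> *\<^sub>R w - z) /\<^sub>R \<epsilon> = w"
    using eventually_at_right_less[of 0] by eventually_elim simp
  then show ?thesis unfolding ahead_def by (rule tendsto_eventually)
qed

lemma ahead_curve:
  assumes "(\<gamma> has_vector_derivative w) (at 0)"
  shows "ahead (\<gamma> 0) \<gamma> w"
proof -
  have "(\<gamma> has_vector_derivative w) (at_right 0)" using assms by (rule has_vector_derivative_at_within)
  then have "((\<lambda>h. (\<gamma> h - \<gamma> 0 - (h - 0) *\<^sub>R w) /\<^sub>R norm (h - 0)) \<longlongrightarrow> 0) (at_right 0)"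
    unfolding has_vector_derivative_def has_derivative_at_within by blast
  moreover have "\<forall>\<^sub>F h in at_right (0 :: real). (\<gamma> h - \<gamma> 0 - (h - 0) *\<^sub>R w) /\<^sub>R norm (h - 0) = (\<gamma> h - \<gamma> 0) /\<^sub>R h - w"
    using eventually_at_right_less[of 0] by eventually_elim (simp add: scaleR_diff_right)
  ultimately have "((\<lambda>h. (\<gamma> h - \<gamma> 0) /\<^sub>R h - w) \<longlongrightarrow> 0) (at_right 0)"
    by (rule Lim_transform_eventually)
  then show ?thesis unfolding ahead_def by (rule LIM_zero_cancel)
qed

end

section \<open>Sides of the curve and sectors at a crossing\<close>

context plane_curve
begin

text \<open>The normal \<open>\<i> * c' t\<close> points to the left, so \<sigma> = 1 is the left
  side in the direction of travel.\<close>

definition side :: "real \<Rightarrow> real \<Rightarrow> complex set \<Rightarrow> bool" where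
  "side t \<sigma> R \<longleftrightarrow> leads (range c) (\<lambda>\<epsilon>. c t + \<epsilon> *\<^sub>R (\<sigma> *\<^sub>R (\<i> * c' t))) R"

lemma side_unique: "side t \<sigma> R \<Longrightarrow> side t \<sigma> R' \<Longrightarrow> R = R'"
  unfolding side_def by (rule leads_unique)

lemma side_region: "side t \<sigma> R \<Longrightarrow> R \<in> components (- range c)"
  by (simp add: side_def leads_def)

lemma side_per: "side (t + of_int k) \<sigma> R = side t \<sigma> R"
  by (simp add: side_def per_int deriv_per)

lemma normal_positive:
  assumes "\<bar>\<sigma>\<bar> = 1"
  shows "\<sigma> * Im (cnj (c' t) * (\<sigma> *\<^sub>R (\<i> * c' t))) > 0"
proof -
  have "\<sigma> * Im (cnj (c' t) * (\<sigma> *\<^sub>R (\<i> * c' t))) = (\<sigma> * \<sigma>) * ((Re (c' t))\<^sup>2 + (Im (c' t))\<^sup>2)"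
    by (simp add: algebra_simps power2_eq_square)
  moreover have "\<sigma> * \<sigma> = 1" using assms abs_mult_self_eq[of \<sigma>] by simp
  moreover have "(Re (c' t))\<^sup>2 + (Im (c' t))\<^sup>2 > 0" using nz[of t] complex_neq_0 by blast
  ultimately show ?thesis by simp
qed

text \<open>At a simple point the two tangent lines in \<open>wedge\<close> coincide and the sector
  is a half-plane, so every path leaving into it reaches the region of the normal ray.\<close>

lemma side_of_path:
  assumes "simple t" "\<bar>\<sigma>\<bar> = 1" "\<sigma> * Im (cnj (c' t) * w) > 0" "ahead (c t) \<gamma> w" "leads (range c) \<gamma> R"
  shows "side t \<sigma> R"
proof -
  obtain R' where R': "leads (range c) \<gamma> R'"
    "\<forall>\<gamma>2. ahead (c t) \<gamma>2 (\<sigma> *\<^sub>R (\<i> * c' t)) \<longrightarrow> leads (range c) \<gamma>2 R'"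
    using wedge[OF assms(1,2,2,3,3) normal_positive[OF assms(2)] normal_positive[OF assms(2)] assms(4)] by blast
  have "R' = R" using leads_unique[OF R'(1) assms(5)] .
  then show ?thesis using R'(2) ahead_ray unfolding side_def by blast
qed

lemma near_curve:
  assumes "\<rho> > 0"
  shows "\<forall>\<^sub>F \<delta> in at_right 0. \<forall>t\<in>ball x \<delta>. norm (c t - c x) < \<rho>"
proof -
  have "isCont c x" using deriv has_vector_derivative_continuous by blast
  then obtain d where "d > 0" "\<And>t. dist t x < d \<Longrightarrow> dist (c t) (c x) < \<rho>"
    using assms unfolding continuous_at_eps_delta by blast
  then show ?thesis unfolding eventually_at_right_field
    by (intro exI[of _ d]) (auto simp: dist_norm norm_minus_commute)
qed

lemma near_sign:
  assumes "q * Im (cnj (c' x) * w) > 0"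
  shows "\<forall>\<^sub>F \<delta> in at_right 0. \<forall>t\<in>ball x \<delta>. q * Im (cnj (c' t) * w) > 0"
proof -
  have "isCont c' x" using cont by (simp add: continuous_on_eq_continuous_at)
  then have "((\<lambda>t. q * Im (cnj (c' t) * w)) \<longlongrightarrow> q * Im (cnj (c' x) * w)) (at x)"
    unfolding isCont_def by (intro tendsto_intros)
  then have "\<forall>\<^sub>F t in at x. q * Im (cnj (c' t) * w) > 0"
    using assms by (rule order_tendstoD(1))
  then obtain d where d: "d > 0" "\<And>t. t \<noteq> x \<Longrightarrow> dist t x < d \<Longrightarrow> q * Im (cnj (c' t) * w) > 0"
    unfolding eventually_at by blast
  have "q * Im (cnj (c' t) * w) > 0" if "dist t x < d" for t
    using d(2)[of t] that assms by (cases "t = x") simp_all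
  then show ?thesis using d(1) unfolding eventually_at_right_field
    by (intro exI[of _ d]) (auto simp: dist_commute)
qed

lemma affine_derivative: "((\<lambda>h. c (x + \<sigma> * h)) has_vector_derivative \<sigma> *\<^sub>R c' x) (at 0)"
proof -
  have "((\<lambda>h. x + \<sigma> * h) has_vector_derivative \<sigma>) (at 0)"
    by (auto intro!: derivative_eq_intros simp: has_vector_derivative_def mult.commute)
  moreover have "(c has_vector_derivative c' x) (at (x + \<sigma> * 0))" using deriv by simp
  ultimately show ?thesis using vector_diff_chain_at[of "\<lambda>h. x + \<sigma> * h" \<sigma> 0 c "c' x"] by (simp add: o_def)
qed

text \<open>Pushing the curve slightly in the fixed direction w sweeps out a connected strip.
  Transversality of the curve to straight lines in direction w keeps the strip off the curve, so it
  lies in one region. As w points to the same side at all nearby parameters, this region is that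
  side for each of them.\<close>

lemma side_locally_constant:
  assumes s: "simple t0" and \<sigma>: "\<bar>\<sigma>\<bar> = 1"
  shows "\<exists>R. \<exists>\<delta>>0. \<forall>t\<in>ball t0 \<delta>. simple t \<longrightarrow> side t \<sigma> R"
proof -
  define w where "w = \<sigma> *\<^sub>R (\<i> * c' t0)"
  have pos: "\<sigma> * Im (cnj (c' t0) * w) > 0" using normal_positive[OF \<sigma>] by (simp only: w_def)
  then have ind: "Im (cnj (c' t0) * w) \<noteq> 0" by force
  have g: "((\<lambda>s. s *\<^sub>R w) has_vector_derivative w) (at r)" for r
    by (auto intro!: derivative_eq_intros simp: has_vector_derivative_def)
  from at_right_happens[OF eventually_conj[OF eventually_at_right_less[of 0]
      transversal[OF deriv cont g continuous_on_const ind, where y = 0]]]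
  obtain \<delta>1 where \<delta>1: "\<delta>1 > 0"
    "\<And>t t' s s'. t \<in> ball t0 \<delta>1 \<Longrightarrow> t' \<in> ball t0 \<delta>1 \<Longrightarrow> s \<in> ball 0 \<delta>1 \<Longrightarrow> s' \<in> ball 0 \<delta>1 \<Longrightarrow>
      c t' - c t = s' *\<^sub>R w - s *\<^sub>R w \<Longrightarrow> t' = t \<and> s' = s"
    by blast
  obtain \<rho> where \<rho>: "\<rho> > 0"
    "\<And>t. dist (c t) (c t0) < \<rho> \<Longrightarrow> \<exists>t'. c t' = c t \<and> t' \<in> ball t0 \<delta>1"
    using near_branch[OF s \<delta>1(1)] by blast
  have \<rho>2: "\<rho> / 2 > 0" using \<rho> by simp
  from at_right_happens[OF eventually_conj[OF eventually_at_right_less[of 0]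
      eventually_conj[OF near_curve[OF \<rho>2, of t0] near_sign[OF pos]]]]
  obtain \<delta>2 where \<delta>2: "\<delta>2 > 0" "\<And>t. t \<in> ball t0 \<delta>2 \<Longrightarrow> norm (c t - c t0) < \<rho> / 2"
    "\<And>t. t \<in> ball t0 \<delta>2 \<Longrightarrow> \<sigma> * Im (cnj (c' t) * w) > 0"
    by blast
  define \<nu> where "\<nu> = norm w + 1"
  have w1: "\<nu> > 0" by (simp add: add_nonneg_pos \<nu>_def)
  define \<delta>3 where "\<delta>3 = \<rho> / 2 / \<nu>"
  have \<delta>3: "\<delta>3 > 0" using \<rho>(1) w1 by (simp add: \<delta>3_def)
  have small: "norm (k *\<^sub>R w) < \<rho> / 2" if "0 < k" "k < \<delta>3" for k
  proof -
    have "norm (k *\<^sub>R w) \<le> k * \<nu>" using that by (simp add: algebra_simps \<nu>_def)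
    also have "\<dots> < \<delta>3 * \<nu>" using that w1 by simp
    also have "\<dots> = \<rho> / 2" using w1 by (simp add: \<delta>3_def)
    finally show ?thesis .
  qed
  define \<delta> where "\<delta> = min \<delta>1 (min \<delta>2 \<delta>3)"
  have \<delta>: "\<delta> > 0" "\<delta> \<le> \<delta>1" "\<delta> \<le> \<delta>2" "\<delta> \<le> \<delta>3" using \<delta>1 \<delta>2 \<delta>3 by (auto simp: \<delta>_def)
  define T where "T = (\<lambda>(t, k). c t + k *\<^sub>R w) ` (ball t0 \<delta> \<times> {0<..<\<delta>})"
  have conn: "connected T" unfolding T_def split_beta
    by (intro connected_continuous_image connected_Times continuous_intros
        continuous_on_compose2[OF cont_curve[of UNIV]]) auto
  have "c r \<notin> T" for r
  proof
    assume "c r \<in> T"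
    then obtain t k where tk: "t \<in> ball t0 \<delta>" "0 < k" "k < \<delta>" "c r = c t + k *\<^sub>R w" unfolding T_def by auto
    have t: "t \<in> ball t0 \<delta>1" "t \<in> ball t0 \<delta>2" using tk(1) \<delta> by auto
    have "norm (c r - c t0) = norm ((c t - c t0) + k *\<^sub>R w)" by (simp add: tk(4) algebra_simps)
    also have "\<dots> \<le> norm (c t - c t0) + norm (k *\<^sub>R w)" by (rule norm_triangle_ineq)
    also have "\<dots> < \<rho>" using \<delta>2(2)[OF t(2)] small[of k] tk \<delta> by linarith
    finally have "dist (c r) (c t0) < \<rho>" by (simp add: dist_norm)
    then obtain r' where r': "c r' = c r" "r' \<in> ball t0 \<delta>1" using \<rho>(2) by blast
    have "c r' - c t = k *\<^sub>R w - 0 *\<^sub>R w" using r' tk by simp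
    then have "k = 0" using \<delta>1(2)[OF t(1) r'(2), of 0 k] tk \<delta> \<delta>1(1) by simp
    then show False using tk by simp
  qed
  then have sub: "T \<subseteq> - range c" by blast
  have "c t0 + (\<delta> / 2) *\<^sub>R w \<in> T" unfolding T_def using \<delta>(1) by force
  then obtain R where R: "R \<in> components (- range c)" "T \<subseteq> R"
    using exists_component_superset[OF sub _ conn] sub by blast
  have "side t \<sigma> R" if t: "t \<in> ball t0 \<delta>" "simple t" for t
  proof (rule side_of_path[OF t(2) \<sigma> _ ahead_ray])
    show "\<sigma> * Im (cnj (c' t) * w) > 0" using \<delta>2(3)[of t] t(1) \<delta>(3) by simp
    have "\<forall>\<^sub>F k in at_right 0. k < \<delta>" using \<delta>(1) by (auto simp: eventually_at_right_field)
    then have "\<forall>\<^sub>F k in at_right 0. c t + k *\<^sub>R w \<in> T"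
      using eventually_at_right_less[of 0]
      by eventually_elim (use t(1) in \<open>force simp: T_def\<close>)
    then show "leads (range c) (\<lambda>k. c t + k *\<^sub>R w) R"
      unfolding leads_def using R by (auto elim: eventually_mono)
  qed
  then show ?thesis using \<delta>(1) by blast
qed

text \<open>The sector is modelled by the points c (t0 + \<tau> * h) + c (s0 + \<sigma> * k) - z
  with small positive h and k. By transversality none of them is on the curve, so they lie in one
  region. Along the diagonal h = k they leave the crossing in the direction of the ray; for fixed h
  they leave the strand through t0 sideways. Hence the region of the sector is also the region on
  one side of that strand.\<close>

lemma quadrant_half:
  assumes br: "branches s0 t0" and ind: "Im (cnj (c' t0) * c' s0) \<noteq> 0" and \<sigma>: "\<bar>\<sigma>\<bar> = 1" and \<tau>: "\<bar>\<tau>\<bar> = 1"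
  shows "\<exists>R. leads (range c) (\<lambda>\<epsilon>. c s0 + \<epsilon> *\<^sub>R (\<sigma> *\<^sub>R c' s0 + \<tau> *\<^sub>R c' t0)) R \<and>
    (\<exists>\<delta>>0. \<forall>h. 0 < h \<longrightarrow> h < \<delta> \<longrightarrow> simple (t0 + \<tau> * h) \<longrightarrow>
      side (t0 + \<tau> * h) (\<sigma> * sgn (Im (cnj (c' t0) * c' s0))) R)"
proof -
  define z where "z = c s0"
  have z: "c s0 = z" "c t0 = z" using br by (simp_all add: z_def branches_def)
  \<comment> \<open>The sign tells to which side of the strand through t0 the velocity at s0
    points.\<close>
  define \<mu> where "\<mu> = sgn (Im (cnj (c' t0) * c' s0))"
  have \<mu>: "\<bar>\<mu>\<bar> = 1" "\<mu> * Im (cnj (c' t0) * c' s0) > 0" using ind by (auto simp: \<mu>_def sgn_real_def)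
  have sq: "\<sigma> * \<sigma> = 1" "\<tau> * \<tau> = 1" using \<sigma> \<tau> abs_mult_self_eq[of \<sigma>] abs_mult_self_eq[of \<tau>] by simp_all
  from at_right_happens[OF eventually_conj[OF eventually_at_right_less[of 0]
      transversal[OF deriv cont deriv cont ind]]]
  obtain \<delta>1 where \<delta>1: "\<delta>1 > 0"
    "\<And>t t' s s'. t \<in> ball t0 \<delta>1 \<Longrightarrow> t' \<in> ball t0 \<delta>1 \<Longrightarrow> s \<in> ball s0 \<delta>1 \<Longrightarrow> s' \<in> ball s0 \<delta>1 \<Longrightarrow>
      c t' - c t = c s' - c s \<Longrightarrow> t' = t \<and> s' = s"
    by blast
  obtain \<rho> where \<rho>: "\<rho> > 0"
    "\<And>t. dist (c t) z < \<rho> \<Longrightarrow> \<exists>t'. c t' = c t \<and> (t' \<in> ball s0 \<delta>1 \<or> t' \<in> ball t0 \<delta>1)"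
    using near_branch[OF br \<delta>1(1)] unfolding z by blast
  have \<rho>2: "\<rho> / 2 > 0" using \<rho> by simp
  from at_right_happens[OF eventually_conj[OF eventually_at_right_less[of 0]
      eventually_conj[OF near_curve[OF \<rho>2, of t0] eventually_conj[OF near_curve[OF \<rho>2, of s0] near_sign[OF \<mu>(2)]]]]]
  obtain \<delta>2 where \<delta>2: "\<delta>2 > 0" "\<And>t. t \<in> ball t0 \<delta>2 \<Longrightarrow> norm (c t - z) < \<rho> / 2"
    "\<And>t. t \<in> ball s0 \<delta>2 \<Longrightarrow> norm (c t - z) < \<rho> / 2"
    "\<And>t. t \<in> ball t0 \<delta>2 \<Longrightarrow> \<mu> * Im (cnj (c' t) * c' s0) > 0"
    unfolding z by blast
  define \<delta> where "\<delta> = min \<delta>1 \<delta>2"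
  have \<delta>: "\<delta> > 0" "\<delta> \<le> \<delta>1" "\<delta> \<le> \<delta>2" using \<delta>1 \<delta>2 by (auto simp: \<delta>_def)
  have ball_t: "t0 + \<tau> * h \<in> ball t0 r" if "0 < h" "h < \<delta>" "\<delta> \<le> r" for h r
    using that \<tau> by (simp add: dist_real_def abs_mult)
  have ball_s: "s0 + \<sigma> * h \<in> ball s0 r" if "0 < h" "h < \<delta>" "\<delta> \<le> r" for h r
    using that \<sigma> by (simp add: dist_real_def abs_mult)
  define \<Phi> where "\<Phi> h k = c (t0 + \<tau> * h) + c (s0 + \<sigma> * k) - z" for h k
  define T where "T = (\<lambda>(h, k). \<Phi> h k) ` ({0<..<\<delta>} \<times> {0<..<\<delta>})"
  have conn: "connected T" unfolding T_def split_beta \<Phi>_def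
    by (intro connected_continuous_image connected_Times continuous_intros
        continuous_on_compose2[OF cont_curve[of UNIV]]) auto
  have "c r \<notin> T" for r
  proof
    assume "c r \<in> T"
    then obtain h k where hk: "0 < h" "h < \<delta>" "0 < k" "k < \<delta>" "c r = \<Phi> h k" unfolding T_def by auto
    let ?t = "t0 + \<tau> * h" and ?s = "s0 + \<sigma> * k"
    have "norm (c r - z) = norm ((c ?t - z) + (c ?s - z))" by (simp add: hk(5) \<Phi>_def algebra_simps)
    also have "\<dots> \<le> norm (c ?t - z) + norm (c ?s - z)" by (rule norm_triangle_ineq)
    also have "\<dots> < \<rho>"
      using \<delta>2(2)[OF ball_t[OF hk(1,2) \<delta>(3)]] \<delta>2(3)[OF ball_s[OF hk(3,4) \<delta>(3)]] by linarith
    finally have "dist (c r) z < \<rho>" by (simp add: dist_norm)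
    then obtain r' where r': "c r' = c r" "r' \<in> ball s0 \<delta>1 \<or> r' \<in> ball t0 \<delta>1" using \<rho>(2) by blast
    have centers: "s0 \<in> ball s0 \<delta>1" "t0 \<in> ball t0 \<delta>1" using \<delta>1(1) by simp_all
    from r'(2) show False
    proof
      assume "r' \<in> ball t0 \<delta>1"
      \<comment> \<open>Rearranging the definition of \<Phi> equates a chord of one strand with a
        chord of the other, so both are trivial; the second case exchanges the strands.\<close>
      moreover have "c r' - c ?t = c ?s - c s0" using r' hk(5) z by (simp add: \<Phi>_def)
      ultimately have "?s = s0"
        using \<delta>1(2)[OF ball_t[OF hk(1,2) \<delta>(2)] _ centers(1) ball_s[OF hk(3,4) \<delta>(2)]] by blast
      then show False using hk \<sigma> by auto
    next
      assume "r' \<in> ball s0 \<delta>1"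
      moreover have "c ?t - c t0 = c r' - c ?s" using r' hk(5) z by (simp add: \<Phi>_def)
      ultimately have "?t = t0"
        using \<delta>1(2)[OF centers(2) ball_t[OF hk(1,2) \<delta>(2)] ball_s[OF hk(3,4) \<delta>(2)]] by blast
      then show False using hk \<tau> by auto
    qed
  qed
  then have sub: "T \<subseteq> - range c" by blast
  have "\<Phi> (\<delta> / 2) (\<delta> / 2) \<in> T" unfolding T_def using \<delta>(1) by force
  then obtain R where R: "R \<in> components (- range c)" "T \<subseteq> R"
    using exists_component_superset[OF sub _ conn] sub by blast
  have small: "\<forall>\<^sub>F k in at_right 0. k < \<delta>" using \<delta>(1) by (auto simp: eventually_at_right_field)
  have leadsI: "leads (range c) \<gamma> R" if "\<And>k. 0 < k \<Longrightarrow> k < \<delta> \<Longrightarrow> \<gamma> k \<in> T" for \<gamma>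
  proof -
    have "\<forall>\<^sub>F k in at_right 0. \<gamma> k \<in> T"
      using eventually_at_right_less[of 0] small by eventually_elim (rule that)
    then show ?thesis unfolding leads_def using R by (auto elim: eventually_mono)
  qed
  have diag: "leads (range c) (\<lambda>k. \<Phi> k k) R" by (rule leadsI) (auto simp: T_def)
  let ?w = "\<sigma> *\<^sub>R c' s0 + \<tau> *\<^sub>R c' t0"
  have "((\<lambda>k. \<Phi> k k) has_vector_derivative \<tau> *\<^sub>R c' t0 + \<sigma> *\<^sub>R c' s0 - 0) (at 0)"
    unfolding \<Phi>_def by (intro has_vector_derivative_add has_vector_derivative_diff affine_derivative has_vector_derivative_const)
  then have "ahead (\<Phi> 0 0) (\<lambda>k. \<Phi> k k) ?w" using ahead_curve by (simp add: add.commute)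
  then have ahead: "ahead (c s0) (\<lambda>k. \<Phi> k k) ?w" by (simp add: \<Phi>_def z)
  have anti: "Im (cnj (c' s0) * c' t0) = - Im (cnj (c' t0) * c' s0)" by simp
  have i1: "Im (cnj (c' s0) * ?w) = - (\<tau> * Im (cnj (c' t0) * c' s0))" by (simp add: algebra_simps)
  have i2: "Im (cnj (c' t0) * ?w) = \<sigma> * Im (cnj (c' t0) * c' s0)" by (simp add: algebra_simps)
  have q: "\<bar>- \<tau> * \<mu>\<bar> = 1" "\<bar>\<sigma> * \<mu>\<bar> = 1" using \<sigma> \<tau> \<mu>(1) by (simp_all add: abs_mult)
  have p1: "(- \<tau> * \<mu>) * Im (cnj (c' s0) * ?w) > 0"
  proof -
    have "(- \<tau> * \<mu>) * Im (cnj (c' s0) * ?w) = (\<tau> * \<tau>) * (\<mu> * Im (cnj (c' t0) * c' s0))"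
      unfolding i1 by (simp only: mult_minus_left mult_minus_right minus_minus mult_ac)
    then show ?thesis using \<mu>(2) by (simp only: sq mult_1)
  qed
  have p2: "(\<sigma> * \<mu>) * Im (cnj (c' t0) * ?w) > 0"
  proof -
    have "(\<sigma> * \<mu>) * Im (cnj (c' t0) * ?w) = (\<sigma> * \<sigma>) * (\<mu> * Im (cnj (c' t0) * c' s0))"
      unfolding i2 by (simp only: mult_ac)
    then show ?thesis using \<mu>(2) by (simp only: sq mult_1)
  qed
  obtain R' where R': "leads (range c) (\<lambda>k. \<Phi> k k) R'" "\<forall>\<gamma>2. ahead (c s0) \<gamma>2 ?w \<longrightarrow> leads (range c) \<gamma>2 R'"
    using wedge[OF br q p1 p2 p1 p2 ahead] by blast
  have "R' = R" using leads_unique[OF R'(1) diag] .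
  then have ray: "leads (range c) (\<lambda>\<epsilon>. c s0 + \<epsilon> *\<^sub>R ?w) R" using R'(2) ahead_ray by blast
  have "side (t0 + \<tau> * h) (\<sigma> * \<mu>) R" if h: "0 < h" "h < \<delta>" "simple (t0 + \<tau> * h)" for h
  proof (rule side_of_path[OF h(3) q(2)])
    show "leads (range c) (\<lambda>k. \<Phi> h k) R" by (rule leadsI) (use h in \<open>auto simp: T_def\<close>)
    have "((\<lambda>k. \<Phi> h k) has_vector_derivative 0 + \<sigma> *\<^sub>R c' s0 - 0) (at 0)"
      unfolding \<Phi>_def by (intro has_vector_derivative_add has_vector_derivative_diff affine_derivative has_vector_derivative_const)
    then have "ahead (\<Phi> h 0) (\<lambda>k. \<Phi> h k) (\<sigma> *\<^sub>R c' s0)" using ahead_curve by simp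
    then show "ahead (c (t0 + \<tau> * h)) (\<lambda>k. \<Phi> h k) (\<sigma> *\<^sub>R c' s0)" by (simp add: \<Phi>_def z)
    have "(\<sigma> * \<mu>) * Im (cnj (c' (t0 + \<tau> * h)) * \<sigma> *\<^sub>R c' s0) =
        (\<sigma> * \<sigma>) * (\<mu> * Im (cnj (c' (t0 + \<tau> * h)) * c' s0))"
      unfolding mult_scaleR_right scaleR_complex.sel by (simp only: mult_ac)
    then show "(\<sigma> * \<mu>) * Im (cnj (c' (t0 + \<tau> * h)) * (\<sigma> *\<^sub>R c' s0)) > 0"
      using \<delta>2(4)[OF ball_t[OF h(1,2) \<delta>(3)]] by (simp only: sq mult_1)
  qed
  then show ?thesis using ray \<delta>(1) unfolding \<mu>_def by blast
qed

text \<open>Exchanging the two strands in \<open>quadrant_half\<close> yields the same ray from the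
  crossing, so the regions agree and one region serves both strands.\<close>

lemma quadrant:
  assumes br: "branches s0 t0" and ind: "Im (cnj (c' s0) * c' t0) \<noteq> 0" and \<sigma>: "\<bar>\<sigma>\<bar> = 1" and \<tau>: "\<bar>\<tau>\<bar> = 1"
  shows "\<exists>R. leads (range c) (\<lambda>\<epsilon>. c s0 + \<epsilon> *\<^sub>R (\<sigma> *\<^sub>R c' s0 + \<tau> *\<^sub>R c' t0)) R \<and>
    (\<exists>\<delta>>0. \<forall>h. 0 < h \<longrightarrow> h < \<delta> \<longrightarrow>
      (simple (t0 + \<tau> * h) \<longrightarrow> side (t0 + \<tau> * h) (\<sigma> * sgn (Im (cnj (c' t0) * c' s0))) R) \<and>
      (simple (s0 + \<sigma> * h) \<longrightarrow> side (s0 + \<sigma> * h) (\<tau> * sgn (Im (cnj (c' s0) * c' t0))) R))"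
proof -
  have ind': "Im (cnj (c' t0) * c' s0) \<noteq> 0" using ind by (simp add: algebra_simps)
  obtain R \<delta> where R: "leads (range c) (\<lambda>\<epsilon>. c s0 + \<epsilon> *\<^sub>R (\<sigma> *\<^sub>R c' s0 + \<tau> *\<^sub>R c' t0)) R" and \<delta>: "\<delta> > 0"
    "\<And>h. 0 < h \<Longrightarrow> h < \<delta> \<Longrightarrow> simple (t0 + \<tau> * h) \<Longrightarrow>
      side (t0 + \<tau> * h) (\<sigma> * sgn (Im (cnj (c' t0) * c' s0))) R"
    using quadrant_half[OF br ind' \<sigma> \<tau>] by blast
  obtain R' \<delta>' where R': "leads (range c) (\<lambda>\<epsilon>. c t0 + \<epsilon> *\<^sub>R (\<tau> *\<^sub>R c' t0 + \<sigma> *\<^sub>R c' s0)) R'" and \<delta>': "\<delta>' > 0"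
    "\<And>h. 0 < h \<Longrightarrow> h < \<delta>' \<Longrightarrow> simple (s0 + \<sigma> * h) \<Longrightarrow>
      side (s0 + \<sigma> * h) (\<tau> * sgn (Im (cnj (c' s0) * c' t0))) R'"
    using quadrant_half[OF branches_sym[OF br] ind \<tau> \<sigma>] by blast
  have "c t0 = c s0" using br by (simp add: branches_def)
  then have "R' = R" using leads_unique[OF R' R[folded \<open>c t0 = c s0\<close>, unfolded add.commute[of "\<sigma> *\<^sub>R c' s0"]]] by blast
  then show ?thesis
    using R \<delta> \<delta>' by (intro exI[of _ R] conjI exI[of _ "min \<delta> \<delta>'"]) auto
qed

end

section \<open>Colorings of knot diagrams\<close>

text \<open>Color pairs are considered at simple parameters, which do not form an interval. Their
  density still lets the connectedness of the line carry a value past a crossing.\<close>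

lemma locally_constant_on_dense:
  fixes f :: "real \<Rightarrow> 'a" and P :: "real \<Rightarrow> bool"
  assumes dense: "\<And>a b. a < b \<Longrightarrow> \<exists>t. a < t \<and> t < b \<and> P t"
    and local: "\<And>a. \<exists>\<delta>>0. \<forall>x\<in>ball a \<delta>. \<forall>y\<in>ball a \<delta>. P x \<and> P y \<longrightarrow> f x = f y"
    and P: "P x" "P y"
  shows "f x = f y"
proof -
  define R where "R x y \<longleftrightarrow> f x = f y" for x y
  have opD: "\<exists>z. z \<in> T \<and> P z" if T: "openin (top_of_set UNIV) T" "a \<in> T" for T a
  proof -
    have "open T" using T(1) by simp
    then obtain e where e: "e > 0" "ball a e \<subseteq> T" using T(2) by (rule openE)
    have "a < a + e" using e(1) by simp
    then obtain t where t: "a < t" "t < a + e" "P t" using dense by blast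
    then have "t \<in> ball a e" by (simp add: dist_real_def)
    then show ?thesis using e(2) t(3) by blast
  qed
  have opI: "\<exists>T. openin (top_of_set UNIV) T \<and> a \<in> T \<and> (\<forall>x\<in>T. \<forall>y\<in>T. P x \<and> P y \<longrightarrow> R x y)" for a
  proof -
    obtain \<delta> where d: "\<delta> > 0" "\<forall>x\<in>ball a \<delta>. \<forall>y\<in>ball a \<delta>. P x \<and> P y \<longrightarrow> f x = f y" using local[of a] by blast
    have "openin (top_of_set UNIV) (ball a \<delta>)" by simp
    moreover have "a \<in> ball a \<delta>" using d(1) by simp
    ultimately show ?thesis using d(2) unfolding R_def by blast
  qed
  have "R x y"
    by (rule connected_equivalence_relation_gen[where S = UNIV and P = P and R = R, OF connected_UNIV UNIV_I UNIV_I P _ opD opI])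
       (simp_all add: R_def)
  then show ?thesis by (simp add: R_def)
qed

lemma plane_curve_strand:
  assumes "knot_diagram D"
  shows "plane_curve (strand D) (velocity (strand D))"
proof -
  have im: "immersed_circle (strand D)" using assms by (simp add: knot_diagram_def)
  obtain d :: "nat \<Rightarrow> real \<Rightarrow> complex" where d: "d 0 = strand D"
    "\<And>n t. (d n has_vector_derivative d (Suc n) t) (at t)"
    using im unfolding immersed_circle_def smooth_curve_def by blast
  have v: "velocity (strand D) t = d 1 t" for t
    using vector_derivative_at[OF d(2)[of 0 t]] d(1) by simp
  show ?thesis
  proof
    show "(strand D has_vector_derivative velocity (strand D) t) (at t)" for t
      unfolding v using d(2)[of 0 t] d(1) by simp
    have "continuous_on UNIV (d 1)"
      using d(2)[of 1] has_vector_derivative_continuous by (intro continuous_at_imp_continuous_on) blast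
    then show "continuous_on UNIV (velocity (strand D))" by (simp add: v)
  qed (use im in \<open>auto simp: immersed_circle_def\<close>)
qed

locale colored_diagram =
  fixes D :: diagram and p :: nat and C :: "complex set \<Rightarrow> int"
  assumes D: "knot_diagram D" and C: "nontrivial_dehn_coloring p D C"
begin

abbreviation "c \<equiv> strand D"

sublocale plane_curve c "velocity c"
  using plane_curve_strand[OF D] .

lemma frac_curve: "c (frac t) = c t"
  using per_int[of "frac t" "\<lfloor>t\<rfloor>"] by (simp add: frac_def)

lemma frac_range: "frac t \<in> {0..<1 :: real}"
  using frac_lt_1[of t] by simp

lemma double_point_branches:
  assumes "(s, t) \<in> double_points c"
  shows "branches s t"
proof -
  have st: "s \<in> {0..<1}" "t \<in> {0..<1}" "s \<noteq> t" "c s = c t" using assms by (auto simp: double_points_def)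
  let ?P = "{r \<in> {0..<1}. c r = c s}"
  \<comment> \<open>Finiteness has to be shown separately: an infinite set has cardinality 0 and
    would satisfy the bound 2 by default.\<close>
  have "?P \<subseteq> insert s (snd ` double_points c)"
    using st by (force simp: double_points_def image_iff)
  moreover have "finite (double_points c)" using D by (simp add: knot_diagram_def)
  ultimately have fin: "finite ?P" by (meson finite_imageI finite_insert finite_subset)
  have "card ?P \<le> 2" using D by (simp add: knot_diagram_def)
  moreover have "{s, t} \<subseteq> ?P" "card {s, t} = 2" using st by auto
  ultimately have eq: "{s, t} = ?P" using card_seteq[OF fin, of "{s, t}"] by simp
  have "\<exists>k :: int. r = s + of_int k \<or> r = t + of_int k" if "c r = c s" for r
  proof -
    have "frac r \<in> ?P" using that frac_curve frac_range by simp
    then have "frac r = s \<or> frac r = t" using eq by blast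
    then show ?thesis by (intro exI[of _ "\<lfloor>r\<rfloor>"]) (auto simp: frac_def algebra_simps)
  qed
  then show ?thesis using st(4) unfolding branches_def by blast
qed

lemma crossing_double: "(s, t) \<in> crossings D \<Longrightarrow> (s, t) \<in> double_points c"
  using D by (auto simp: knot_diagram_def)

lemma not_simple_crossing:
  assumes "\<not> simple a"
  shows "\<exists>s t. \<exists>k :: int. (s, t) \<in> crossings D \<and> (a = t + of_int k \<or> a = s + of_int k)"
proof -
  obtain x where x: "c x = c a" "\<And>k :: int. x \<noteq> a + of_int k"
    using assms unfolding branches_def by blast
  have ne: "frac a \<noteq> frac x"
  proof
    assume "frac a = frac x"
    then have "x = a + of_int (\<lfloor>x\<rfloor> - \<lfloor>a\<rfloor>)" by (simp add: frac_def)
    then show False using x(2) by blast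
  qed
  then have "(frac a, frac x) \<in> double_points c"
    using frac_range frac_curve x(1) by (simp add: double_points_def)
  then have "(frac a, frac x) \<in> crossings D \<or> (frac x, frac a) \<in> crossings D"
    using D by (auto simp: knot_diagram_def)
  moreover have "a = frac a + of_int \<lfloor>a\<rfloor>" by (simp add: frac_def)
  ultimately show ?thesis by metis
qed

text \<open>The parameters of crossings and their integer translates are countably many.\<close>

lemma simple_dense:
  assumes "a < b"
  shows "\<exists>t. a < t \<and> t < b \<and> simple t"
proof (rule ccontr)
  assume none: "\<not> ?thesis"
  define B where "B = (\<Union>k :: int. (\<lambda>t. t + of_int k) ` (fst ` double_points c \<union> snd ` double_points c))"
  have "finite (double_points c)" using D by (simp add: knot_diagram_def)
  then have "countable (fst ` double_points c \<union> snd ` double_points c)" by (intro countable_finite) simp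
  then have "countable B" unfolding B_def by (intro countable_UN countable_image) auto
  moreover have "{a<..<b} \<subseteq> B"
  proof
    fix t assume "t \<in> {a<..<b}"
    then have "\<not> simple t" using none by auto
    then obtain s t' and k :: int where st: "(s, t') \<in> crossings D" "t = t' + of_int k \<or> t = s + of_int k"
      using not_simple_crossing by blast
    have "s \<in> fst ` double_points c" "t' \<in> snd ` double_points c"
      using crossing_double[OF st(1)] by (metis fst_conv image_eqI, metis snd_conv image_eqI)
    then show "t \<in> B" using st(2) unfolding B_def by blast
  qed
  ultimately show False using uncountable_open_interval[of a b] assms countable_subset by blast
qed

lemma branches_per: "simple (t + of_int k) \<longleftrightarrow> simple t"
proof -
  have "simple (t + of_int k)" if t: "simple t" for t k
    unfolding branches_def
  proof (intro conjI refl allI impI)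
    fix x assume "c x = c (t + of_int k)"
    then obtain l :: int where "x = t + of_int l" using t unfolding branches_def per_int by blast
    then have "x = t + of_int k + of_int (l - k)" by simp
    then show "\<exists>l :: int. x = t + of_int k + of_int l \<or> x = t + of_int k + of_int l" by blast
  qed
  from this[of t k] this[of "t + of_int k" "- k"] show ?thesis by auto
qed

section \<open>Color pairs along the knot\<close>

definition adjacent_colors :: "real \<Rightarrow> int \<Rightarrow> int \<Rightarrow> bool" where
  "adjacent_colors t a b \<longleftrightarrow> (\<exists>q R R'. \<bar>q\<bar> = 1 \<and> side t q R \<and> side t (- q) R' \<and> a = C R \<and> b = C R')"

lemma adjacent_colors_unique:
  assumes "adjacent_colors t a b" "adjacent_colors t a' b'"
  shows "a' = a \<and> b' = b \<or> a' = b \<and> b' = a"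
proof -
  obtain q R R' where 1: "\<bar>q\<bar> = 1" "side t q R" "side t (- q) R'" "a = C R" "b = C R'"
    using assms(1) unfolding adjacent_colors_def by blast
  obtain r Q Q' where 2: "\<bar>r\<bar> = 1" "side t r Q" "side t (- r) Q'" "a' = C Q" "b' = C Q'"
    using assms(2) unfolding adjacent_colors_def by blast
  have "r = q \<or> r = - q" using 1(1) 2(1) by linarith
  then show ?thesis
  proof
    assume "r = q"
    then show ?thesis using 1 2 side_unique by metis
  next
    assume "r = - q"
    then show ?thesis using 1 2 side_unique by (metis minus_minus)
  qed
qed

lemma adjacent_colors_per: "adjacent_colors (t + of_int k) a b = adjacent_colors t a b"
  by (simp add: adjacent_colors_def side_per)

definition arc_pairs :: "(int \<times> int) set" where
  "arc_pairs = {(a, b). \<exists>t. simple t \<and> adjacent_colors t a b}"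

definition ray :: "real \<times> real \<Rightarrow> real \<Rightarrow> real \<Rightarrow> real \<Rightarrow> complex" where
  "ray x \<sigma> \<tau> \<epsilon> = c (fst x) + \<epsilon> *\<^sub>R (\<sigma> *\<^sub>R velocity c (fst x) + \<tau> *\<^sub>R velocity c (snd x))"

lemma sector_region_iff: "sector_region D x \<sigma> \<tau> R \<longleftrightarrow> leads (range c) (ray x \<sigma> \<tau>) R"
  by (simp add: sector_region_def leads_def regions_def ray_def[abs_def])

text \<open>Besides naming the regions of the four sectors, this records what is seen on leaving the
  crossing: along the under-arc in direction \<tau> the two sectors with this \<tau>, and along the
  over-arc in direction \<sigma> the two sectors with this \<sigma>.\<close>

definition sectors :: "real \<Rightarrow> real \<Rightarrow> (real \<Rightarrow> real \<Rightarrow> complex set) \<Rightarrow> real \<Rightarrow> bool" where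
  "sectors s t Q \<delta> \<longleftrightarrow> \<delta> > 0 \<and>
    (\<forall>\<sigma>\<in>{1, -1}. \<forall>\<tau>\<in>{1, -1}. sector_region D (s, t) \<sigma> \<tau> (Q \<sigma> \<tau>)) \<and>
    (\<forall>h. 0 < h \<longrightarrow> h < \<delta> \<longrightarrow>
      (\<forall>\<sigma>\<in>{1, -1}. \<forall>\<tau>\<in>{1, -1}.
        (simple (t + \<tau> * h) \<longrightarrow> adjacent_colors (t + \<tau> * h) (C (Q \<sigma> \<tau>)) (C (Q (- \<sigma>) \<tau>))) \<and>
        (simple (s + \<sigma> * h) \<longrightarrow> adjacent_colors (s + \<sigma> * h) (C (Q \<sigma> \<tau>)) (C (Q \<sigma> (- \<tau>))))))"

lemma sectorsD:
  assumes "sectors s t Q \<delta>"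
  shows "\<delta> > 0"
    and "\<sigma> \<in> {1, -1} \<Longrightarrow> \<tau> \<in> {1, -1} \<Longrightarrow> sector_region D (s, t) \<sigma> \<tau> (Q \<sigma> \<tau>)"
    and "0 < h \<Longrightarrow> h < \<delta> \<Longrightarrow> \<sigma> \<in> {1, -1} \<Longrightarrow> \<tau> \<in> {1, -1} \<Longrightarrow> simple (t + \<tau> * h) \<Longrightarrow>
        adjacent_colors (t + \<tau> * h) (C (Q \<sigma> \<tau>)) (C (Q (- \<sigma>) \<tau>))"
    and "0 < h \<Longrightarrow> h < \<delta> \<Longrightarrow> \<sigma> \<in> {1, -1} \<Longrightarrow> \<tau> \<in> {1, -1} \<Longrightarrow> simple (s + \<sigma> * h) \<Longrightarrow>
        adjacent_colors (s + \<sigma> * h) (C (Q \<sigma> \<tau>)) (C (Q \<sigma> (- \<tau>)))"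
  using assms unfolding sectors_def by blast+

lemma crossing_sectors:
  assumes "(s, t) \<in> crossings D"
  shows "\<exists>Q \<delta>. sectors s t Q \<delta>"
proof -
  have dp: "(s, t) \<in> double_points c" using crossing_double[OF assms] .
  have br: "branches s t" using double_point_branches[OF dp] .
  have ind: "Im (cnj (velocity c s) * velocity c t) \<noteq> 0" using D dp by (auto simp: knot_diagram_def)
  define \<mu> where "\<mu> = sgn (Im (cnj (velocity c t) * velocity c s))"
  define \<nu> where "\<nu> = sgn (Im (cnj (velocity c s) * velocity c t))"
  have \<mu>: "\<bar>\<mu>\<bar> = 1" "\<bar>\<nu>\<bar> = 1" using ind by (auto simp: \<mu>_def \<nu>_def sgn_real_def algebra_simps)
  define good where "good \<sigma> \<tau> R \<delta> \<longleftrightarrow> sector_region D (s, t) \<sigma> \<tau> R \<and> \<delta> > 0 \<and> (\<forall>h. 0 < h \<longrightarrow> h < \<delta> \<longrightarrow>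
      (simple (t + \<tau> * h) \<longrightarrow> side (t + \<tau> * h) (\<sigma> * \<mu>) R) \<and>
      (simple (s + \<sigma> * h) \<longrightarrow> side (s + \<sigma> * h) (\<tau> * \<nu>) R))" for \<sigma> \<tau> R \<delta>
  have ex: "\<exists>R \<delta>. good \<sigma> \<tau> R \<delta>" if "\<bar>\<sigma>\<bar> = 1" "\<bar>\<tau>\<bar> = 1" for \<sigma> \<tau>
    using quadrant[OF br ind that] unfolding good_def \<mu>_def \<nu>_def sector_region_iff ray_def[abs_def] fst_conv snd_conv
    by blast
  obtain R11 d11 where g11: "good 1 1 R11 d11" using ex[of 1 1] by auto
  obtain R12 d12 where g12: "good 1 (-1) R12 d12" using ex[of 1 "-1"] by auto
  obtain R21 d21 where g21: "good (-1) 1 R21 d21" using ex[of "-1" 1] by auto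
  obtain R22 d22 where g22: "good (-1) (-1) R22 d22" using ex[of "-1" "-1"] by auto
  define Q where "Q \<sigma> \<tau> = (if \<sigma> = 1 then if \<tau> = 1 then R11 else R12 else if \<tau> = 1 then R21 else R22)" for \<sigma> \<tau> :: real
  define \<delta> where "\<delta> = min (min d11 d12) (min d21 d22)"
  have pos: "d11 > 0" "d12 > 0" "d21 > 0" "d22 > 0" using g11 g12 g21 g22 unfolding good_def by blast+
  have good: "good \<sigma> \<tau> (Q \<sigma> \<tau>) \<delta>" if "\<sigma> \<in> {1, -1}" "\<tau> \<in> {1, -1}" for \<sigma> \<tau>
  proof -
    have "\<delta> > 0" "\<delta> \<le> d11" "\<delta> \<le> d12" "\<delta> \<le> d21" "\<delta> \<le> d22" using pos by (auto simp: \<delta>_def)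
    moreover have "good \<sigma> \<tau> (Q \<sigma> \<tau>) (if \<sigma> = 1 then if \<tau> = 1 then d11 else d12 else if \<tau> = 1 then d21 else d22)"
      using that g11 g12 g21 g22 by (auto simp: Q_def)
    ultimately show ?thesis unfolding good_def by (smt (verit, best))
  qed
  have "\<delta> > 0" using pos by (simp add: \<delta>_def)
  moreover have "sector_region D (s, t) \<sigma> \<tau> (Q \<sigma> \<tau>)" if "\<sigma> \<in> {1, -1}" "\<tau> \<in> {1, -1}" for \<sigma> \<tau>
    using good[OF that] unfolding good_def by blast
  moreover have "adjacent_colors (t + \<tau> * h) (C (Q \<sigma> \<tau>)) (C (Q (- \<sigma>) \<tau>))"
    if h: "0 < h" "h < \<delta>" "simple (t + \<tau> * h)" and st: "\<sigma> \<in> {1, -1}" "\<tau> \<in> {1, -1}" for h \<sigma> \<tau>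
  proof -
    have "- \<sigma> \<in> {1, -1}" using st by auto
    then have "side (t + \<tau> * h) (\<sigma> * \<mu>) (Q \<sigma> \<tau>)" "side (t + \<tau> * h) (- \<sigma> * \<mu>) (Q (- \<sigma>) \<tau>)"
      using good st h unfolding good_def by blast+
    moreover have "\<bar>\<sigma> * \<mu>\<bar> = 1" using st \<mu> by (auto simp: abs_mult)
    ultimately show ?thesis unfolding adjacent_colors_def mult_minus_left by blast
  qed
  moreover have "adjacent_colors (s + \<sigma> * h) (C (Q \<sigma> \<tau>)) (C (Q \<sigma> (- \<tau>)))"
    if h: "0 < h" "h < \<delta>" "simple (s + \<sigma> * h)" and st: "\<sigma> \<in> {1, -1}" "\<tau> \<in> {1, -1}" for h \<sigma> \<tau>
  proof -
    have "- \<tau> \<in> {1, -1}" using st by auto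
    then have "side (s + \<sigma> * h) (\<tau> * \<nu>) (Q \<sigma> \<tau>)" "side (s + \<sigma> * h) (- \<tau> * \<nu>) (Q \<sigma> (- \<tau>))"
      using good st h unfolding good_def by blast+
    moreover have "\<bar>\<tau> * \<nu>\<bar> = 1" using st \<mu> by (auto simp: abs_mult)
    ultimately show ?thesis unfolding adjacent_colors_def mult_minus_left by blast
  qed
  ultimately have "sectors s t Q \<delta>" unfolding sectors_def by blast
  then show ?thesis by blast
qed

text \<open>Each of the four half-arcs at the crossing contains simple parameters arbitrarily close
  to it, so every two neighboring sectors give an arc pair. A ray leads to only one region, so the
  given regions are those of the sectors.\<close>

lemma crossing_quadruple:
  assumes x: "(s, t) \<in> crossings D" and st: "\<sigma> \<in> {1, -1}" "\<tau> \<in> {1, -1}"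
    and R: "sector_region D (s, t) \<sigma> \<tau> x1" "sector_region D (s, t) (- \<sigma>) \<tau> x2"
      "sector_region D (s, t) \<sigma> (- \<tau>) x3" "sector_region D (s, t) (- \<sigma>) (- \<tau>) x4"
  shows "crossing_colors (int p) arc_pairs (C x1) (C x2) (C x3) (C x4)"
proof -
  obtain Q \<delta> where "sectors s t Q \<delta>" using crossing_sectors[OF x] by blast
  note \<delta> = sectorsD(1)[OF this] and Q = sectorsD(2)[OF this] and T = sectorsD(3)[OF this] and S = sectorsD(4)[OF this]
  have uniq: "R = R'" if "sector_region D (s, t) \<sigma> \<tau> R" "sector_region D (s, t) \<sigma> \<tau> R'" for \<sigma> \<tau> R R'
    using that leads_unique unfolding sector_region_iff by blast
  have neg: "- \<sigma> \<in> {1, -1}" "- \<tau> \<in> {1, -1}" using st by auto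
  have eq: "x1 = Q \<sigma> \<tau>" "x2 = Q (- \<sigma>) \<tau>" "x3 = Q \<sigma> (- \<tau>)" "x4 = Q (- \<sigma>) (- \<tau>)"
    using uniq[OF R(1) Q[OF st]] uniq[OF R(2) Q[OF neg(1) st(2)]] uniq[OF R(3) Q[OF st(1) neg(2)]]
      uniq[OF R(4) Q[OF neg]] by simp_all
  have near: "\<exists>h. 0 < h \<and> h < \<delta> \<and> simple (r + q * h)" if "q \<in> {1, -1}" for r q
  proof (cases "q = 1")
    case True
    obtain y where "r < y" "y < r + \<delta>" "simple y" using simple_dense[of r "r + \<delta>"] \<delta> by auto
    then show ?thesis using True by (intro exI[of _ "y - r"]) auto
  next
    case False
    then have "q = -1" using that by blast
    obtain y where "r - \<delta> < y" "y < r" "simple y" using simple_dense[of "r - \<delta>" r] \<delta> by auto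
    then show ?thesis using \<open>q = -1\<close> by (intro exI[of _ "r - y"]) auto
  qed
  have under: "(C (Q \<sigma>' \<tau>'), C (Q (- \<sigma>') \<tau>')) \<in> arc_pairs" if st': "\<sigma>' \<in> {1, -1}" "\<tau>' \<in> {1, -1}" for \<sigma>' \<tau>'
  proof -
    obtain h where h: "0 < h" "h < \<delta>" "simple (t + \<tau>' * h)" using near[OF st'(2), of t] by blast
    show ?thesis using T[OF h(1,2) st' h(3)] h(3) unfolding arc_pairs_def by blast
  qed
  have over: "(C (Q \<sigma>' \<tau>'), C (Q \<sigma>' (- \<tau>'))) \<in> arc_pairs" if st': "\<sigma>' \<in> {1, -1}" "\<tau>' \<in> {1, -1}" for \<sigma>' \<tau>'
  proof -
    obtain h where h: "0 < h" "h < \<delta>" "simple (s + \<sigma>' * h)" using near[OF st'(1), of s] by blast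
    show ?thesis using S[OF h(1,2) st' h(3)] h(3) unfolding arc_pairs_def by blast
  qed
  have "crossing_regions D (s, t) x1 x2 x3 x4"
    unfolding crossing_regions_def using st R by blast
  moreover have "dehn_coloring p D C" using C by (simp add: nontrivial_dehn_coloring_def)
  ultimately have "[C x1 + C x3 = C x2 + C x4] (mod int p)"
    using x unfolding dehn_coloring_def by blast
  then show ?thesis
    unfolding crossing_colors_def cong_def
    using under[OF st] under[OF st(1) neg(2)] over[OF st] over[OF neg(1) st(2)] by (simp only: eq simp_thms)
qed

text \<open>A knot is a single closed curve, so a locally constant quantity on its parameters is
  constant. Here this quantity is the value of \<open>h\<close> on the color pair: near a simple
  parameter the two sides do not change, and at a crossing the invariance of \<open>h\<close>
  equates the values before and after.\<close>

lemma connected_coloring_arc_pairs: "connected_coloring (int p) arc_pairs"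
  unfolding connected_coloring_def
proof (intro conjI allI impI)
  obtain x where x: "x \<in> crossings D" "\<not> trivially_colored D C x"
    using C unfolding nontrivial_dehn_coloring_def by blast
  then obtain x1 x2 x3 x4 where r: "crossing_regions D x x1 x2 x3 x4" "\<not> (C x1 = C x4 \<and> C x3 = C x2)"
    unfolding trivially_colored_def by blast
  obtain s t where st: "x = (s, t)" by (cases x)
  obtain \<sigma> \<tau> where \<sigma>: "\<sigma> \<in> {1, -1}" "\<tau> \<in> {1, -1}"
    "sector_region D (s, t) \<sigma> \<tau> x1" "sector_region D (s, t) (- \<sigma>) \<tau> x2"
    "sector_region D (s, t) \<sigma> (- \<tau>) x3" "sector_region D (s, t) (- \<sigma>) (- \<tau>) x4"
    using r(1) unfolding st crossing_regions_def by blast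
  have "crossing_colors (int p) arc_pairs (C x1) (C x2) (C x3) (C x4)"
    using crossing_quadruple[OF x(1)[unfolded st] \<sigma>] .
  then show "\<exists>x1 x2 x3 x4. crossing_colors (int p) arc_pairs x1 x2 x3 x4 \<and> \<not> (x1 = x4 \<and> x3 = x2)"
    using r(2) by blast
next
  fix h :: "int \<Rightarrow> int \<Rightarrow> bool"
  assume sym: "\<forall>x y. h x y = h y x"
    and inv: "\<forall>x1 x2 x3 x4. crossing_colors (int p) arc_pairs x1 x2 x3 x4 \<longrightarrow> h x1 x2 = h x3 x4 \<and> h x1 x3 = h x2 x4"
  define val where "val t \<longleftrightarrow> (\<exists>a b. adjacent_colors t a b \<and> h a b)" for t
  have val: "val t = h a b" if "adjacent_colors t a b" for t a b
  proof
    assume "val t"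
    then obtain a' b' where "adjacent_colors t a' b'" "h a' b'" unfolding val_def by blast
    then show "h a b" using adjacent_colors_unique[OF that] sym by metis
  next
    assume "h a b"
    then show "val t" using that unfolding val_def by blast
  qed
  have val_per: "val (t + of_int k) = val t" for t k by (simp add: val_def adjacent_colors_per)
  have local: "\<exists>\<delta>>0. \<forall>x\<in>ball a \<delta>. \<forall>y\<in>ball a \<delta>. simple x \<and> simple y \<longrightarrow> val x = val y" for a
  proof (cases "simple a")
    case True
    obtain R1 d1 where 1: "d1 > 0" "\<forall>t\<in>ball a d1. simple t \<longrightarrow> side t 1 R1"
      using side_locally_constant[OF True, of 1] by auto
    obtain R2 d2 where 2: "d2 > 0" "\<forall>t\<in>ball a d2. simple t \<longrightarrow> side t (- 1) R2"
      using side_locally_constant[OF True, of "- 1"] by auto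
    have "val t = h (C R1) (C R2)" if "t \<in> ball a (min d1 d2)" "simple t" for t
    proof (rule val)
      have "side t 1 R1" "side t (- 1) R2" using 1 2 that by auto
      then show "adjacent_colors t (C R1) (C R2)" unfolding adjacent_colors_def
        by (intro exI[of _ 1] exI[of _ R1] exI[of _ R2]) simp
    qed
    then show ?thesis using 1(1) 2(1) by (intro exI[of _ "min d1 d2"]) auto
  next
    case False
    then obtain s t and k :: int where x: "(s, t) \<in> crossings D" and a: "a = t + of_int k \<or> a = s + of_int k"
      using not_simple_crossing by blast
    obtain Q \<delta> where "sectors s t Q \<delta>" using crossing_sectors[OF x] by blast
    note \<delta> = sectorsD(1)[OF this] and Q = sectorsD(2)[OF this] and T = sectorsD(3)[OF this] and S = sectorsD(4)[OF this]
    have "crossing_colors (int p) arc_pairs (C (Q 1 1)) (C (Q (- 1) 1)) (C (Q 1 (- 1))) (C (Q (- 1) (- 1)))"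
      using crossing_quadruple[OF x, of 1 1] Q by simp
    then have hq: "h (C (Q 1 1)) (C (Q (- 1) 1)) = h (C (Q 1 (- 1))) (C (Q (- 1) (- 1)))"
      "h (C (Q 1 1)) (C (Q 1 (- 1))) = h (C (Q (- 1) 1)) (C (Q (- 1) (- 1)))"
      using inv by blast+
    have near_t: "val r = h (C (Q 1 1)) (C (Q (- 1) 1))" if "simple r" "r \<noteq> t" "\<bar>r - t\<bar> < \<delta>" for r
    proof (cases "r > t")
      case True
      then show ?thesis using T[of "r - t" 1 1] that by (intro val) simp
    next
      case False
      then have "val r = h (C (Q 1 (- 1))) (C (Q (- 1) (- 1)))"
        using T[of "t - r" 1 "- 1"] that by (intro val) simp
      then show ?thesis using hq(1) by simp
    qed
    have near_s: "val r = h (C (Q 1 1)) (C (Q 1 (- 1)))" if "simple r" "r \<noteq> s" "\<bar>r - s\<bar> < \<delta>" for r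
    proof (cases "r > s")
      case True
      then show ?thesis using S[of "r - s" 1 1] that by (intro val) simp
    next
      case False
      then have "val r = h (C (Q (- 1) 1)) (C (Q (- 1) (- 1)))"
        using S[of "s - r" "- 1" 1] that by (intro val) simp
      then show ?thesis using hq(2) by simp
    qed
    \<comment> \<open>From here on both strands are treated alike: r0 is the crossing parameter that
      equals a up to a period, and v is the common value around it.\<close>
    obtain r0 v where r0: "a = r0 + of_int k" "\<And>r. simple r \<Longrightarrow> r \<noteq> r0 \<Longrightarrow> \<bar>r - r0\<bar> < \<delta> \<Longrightarrow> val r = v"
      using a
    proof
      assume "a = t + of_int k"
      then show ?thesis using near_t by (rule that)
    next
      assume "a = s + of_int k"
      then show ?thesis using near_s by (rule that)
    qed
    have "val y = v" if y: "y \<in> ball a \<delta>" "simple y" for y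
    proof -
      define r where "r = y - of_int k"
      have yr: "y = r + of_int k" by (simp add: r_def)
      have "simple r" "\<bar>r - r0\<bar> < \<delta>" using y branches_per[of r k] r0(1) by (auto simp: yr dist_real_def)
      moreover have "r \<noteq> r0" using y(2) False r0(1) by (auto simp: yr)
      ultimately show ?thesis unfolding yr val_per by (intro r0(2))
    qed
    then show ?thesis using \<delta> by blast
  qed
  have const: "val x = val y" if "simple x" "simple y" for x y
    by (rule locally_constant_on_dense[of simple val x y, OF simple_dense local that])
  have eq: "h a b = h a' b'" if "(a, b) \<in> arc_pairs" "(a', b') \<in> arc_pairs" for a b a' b'
  proof -
    obtain x y where "simple x" "adjacent_colors x a b" "simple y" "adjacent_colors y a' b'"
      using \<open>(a, b) \<in> arc_pairs\<close> \<open>(a', b') \<in> arc_pairs\<close> by (auto simp: arc_pairs_def)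
    then show ?thesis using const[of x y] val[of x a b] val[of y a' b'] by simp
  qed
  show "\<forall>(x, y)\<in>arc_pairs. \<forall>(x', y')\<in>arc_pairs. h x y = h x' y'"
  proof
    fix m assume m: "m \<in> arc_pairs"
    obtain a b where ab: "m = (a, b)" by (cases m)
    show "case m of (x, y) \<Rightarrow> \<forall>(x', y')\<in>arc_pairs. h x y = h x' y'"
      unfolding ab prod.case
    proof
      fix m' assume m': "m' \<in> arc_pairs"
      obtain a' b' where ab': "m' = (a', b')" by (cases m')
      show "case m' of (x', y') \<Rightarrow> h a b = h x' y'"
        unfolding ab' prod.case using m m' unfolding ab ab' by (rule eq)
    qed
  qed
qed

lemma arc_pairs_colors: "arc_pairs \<subseteq> colors D C \<times> colors D C"
proof -
  have "C R \<in> colors D C" if "side t q R" for t q R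
    using side_region[OF that] by (simp add: colors_def regions_def)
  then show ?thesis by (auto simp: arc_pairs_def adjacent_colors_def)
qed

lemma colors_residues: "colors D C \<subseteq> residues_mod p"
  using C by (simp add: colors_def nontrivial_dehn_coloring_def dehn_coloring_def)

end

section \<open>Palette graphs\<close>

lemma two_multisets_iff: "{#a, b#} \<in> two_multisets S \<longleftrightarrow> a \<in> S \<and> b \<in> S"
proof
  assume "{#a, b#} \<in> two_multisets S"
  then obtain x y where xy: "{#a, b#} = {#x, y#}" "x \<in> S" "y \<in> S" unfolding two_multisets_def by blast
  have "a \<in># {#x, y#}" "b \<in># {#x, y#}" unfolding xy(1)[symmetric] by simp_all
  then show "a \<in> S \<and> b \<in> S" using xy(2,3) by auto
qed (auto simp: two_multisets_def)

lemma sum_class_cong: "[b = b'] (mod int p) \<Longrightarrow> sum_class p S b = sum_class p S b'"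
  unfolding sum_class_def by (auto simp: cong_def)

lemma sum_class_eq_iff:
  assumes "sum_class p S b \<noteq> {}" "sum_class p S b = sum_class p S b'"
  shows "[b = b'] (mod int p)"
proof -
  obtain m where "m \<in> sum_class p S b" "m \<in> sum_class p S b'" using assms by blast
  then show ?thesis unfolding sum_class_def cong_def by simp
qed

lemma pair_in_sum_class: "{#a1, a2#} \<in> sum_class p S b \<longleftrightarrow> a1 \<in> S \<and> a2 \<in> S \<and> [a1 + a2 = b] (mod int p)"
  by (simp add: sum_class_def two_multisets_iff)

lemma palette_vertexE:
  assumes "A \<in> palette_vertices p S" "p > 0"
  obtains b where "b \<in> residues_mod p" "A = sum_class p S b" "A \<noteq> {}"
proof -
  obtain m where m: "m \<in> two_multisets S" "A = sum_rel p S `` {m}"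
    using assms(1) unfolding palette_vertices_def quotient_def by blast
  define b where "b = \<Sum>\<^sub># m mod int p"
  have "A = sum_class p S b"
    using m(1) unfolding m(2) sum_rel_def sum_class_def b_def by (auto simp: cong_def)
  moreover have "m \<in> sum_class p S b" using m(1) by (simp add: sum_class_def b_def cong_def)
  moreover have "b \<in> residues_mod p" using assms(2) by (simp add: b_def)
  ultimately show ?thesis using that by blast
qed

text \<open>Vertices are replaced by the residues of their classes. The condition on labels places
  the common value of each relation in V, as \<open>edge\<close> demands, and paths in G carry
  membership in a cut from vertex to vertex.\<close>

lemma R_subgraph_connected_palette:
  assumes R: "R_subgraph p S G" and G: "connected_sgraph G" "card (fst G) \<ge> 2" and p: "prime p" "p > 2"
  shows "\<exists>V. connected_palette (int p) S V"
proof -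
  define V where "V = {b \<in> residues_mod p. sum_class p S b \<in> fst G}"
  have p0: "p > 0" using p by simp
  have "subgraph_of G (palette_graph p S)" using R by (simp add: R_subgraph_def)
  then have sub: "fst G \<subseteq> palette_vertices p S" "snd G \<subseteq> palette_edges p S" "\<And>e. e \<in> snd G \<Longrightarrow> e \<subseteq> fst G"
    by (simp_all add: subgraph_of_def palette_graph_def)
  have lab: "sum_class p S (modular_inverse (int p) 2 * (b1 + b2)) \<in> fst G"
    if "{sum_class p S b1, sum_class p S b2} \<in> snd G" for b1 b2
    using R that unfolding R_subgraph_def by blast
  have vertex: "\<exists>b\<in>V. A = sum_class p S b" if A: "A \<in> fst G" for A
  proof -
    obtain b where "b \<in> residues_mod p" "A = sum_class p S b"
      using palette_vertexE[OF subsetD[OF sub(1) A] p0] by blast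
    then show ?thesis using A V_def by blast
  qed
  have nonempty: "A \<noteq> {}" if A: "A \<in> fst G" for A
    using palette_vertexE[OF subsetD[OF sub(1) A] p0] by blast
  have inj: "u = v" if "u \<in> V" "v \<in> V" "sum_class p S u = sum_class p S v" for u v
  proof -
    have "sum_class p S u \<noteq> {}" using nonempty that(1) V_def by blast
    then have "[u = v] (mod int p)" using sum_class_eq_iff that(3) by blast
    then show ?thesis using that(1,2) by (simp add: V_def cong_def)
  qed
  have cop: "coprime (2 :: int) (int p)"
  proof -
    have "coprime (0 - (- 2) :: int) (int p)"
      using coprime_residue_diff[OF p(1), of 0 2] p(2) by simp
    then show ?thesis by simp
  qed
  have half: "[modular_inverse (int p) 2 * b = c] (mod int p)" if "[b = 2 * c] (mod int p)" for b c
  proof -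
    have "[modular_inverse (int p) 2 * b = modular_inverse (int p) 2 * (2 * c)] (mod int p)"
      by (intro cong_mult cong_refl that)
    also have "modular_inverse (int p) 2 * (2 * c) = (2 * modular_inverse (int p) 2) * c" by simp
    also have "[(2 * modular_inverse (int p) 2) * c = 1 * c] (mod int p)"
      by (intro cong_mult cong_refl cong_modular_inverse1) (use cop in \<open>simp add: coprime_commute\<close>)
    finally show ?thesis by simp
  qed
  have edge_E: "\<exists>b1\<in>V. \<exists>b2\<in>V. A = sum_class p S b1 \<and> B = sum_class p S b2 \<and>
      (edge (int p) S V b1 b2 \<or> edge (int p) S V b2 b1)" if AB: "{A, B} \<in> snd G" for A B
  proof -
    have "{A, B} \<in> palette_edges p S" using sub(2) AB by blast
    then obtain A' B' a1 a2 a3 a4 where e: "{A, B} = {A', B'}" "{#a1, a2#} \<in> A'" "{#a3, a4#} \<in> B'"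
      "[a1 + a3 = a2 + a4] (mod int p) \<or> [a1 + a4 = a2 + a3] (mod int p)"
      unfolding palette_edges_def mem_Collect_eq by (elim exE conjE) (rule that; assumption)
    have "{A', B'} \<subseteq> fst G" using sub(3)[OF AB] unfolding e(1) .
    then have inG: "A' \<in> fst G" "B' \<in> fst G" by blast+
    obtain b1 where b1: "b1 \<in> V" "A' = sum_class p S b1" using vertex[OF inG(1)] by blast
    obtain b2 where b2: "b2 \<in> V" "B' = sum_class p S b2" using vertex[OF inG(2)] by blast
    have a: "a1 \<in> S" "a2 \<in> S" "a3 \<in> S" "a4 \<in> S"
      "[a1 + a2 = b1] (mod int p)" "[a3 + a4 = b2] (mod int p)"
      using e(2,3) unfolding b1(2) b2(2) pair_in_sum_class by blast+
    have bV: "(a1 + a2) mod int p = b1" "(a3 + a4) mod int p = b2" using a(5,6) b1(1) b2(1) by (simp_all add: V_def cong_def)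
    have "{sum_class p S b1, sum_class p S b2} \<in> snd G" using AB unfolding e(1) b1(2) b2(2) .
    then have L: "sum_class p S (modular_inverse (int p) 2 * (b1 + b2)) \<in> fst G" by (rule lab)
    have label: "c mod int p \<in> V" if c: "[b1 + b2 = 2 * c] (mod int p)" for c
    proof -
      have "[modular_inverse (int p) 2 * (b1 + b2) = c mod int p] (mod int p)"
        using half[OF c] by (simp add: cong_def)
      then have "sum_class p S (c mod int p) \<in> fst G" using L sum_class_cong by metis
      then show ?thesis using p0 by (simp add: V_def)
    qed
    have sum: "[b1 + b2 = (a1 + a2) + (a3 + a4)] (mod int p)"
      by (intro cong_add) (use a(5,6) in \<open>simp_all add: cong_sym\<close>)
    \<comment> \<open>In the second alternative a3 and a4 are exchanged, which leaves their sum
      unchanged.\<close>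
    obtain c3 c4 where c: "c3 \<in> S" "c4 \<in> S" "(c3 + c4) mod int p = b2" "c3 + c4 = a3 + a4"
      and *: "[a1 + c3 = a2 + c4] (mod int p)"
      using e(4)
    proof
      assume "[a1 + a3 = a2 + a4] (mod int p)"
      then show ?thesis using that[of a3 a4] a bV(2) by simp
    next
      assume "[a1 + a4 = a2 + a3] (mod int p)"
      then show ?thesis using that[of a4 a3] a bV(2) by (simp add: add.commute)
    qed
    \<comment> \<open>The sum of the ends is twice a1 + c3, so halving it identifies a1 + c3 as the
      label.\<close>
    have "[(a1 + c3) + (a2 + c4) = (a1 + c3) + (a1 + c3)] (mod int p)"
      by (intro cong_add cong_refl cong_sym[OF *])
    moreover have "(a1 + c3) + (a2 + c4) = (a1 + a2) + (a3 + a4)" using c(4) by simp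
    ultimately have "[b1 + b2 = 2 * (a1 + c3)] (mod int p)"
      using cong_trans[OF sum] by (metis mult_2)
    then have "(a1 + c3) mod int p \<in> V" by (rule label)
    moreover have "(a1 + c3) mod int p = (a2 + c4) mod int p" using * by (simp add: cong_def)
    ultimately have "edge (int p) S V b1 b2"
      unfolding edge_def using a(1,2) c(1-3) bV(1) b1(1) b2(1) by metis
    moreover have "A = A' \<and> B = B' \<or> A = B' \<and> B = A'" using e(1) by (simp add: doubleton_eq_iff)
    ultimately show ?thesis using b1 b2 by blast
  qed
  have "connected_palette (int p) S V"
    unfolding connected_palette_def
  proof (intro conjI allI impI)
    have "\<exists>A\<in>fst G. \<exists>B\<in>fst G. A \<noteq> B"
    proof (rule ccontr)
      assume "\<not> ?thesis"
      then have "\<And>A B. A \<in> fst G \<Longrightarrow> B \<in> fst G \<Longrightarrow> A = B" by blast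
      \<comment> \<open>An infinite vertex set has cardinality 0 by default and falls under the same
        bound.\<close>
      then have "card (fst G) \<le> Suc 0" using card_le_Suc0_iff_eq card.infinite by (metis le0)
      then show False using G(2) by simp
    qed
    then show "\<exists>u\<in>V. \<exists>v\<in>V. u \<noteq> v" using vertex by metis
  next
    fix X assume X: "\<forall>u v. edge (int p) S V u v \<longrightarrow> (u \<in> X \<longleftrightarrow> v \<in> X)"
    have "v \<in> X" if uv: "u \<in> V" "u \<in> X" "v \<in> V" for u v
    proof -
      have "(sum_class p S u, sum_class p S v) \<in> {(x, y). {x, y} \<in> snd G}\<^sup>*"
        using G(1) uv unfolding connected_sgraph_def V_def by blast
      then have "\<exists>w\<in>V. sum_class p S v = sum_class p S w \<and> w \<in> X"
      proof (induction rule: rtrancl_induct)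
        case base
        then show ?case using uv by blast
      next
        case (step A B)
        obtain w where w: "w \<in> V" "A = sum_class p S w" "w \<in> X" using step.IH by blast
        have "{A, B} \<in> snd G" using step.hyps(2) by blast
        then obtain b1 b2 where b: "b1 \<in> V" "b2 \<in> V" "A = sum_class p S b1" "B = sum_class p S b2"
          "edge (int p) S V b1 b2 \<or> edge (int p) S V b2 b1" using edge_E by blast
        have "w = b1" using inj[OF w(1) b(1)] w(2) b(3) by simp
        then have "b2 \<in> X" using b(5) X w(3) by blast
        then show ?case using b by blast
      qed
      then show ?thesis using inj uv(3) by blast
    qed
    then show "V \<subseteq> X \<or> V \<inter> X = {}" by blast
  qed
  then show ?thesis by blast
qed

section \<open>The bound and the critical palettes\<close>

lemma no_connected_palette:
  assumes "prime p" "p > 2" "check_all p k" "k \<le> 3" "k > 1 \<Longrightarrow> p > 3" "k + 3 \<le> p"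
    and S: "S \<subseteq> residues_mod p" "card S < k + 3"
  shows "\<not> connected_palette (int p) S V"
proof (rule no_small_palette[OF assms(1,2) _ _ _ S])
  let ?Ls = "listed_sets p @ exceptional_sets p"
  have minors: "check_minors (int p) L" if "L \<in> set ?Ls" for L
    using assms(3) that unfolding check_all_def list_all_iff by blast
  have res: "set L \<subseteq> residues_mod p" if "L \<in> set ?Ls" for L
    using minors[OF that] by (auto simp: check_minors_def list_all_iff)
  have cl: "\<exists>L\<in>set ?Ls. affine_equiv p S (set L)"
    if "card S = k + 3" "S \<subseteq> residues_mod p" "\<not> parted (int p) S" for S
    using classification[OF assms(1,2) _ _ that res] assms(3) unfolding check_all_def by blast
  show "parted (int p) S" if "S \<subseteq> residues_mod p" "2 \<le> card S" "card S < k + 3" for S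
    by (rule small_parted[OF assms(1,6) cl _ that]) (use check_minorsD[OF minors] in blast)+
qed (use assms(4,5) in auto)

context colored_diagram
begin

lemma card_colors:
  assumes "prime p" "p > 2" "check_all p k" "k \<le> 3" "k > 1 \<Longrightarrow> p > 3" "k + 3 \<le> p"
  shows "k + 3 \<le> card (colors D C)"
proof (rule ccontr)
  assume "\<not> ?thesis"
  then have "card (colors D C) < k + 3" by simp
  then show False
    using no_connected_palette[OF assms colors_residues]
      connected_coloring_palette[OF connected_coloring_arc_pairs arc_pairs_colors colors_residues assms(1,2)]
    by blast
qed

text \<open>Since no smaller set carries a connected palette, \<open>coloring_not_parted\<close>
  makes the color set rigid and the classification applies. An exceptional set is ruled out by
  carrying the palette of the coloring over to it along the affine equivalence.\<close>

lemma minimal_colors: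
  assumes "prime p" "p > 2" "check_all p k" "k \<le> 3" "k > 1 \<Longrightarrow> p > 3" "k + 3 \<le> p"
    and card: "card (colors D C) = k + 3"
  shows "\<exists>L\<in>set (listed_sets p). affine_equiv p (colors D C) (set L)"
proof -
  let ?S = "colors D C" and ?Ls = "listed_sets p @ exceptional_sets p"
  have minors: "check_minors (int p) L" if "L \<in> set ?Ls" for L
    using assms(3) that unfolding check_all_def list_all_iff by blast
  have res: "set L \<subseteq> residues_mod p" if "L \<in> set ?Ls" for L
    using minors[OF that] by (auto simp: check_minors_def list_all_iff)
  have no: "\<not> connected_palette (int p) S' V" if "S' \<subseteq> residues_mod p" "card S' < card ?S" for S' V
    using no_connected_palette[OF assms(1-6) that(1)] that(2) card by simp
  have "\<not> parted (int p) ?S"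
  proof
    assume "parted (int p) ?S"
    then obtain A B where "A \<union> B = ?S" "A \<noteq> {}" "B \<noteq> {}"
      "sumset (int p) A B \<inter> (sumset (int p) A A \<union> sumset (int p) B B) = {}"
      unfolding parted_def by blast
    then interpret sum_partition "int p" ?S A B by unfold_locales
    show False
      using coloring_not_parted[OF assms(1,2) refl colors_residues no connected_coloring_arc_pairs arc_pairs_colors] .
  qed
  then obtain L where L: "L \<in> set ?Ls" "affine_equiv p ?S (set L)"
    using classification[OF assms(1,2) _ _ card colors_residues _ res] assms(3) unfolding check_all_def by blast
  have "L \<notin> set (exceptional_sets p)"
  proof
    assume "L \<in> set (exceptional_sets p)"
    then have "check_dead (int p) L" using assms(3) unfolding check_all_def list_all_iff by blast
    moreover have "set L \<subseteq> {0..<int p}" using res[OF L(1)] by (simp add: residues_mod_def)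
    ultimately have "\<not> connected_palette (int p) (set L) V" for V by (rule check_dead_sound)
    then show False
      using connected_palette_affine[OF connected_coloring_palette[OF connected_coloring_arc_pairs
          arc_pairs_colors colors_residues assms(1,2)] L(2)] assms(2) by auto
  qed
  then show ?thesis using L by auto
qed

end

lemma palette_bounds:
  assumes p: "prime p" "p > 2" and check: "check_all p k" "k \<le> 3" "k > 1 \<Longrightarrow> p > 3" "k + 3 \<le> p"
    and n: "n = k + 1"
  shows "\<not> (\<exists>S. S \<noteq> {} \<and> S \<subseteq> residues_mod p \<and> card S \<le> n + 1 \<and>
         (\<exists>G. R_subgraph p S G \<and> connected_sgraph G \<and>
            n + 2 \<le> card (fst G)))"
    and "\<forall>K. knot K \<and> dehn_colorable p K \<longrightarrow> n + 2 \<le> mincol_dehn p K"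
    and "\<forall>K D C. knot K \<and> diagram_of K D \<and> nontrivial_dehn_coloring p D C \<and>
        card (colors D C) = n + 2 \<longrightarrow>
        (\<exists>L\<in>set (listed_sets p). affine_equiv p (colors D C) (set L))"
proof -
  have n3: "n + 2 = k + 3" using n by simp
  have col: "colored_diagram D p C" if "diagram_of K D" "nontrivial_dehn_coloring p D C" for K D C
    using that unfolding colored_diagram_def diagram_of_def by blast
  show "\<not> (\<exists>S. S \<noteq> {} \<and> S \<subseteq> residues_mod p \<and> card S \<le> n + 1 \<and>
         (\<exists>G. R_subgraph p S G \<and> connected_sgraph G \<and>
            n + 2 \<le> card (fst G)))"
  proof (rule notI, elim exE conjE)
    fix S G assume S: "S \<subseteq> residues_mod p" "card S \<le> n + 1"
      and G: "R_subgraph p S G" "connected_sgraph G" "n + 2 \<le> card (fst G)"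
    have "2 \<le> card (fst G)" "card S < k + 3" using G(3) S(2) n by simp_all
    then show False
      using R_subgraph_connected_palette[OF G(1,2) _ p] no_connected_palette[OF p check S(1)] by blast
  qed
  show "\<forall>K. knot K \<and> dehn_colorable p K \<longrightarrow> n + 2 \<le> mincol_dehn p K"
  proof (intro allI impI)
    fix K assume "knot K \<and> dehn_colorable p K"
    then have "\<exists>n D C. diagram_of K D \<and> nontrivial_dehn_coloring p D C \<and> n = card (colors D C)"
      unfolding dehn_colorable_def by blast
    \<comment> \<open>Colorability makes the set of color counts nonempty, so the minimum is
      attained by an actual diagram.\<close>
    then have "\<exists>D C. diagram_of K D \<and> nontrivial_dehn_coloring p D C \<and> mincol_dehn p K = card (colors D C)"
      unfolding mincol_dehn_def by (rule LeastI_ex)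
    then obtain D C where DC: "diagram_of K D" "nontrivial_dehn_coloring p D C" "mincol_dehn p K = card (colors D C)"
      by blast
    interpret colored_diagram D p C using col[OF DC(1,2)] .
    show "n + 2 \<le> mincol_dehn p K"
      unfolding n3 DC(3) by (rule card_colors[OF p check])
  qed
  show "\<forall>K D C. knot K \<and> diagram_of K D \<and> nontrivial_dehn_coloring p D C \<and>
        card (colors D C) = n + 2 \<longrightarrow>
        (\<exists>L\<in>set (listed_sets p). affine_equiv p (colors D C) (set L))"
  proof (intro allI impI)
    fix K D C assume *: "knot K \<and> diagram_of K D \<and> nontrivial_dehn_coloring p D C \<and>
        card (colors D C) = n + 2"
    then interpret colored_diagram D p C using col by blast
    have "card (colors D C) = k + 3" using * n by simp
    from minimal_colors[OF p check this]
    show "\<exists>L\<in>set (listed_sets p). affine_equiv p (colors D C) (set L)" .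
  qed
qed

lemma odd_primes_below_32:
  fixes p :: nat
  assumes "prime p" "odd p" "p < 2 ^ 5"
  shows "p \<in> {3, 5, 7, 11, 13, 17, 19, 23, 29, 31}"
proof -
  have "p \<in> {..<32}" using assms(3) by simp
  also have "{..<32 :: nat} = set [0..<32]" by auto
  also have "[0..<32] = [0,1,2,3,4,5,6,7,8,9,10,11,12,13,14,15,16,17,18,19,20,21,22,23,24,25,26,27,28,29,30,31]"
    by (simp add: upt_rec)
  finally show ?thesis using assms(1,2) by auto
qed

lemma floor_log2_eq:
  fixes p n :: nat
  assumes "2 ^ n \<le> p" "p < 2 ^ (n + 1)"
  shows "nat \<lfloor>log 2 (real p)\<rfloor> = n"
  using floor_log_nat_eq_if[of 2 n p] assms by simp

theorem theorem5p3:
  fixes p :: nat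
  assumes "prime p" and "odd p" and "p < 2 ^ 5"
  shows
    "(\<not> (\<exists>S. S \<noteq> {} \<and> S \<subseteq> residues_mod p \<and> card S \<le> nat \<lfloor>log 2 (real p)\<rfloor> + 1 \<and>
         (\<exists>G. R_subgraph p S G \<and> connected_sgraph G \<and>
            nat \<lfloor>log 2 (real p)\<rfloor> + 2 \<le> card (fst G)))) \<and>
     (\<forall>K. knot K \<and> dehn_colorable p K \<longrightarrow> nat \<lfloor>log 2 (real p)\<rfloor> + 2 \<le> mincol_dehn p K) \<and>
     (\<forall>K D C. knot K \<and> diagram_of K D \<and> nontrivial_dehn_coloring p D C \<and>
        card (colors D C) = nat \<lfloor>log 2 (real p)\<rfloor> + 2 \<longrightarrow>
        (p = 3 \<longrightarrow>
           affine_equiv p (colors D C) {0, 1, 2}) \<and>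
        (p = 5 \<longrightarrow>
           affine_equiv p (colors D C) {0, 1, 2, 3}) \<and>
        (p = 7 \<longrightarrow>
           affine_equiv p (colors D C) {0, 1, 2, 4}) \<and>
        (p = 11 \<longrightarrow>
           affine_equiv p (colors D C) {0, 1, 2, 3, 6} \<or>
           affine_equiv p (colors D C) {0, 1, 2, 4, 7}) \<and>
        (p = 13 \<longrightarrow>
           affine_equiv p (colors D C) {0, 1, 2, 4, 7}) \<and>
        (p = 17 \<longrightarrow>
           affine_equiv p (colors D C) {0, 1, 2, 3, 5, 9} \<or>
           affine_equiv p (colors D C) {0, 1, 2, 3, 5, 10} \<or>
           affine_equiv p (colors D C) {0, 1, 2, 3, 5, 12} \<or>
           affine_equiv p (colors D C) {0, 1, 2, 3, 6, 9} \<or>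
           affine_equiv p (colors D C) {0, 1, 2, 3, 6, 10} \<or>
           affine_equiv p (colors D C) {0, 1, 2, 3, 6, 11} \<or>
           affine_equiv p (colors D C) {0, 1, 2, 3, 6, 13} \<or>
           affine_equiv p (colors D C) {0, 1, 2, 3, 7, 11} \<or>
           affine_equiv p (colors D C) {0, 1, 2, 4, 5, 9} \<or>
           affine_equiv p (colors D C) {0, 1, 2, 4, 5, 10} \<or>
           affine_equiv p (colors D C) {0, 1, 2, 4, 5, 12} \<or>
           affine_equiv p (colors D C) {0, 1, 2, 4, 10, 13}) \<and>
        (p = 19 \<longrightarrow>
           affine_equiv p (colors D C) {0, 1, 2, 3, 5, 10} \<or>
           affine_equiv p (colors D C) {0, 1, 2, 3, 6, 10} \<or>
           affine_equiv p (colors D C) {0, 1, 2, 3, 6, 11} \<or>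
           affine_equiv p (colors D C) {0, 1, 2, 3, 6, 12} \<or>
           affine_equiv p (colors D C) {0, 1, 2, 3, 6, 13} \<or>
           affine_equiv p (colors D C) {0, 1, 2, 3, 6, 14} \<or>
           affine_equiv p (colors D C) {0, 1, 2, 3, 7, 12} \<or>
           affine_equiv p (colors D C) {0, 1, 2, 4, 5, 10} \<or>
           affine_equiv p (colors D C) {0, 1, 2, 4, 5, 14} \<or>
           affine_equiv p (colors D C) {0, 1, 2, 4, 7, 12} \<or>
           affine_equiv p (colors D C) {0, 1, 2, 4, 7, 15}) \<and>
        (p = 23 \<longrightarrow>
           affine_equiv p (colors D C) {0, 1, 2, 3, 6, 12} \<or>
           affine_equiv p (colors D C) {0, 1, 2, 4, 7, 12} \<or>
           affine_equiv p (colors D C) {0, 1, 2, 4, 7, 13} \<or>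
           affine_equiv p (colors D C) {0, 1, 2, 4, 7, 14} \<or>
           affine_equiv p (colors D C) {0, 1, 2, 4, 9, 14} \<or>
           affine_equiv p (colors D C) {0, 1, 2, 4, 10, 19}) \<and>
        (p = 29 \<longrightarrow>
           affine_equiv p (colors D C) {0, 1, 2, 4, 8, 15}) \<and>
        (p = 31 \<longrightarrow>
           affine_equiv p (colors D C) {0, 1, 2, 4, 8, 16}))"
proof -
  have odd_prime: "p \<in> {3, 5, 7, 11, 13, 17, 19, 23, 29, 31}" using odd_primes_below_32[OF assms] .
  have p2: "p > 2" using odd_prime by auto
  have "\<exists>k. check_all p k \<and> k \<le> 3 \<and> (k > 1 \<longrightarrow> p > 3) \<and> k + 3 \<le> p \<and> nat \<lfloor>log 2 (real p)\<rfloor> = k + 1"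
  proof -
    \<comment> \<open>Between consecutive powers of 2 the critical size is constant, so one value of
      k serves each range.\<close>
    consider "p = 3" | "p \<in> {5, 7}" | "p \<in> {11, 13}" | "p \<in> {17, 19, 23, 29, 31}" using odd_prime by blast
    then show ?thesis
    proof cases
      case 1
      then show ?thesis using check_3 floor_log2_eq[of 1 p] by (intro exI[of _ 0]) auto
    next
      case 2
      then have "check_all p 1" using check_5 check_7 by blast
      then show ?thesis using 2 floor_log2_eq[of 2 p] by (intro exI[of _ 1]) auto
    next
      case 3
      then have "check_all p 2" using check_11 check_13 by blast
      then show ?thesis using 3 floor_log2_eq[of 3 p] by (intro exI[of _ 2]) auto
    next
      case 4
      then have "check_all p 3" using check_17 check_19 check_23 check_29 check_31 by blast
      then show ?thesis using 4 floor_log2_eq[of 4 p] by (intro exI[of _ 3]) auto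
    qed
  qed
  then obtain k where k: "check_all p k" "k \<le> 3" "k > 1 \<Longrightarrow> p > 3" "k + 3 \<le> p"
    "nat \<lfloor>log 2 (real p)\<rfloor> = k + 1" by blast
  have sets: "\<exists>L\<in>set (listed_sets p). affine_equiv p (colors D C) (set L)"
    if "knot K \<and> diagram_of K D \<and> nontrivial_dehn_coloring p D C \<and>
      card (colors D C) = nat \<lfloor>log 2 (real p)\<rfloor> + 2" for K D C
    using palette_bounds(3)[OF assms(1) p2 k] that by blast
  note bounds = palette_bounds(1,2)[OF assms(1) p2 k]
  show ?thesis
  proof (rule conjI[OF bounds(1) conjI[OF bounds(2)]], assumption+)
  qed (intro allI impI conjI; drule sets; simp add: listed_sets_def)
qed

end
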